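(* Let $\{X_i\}_{i\ge1}$ be i.i.d. symmetric random variables with $P(X_1=0)=0$, belonging to the domain of attraction of the $N(0,1)$ distribution. Let $S_j=\sum_{i=1}^j X_i$, $V_j=(\sum_{i=1}^j X_i^2)^{1/2}$ and $Y_j=S_j/V_j$. For each $n\ge1$ define the continuous process $Y^n(\cdot)$ on $[0,\infty)$ by $Y^n(0)=Y_n$, $Y^n\big(\sum_{j=n+1}^{l}\frac{1}{j}\big)=Y_l$ for $l\ge n+1$, and by linear interpolation between consecutive such time points. Then $Y^n$ (restricted to $[0,1]$) converges weakly in $C[0,1]$ to the stationary Ornstein–Uhlenbeck process, i.e. the stationary centered Gaussian process with covariance function $e^{-\frac12|t-s|}$.
   Context: A random variable $X$ is in the domain of attraction of $N(0,1)$ if there exist constants $a_n>0$ such that $(X_1+\cdots+X_n)/a_n$ converges in distribution to $N(0,1)$ for i.i.d. copies $X_i$ of $X$ (no centering is needed here since $X$ is symmetric). *)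

theory Defs
  imports "HOL-Probability.Probability"
begin

definition S_sum :: "(nat \<Rightarrow> 'a \<Rightarrow> real) \<Rightarrow> nat \<Rightarrow> 'a \<Rightarrow> real" where
  "S_sum X j \<omega> = (\<Sum>i\<in>{1..j}. X i \<omega>)"

definition V_sum :: "(nat \<Rightarrow> 'a \<Rightarrow> real) \<Rightarrow> nat \<Rightarrow> 'a \<Rightarrow> real" where
  "V_sum X j \<omega> = sqrt (\<Sum>i\<in>{1..j}. (X i \<omega>)\<^sup>2)"

definition Y_self :: "(nat \<Rightarrow> 'a \<Rightarrow> real) \<Rightarrow> nat \<Rightarrow> 'a \<Rightarrow> real" where
  "Y_self X j \<omega> = S_sum X j \<omega> / V_sum X j \<omega>"

definition tau :: "nat \<Rightarrow> nat \<Rightarrow> real" where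
  "tau n l = (\<Sum>j\<in>{n+1..l}. 1 / real j)"

text \<open>The interpolated process Y^n: Y^n(tau n l) = Y_l for l >= n, linear in between.
  For t >= 0, the relevant segment index is the least l >= n with t < tau n (l+1).\<close>

definition Yproc :: "(nat \<Rightarrow> 'a \<Rightarrow> real) \<Rightarrow> nat \<Rightarrow> 'a \<Rightarrow> real \<Rightarrow> real" where
  "Yproc X n \<omega> t =
     (let l = (LEAST l. n \<le> l \<and> t < tau n (Suc l))
      in Y_self X l \<omega> + (t - tau n l) / (tau n (Suc l) - tau n l)
                         * (Y_self X (Suc l) \<omega> - Y_self X l \<omega>))"

text \<open>Domain of attraction of N(0,1) (symmetric case, no centering).\<close>

definition in_DA_normal :: "'a measure \<Rightarrow> (nat \<Rightarrow> 'a \<Rightarrow> real) \<Rightarrow> bool" where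
  "in_DA_normal M X \<longleftrightarrow>
     (\<exists>a :: nat \<Rightarrow> real. (\<forall>n. a n > 0) \<and>
        weak_conv_m (\<lambda>n. distr M borel (\<lambda>\<omega>. S_sum X n \<omega> / a n)) std_normal_distribution)"

definition C01 :: "(real \<Rightarrow> real) set" where
  "C01 = {f. continuous_on {0..1} f}"

definition sup01 :: "(real \<Rightarrow> real) \<Rightarrow> (real \<Rightarrow> real) \<Rightarrow> real" where
  "sup01 f g = (SUP t\<in>{0..1}. \<bar>f t - g t\<bar>)"

definition bcont_C01 :: "((real \<Rightarrow> real) \<Rightarrow> real) \<Rightarrow> bool" where
  "bcont_C01 F \<longleftrightarrow>
     (\<exists>B. \<forall>f\<in>C01. \<bar>F f\<bar> \<le> B) \<and>
     (\<forall>f\<in>C01. \<forall>e>0. \<exists>d>0. \<forall>g\<in>C01. sup01 f g < d \<longrightarrow> \<bar>F f - F g\<bar> < e)"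

definition weak_conv_C01 ::
  "'a measure \<Rightarrow> (nat \<Rightarrow> 'a \<Rightarrow> real \<Rightarrow> real) \<Rightarrow> 'b measure \<Rightarrow> ('b \<Rightarrow> real \<Rightarrow> real) \<Rightarrow> bool" where
  "weak_conv_C01 M P Q Z \<longleftrightarrow>
     (\<forall>F. bcont_C01 F \<longrightarrow>
        (\<lambda>n. \<integral>\<omega>. F (P n \<omega>) \<partial>M) \<longlonglongrightarrow> (\<integral>\<omega>. F (Z \<omega>) \<partial>Q))"

text \<open>Stationary Ornstein-Uhlenbeck process on [0,1]: continuous paths, centered Gaussian
  with covariance exp(-|t-s|/2); Gaussianity expressed by every finite linear combination
  sum c_i Z(t_i) having the N(0, sum c_i c_j K(t_i,t_j)) characteristic function.\<close>

definition stationary_OU :: "'b measure \<Rightarrow> (real \<Rightarrow> 'b \<Rightarrow> real) \<Rightarrow> bool" where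
  "stationary_OU Q Z \<longleftrightarrow> prob_space Q \<and>
     (\<forall>t\<in>{0..1}. Z t \<in> borel_measurable Q) \<and>
     (\<forall>\<omega>\<in>space Q. continuous_on {0..1} (\<lambda>t. Z t \<omega>)) \<and>
     (\<forall>(k::nat) (ts::nat \<Rightarrow> real) (c::nat \<Rightarrow> real). (\<forall>i<k. ts i \<in> {0..1}) \<longrightarrow>
        (let v = (\<Sum>i<k. \<Sum>j<k. c i * c j * exp (- \<bar>ts i - ts j\<bar> / 2)) in
         char (distr Q borel (\<lambda>\<omega>. \<Sum>i<k. c i * Z (ts i) \<omega>))
           = (\<lambda>\<theta>. complex_of_real (exp (- v * \<theta>\<^sup>2 / 2)))))"

end

theory Submission
  imports Defs
begin

text \<open>
  Let \<open>\<phi>\<close> be the (real) characteristic function of \<open>X 1\<close>. Convergence of \<open>S_n / a_n\<close> to \<open>N(0,1)\<close>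
  gives \<open>n (1 - \<phi>(t / a_n)) \<rightarrow> t\<^sup>2 / 2\<close> for small \<open>t\<close>, and
  \<open>(1 - cos u)\<^sup>2 = 2 (1 - cos u) - (1 - cos 2u) / 2\<close> cancels these limits. Averaging over \<open>t\<close> shows
  that \<open>X_j / a_n\<close>, clipped at level \<open>1\<close>, has fourth moment \<open>o(1/n)\<close> but second moment at least \<open>c/n\<close>.
  With high probability \<open>X_1, \<dots>, X_{3n}\<close> are therefore proportional to a row \<open>\<xi>_j\<close> of bounded i.i.d.
  symmetric variables with variance \<open>1/n\<close> and fourth moment \<open>o(1/n)\<close>, and \<open>Y\<close> does not see the factor
  of proportionality.

  Ottaviani's inequality gives \<open>\<Sum>\<^bsub>j\<le>l\<^esub> \<xi>_j\<^sup>2 \<approx> l/n\<close> uniformly in \<open>l \<le> 3n\<close>, so that \<open>Y_l\<close> is uniformly close to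
  \<open>(\<Sum>\<^bsub>j\<le>l\<^esub> \<xi>_j) / \<surd>(l/n)\<close>. At \<open>l \<approx> n e\<^sup>t\<close> this is a time-changed and rescaled random walk: its
  characteristic functions give the covariance \<open>exp (- |t - s| / 2)\<close>, and fourth moments over blocks
  give tightness. The passage to \<open>C[0,1]\<close> replaces a continuous functional by its Lipschitz envelopes
  and evaluates these on piecewise linear interpolations.
\<close>

section \<open>Properties that hold up to a small probability\<close>

text \<open>The variance of \<open>X 1\<close> may be infinite and of the norming constants only
  positivity is known, so every moment estimate is extracted from characteristic functions. A single
  t cannot control the tail, because (1 - cos (t y))^2 vanishes along a lattice of y; its average
  over t in [0,1] stays away from 0 for large y. Clipping instead of truncating lets one quantity,
  the fourth moment, bound both the error in the normal approximation and the probability that one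
  of the first 3n variables is altered. The range 3n suffices because times up to 1 belong to
  indices near n e^t, and e < 3.

  Weak convergence is tested on functionals constrained on \<open>C01\<close> only, with no
  sigma-algebra on path space given beforehand; so measurability of the composed functionals has to
  be proved, and finite-dimensional convergence is carried by cosines with arbitrary phase. Uniform
  statements over real times need not describe measurable events, so \<open>holds_up_to\<close> asks
  for a measurable exceptional set of small measure.\<close>

definition holds_up_to :: "'a measure \<Rightarrow> real \<Rightarrow> ('a \<Rightarrow> bool) \<Rightarrow> bool" where
  "holds_up_to M d P \<longleftrightarrow> (\<exists>A\<in>sets M. measure M A \<le> d \<and> (\<forall>\<omega>\<in>space M - A. P \<omega>))"

lemma holds_up_to_mono:
  assumes "holds_up_to M a P" "a \<le> b" "\<And>\<omega>. \<omega> \<in> space M \<Longrightarrow> P \<omega> \<Longrightarrow> P' \<omega>"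
  shows "holds_up_to M b P'"
  using assms unfolding holds_up_to_def by (meson DiffD1 order.trans)

lemma holds_up_to_complement:
  assumes "{\<omega>\<in>space M. \<not> P \<omega>} \<in> sets M" "measure M {\<omega>\<in>space M. \<not> P \<omega>} \<le> d"
  shows "holds_up_to M d P"
  using assms unfolding holds_up_to_def by (intro bexI[of _ "{\<omega>\<in>space M. \<not> P \<omega>}"]) auto

lemma holds_up_to_conj:
  assumes "holds_up_to M a P" "holds_up_to M b P'"
  shows "holds_up_to M (a + b) (\<lambda>\<omega>. P \<omega> \<and> P' \<omega>)"
proof -
  obtain A B where A: "A \<in> sets M" "measure M A \<le> a" "\<forall>\<omega>\<in>space M - A. P \<omega>"
    and B: "B \<in> sets M" "measure M B \<le> b" "\<forall>\<omega>\<in>space M - B. P' \<omega>"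
    using assms unfolding holds_up_to_def by blast
  show ?thesis
    unfolding holds_up_to_def
    by (rule bexI[of _ "A \<union> B"]) (use A B measure_Un_le[of A M B] in auto)
qed

lemma holds_up_to_all:
  assumes "\<And>i. i < k \<Longrightarrow> holds_up_to M d (P i)"
  shows "holds_up_to M (real k * d) (\<lambda>\<omega>. \<forall>i<k. P i \<omega>)"
  using assms
proof (induction k)
  case 0
  then show ?case unfolding holds_up_to_def by (intro bexI[of _ "{}"]) auto
next
  case (Suc k)
  have "holds_up_to M (real k * d + d) (\<lambda>\<omega>. (\<forall>i<k. P i \<omega>) \<and> P k \<omega>)"
    using Suc by (intro holds_up_to_conj) auto
  then show ?case by (rule holds_up_to_mono) (auto simp: algebra_simps less_Suc_eq)
qed

section \<open>Hat functions and piecewise linear interpolation\<close>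

definition hat :: "real \<Rightarrow> real" where
  "hat u = max 0 (1 - \<bar>u\<bar>)"

lemma hat_nonneg [simp]: "0 \<le> hat u"
  and hat_le_1 [simp]: "hat u \<le> 1"
  by (auto simp: hat_def)

lemma hat_eq_0: "1 \<le> \<bar>u\<bar> \<Longrightarrow> hat u = 0"
  by (auto simp: hat_def)

lemma continuous_on_hat [continuous_intros]:
  "continuous_on A f \<Longrightarrow> continuous_on A (\<lambda>x. hat (f x))"
  unfolding hat_def by (intro continuous_intros)

text \<open>Only the two integers around u carry weight, and their tents add up to 1. If u equals
  the right end b, the upper neighbour falls outside the range, but its tent vanishes.\<close>

lemma sum_hat:
  assumes "real_of_int a \<le> u" "u \<le> real_of_int b"
  shows "(\<Sum>p\<in>{a..b}. hat (u - real_of_int p)) = 1"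
proof -
  define q where "q = \<lfloor>u\<rfloor>"
  have q: "real_of_int q \<le> u" "u < real_of_int q + 1"
    unfolding q_def by linarith+
  have z: "hat (u - real_of_int p) = 0" if "p \<noteq> q" "p \<noteq> q + 1" for p
  proof (rule hat_eq_0)
    have "p \<le> q - 1 \<or> p \<ge> q + 2" using that by linarith
    then show "1 \<le> \<bar>u - real_of_int p\<bar>" using q by linarith
  qed
  have aq: "a \<le> q" using assms(1) q_def by linarith
  show ?thesis
  proof (cases "q + 1 \<le> b")
    case True
    have "(\<Sum>p\<in>{a..b}. hat (u - real_of_int p)) = (\<Sum>p\<in>{q, q+1}. hat (u - real_of_int p))"
      by (rule sum.mono_neutral_right) (use aq True z in auto)
    also have "\<dots> = 1"
      using q by (simp add: hat_def)
    finally show ?thesis .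
  next
    case False
    then have qb: "q = b" using assms(2) q by linarith
    then have uq: "u = q" using assms(2) q by linarith
    have "(\<Sum>p\<in>{a..b}. hat (u - real_of_int p)) = (\<Sum>p\<in>{q}. hat (u - real_of_int p))"
      by (rule sum.mono_neutral_right) (use aq qb z in auto)
    also have "\<dots> = 1"
      using uq by (simp add: hat_def)
    finally show ?thesis .
  qed
qed

text \<open>P is enlarged to an integer interval that also brackets u, where the tents sum to
  1.\<close>

lemma sum_hat_le_1: "finite P \<Longrightarrow> (\<Sum>p\<in>P. hat (u - real_of_int p)) \<le> 1"
proof -
  assume P: "finite P"
  define a where "a = min \<lfloor>u\<rfloor> (Min (insert 0 P))"
  define b where "b = max \<lceil>u\<rceil> (Max (insert 0 P))"
  have "P \<subseteq> {a..b}"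
    using P by (auto simp: a_def b_def min_le_iff_disj le_max_iff_disj)
  then have "(\<Sum>p\<in>P. hat (u - real_of_int p)) \<le> (\<Sum>p\<in>{a..b}. hat (u - real_of_int p))"
    by (intro sum_mono2) auto
  also have "\<dots> = 1"
    by (rule sum_hat) (auto simp: a_def b_def le_max_iff_disj min_le_iff_disj, linarith+)
  finally show ?thesis .
qed

lemma sum_hat_nat:
  assumes "0 \<le> u" "u \<le> real m"
  shows "(\<Sum>i\<le>m. hat (u - real i)) = 1"
proof -
  have "(\<Sum>i\<le>m. hat (u - real i)) = (\<Sum>p\<in>{0..int m}. hat (u - real_of_int p))"
    by (rule sum.reindex_bij_witness[of _ nat int]) auto
  also have "\<dots> = 1" using assms by (intro sum_hat) auto
  finally show ?thesis .
qed

text \<open>On [0,1] this is the polygon through the points (i/m, \<open>v i\<close>), written in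
  the tent basis. For m = 0 it is the constant \<open>v 0\<close>.\<close>

definition interp :: "nat \<Rightarrow> (nat \<Rightarrow> real) \<Rightarrow> real \<Rightarrow> real" where
  "interp m v t = (\<Sum>i\<le>m. v i * hat (real m * t - real i))"

lemma interp_in_C01: "interp m v \<in> C01"
  unfolding C01_def interp_def by (auto intro!: continuous_intros)

text \<open>On [0,1] the tents form a partition of unity, so the value at t is a convex combination
  of the nodes nearer than one mesh width.\<close>

lemma interp_close:
  assumes "t \<in> {0..1}" "\<And>i. i \<le> m \<Longrightarrow> \<bar>real m * t - real i\<bar> < 1 \<Longrightarrow> \<bar>v i - c\<bar> \<le> e"
  shows "\<bar>interp m v t - c\<bar> \<le> e"
proof -
  have s: "(\<Sum>i\<le>m. hat (real m * t - real i)) = 1"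
    using assms(1) by (intro sum_hat_nat) (auto simp: mult_left_le)
  have "interp m v t - c = (\<Sum>i\<le>m. (v i - c) * hat (real m * t - real i))"
    unfolding interp_def left_diff_distrib sum_subtractf
    using s by (simp flip: sum_distrib_left)
  also have "\<bar>\<dots>\<bar> \<le> (\<Sum>i\<le>m. e * hat (real m * t - real i))"
  proof (intro order.trans[OF sum_abs] sum_mono)
    fix i assume i: "i \<in> {..m}"
    show "\<bar>(v i - c) * hat (real m * t - real i)\<bar> \<le> e * hat (real m * t - real i)"
    proof (cases "\<bar>real m * t - real i\<bar> < 1")
      case True
      then show ?thesis using assms(2)[of i] i by (auto simp: abs_mult intro!: mult_right_mono)
    next
      case False
      then show ?thesis by (simp add: hat_eq_0)
    qed
  qed
  also have "\<dots> = e" using s by (simp flip: sum_distrib_left)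
  finally show ?thesis .
qed

lemma interp_diff_le:
  assumes "t \<in> {0..1}" "\<And>i. i \<le> m \<Longrightarrow> \<bar>v i - w i\<bar> \<le> e"
  shows "\<bar>interp m v t - interp m w t\<bar> \<le> e"
proof -
  have "\<bar>interp m (\<lambda>i. v i - w i) t - 0\<bar> \<le> e"
    using assms by (intro interp_close) auto
  then show ?thesis
    by (simp add: interp_def left_diff_distrib sum_subtractf)
qed

section \<open>The uniform distance and bounded continuous functionals\<close>

lemma bdd_sup01:
  assumes "f \<in> C01" "g \<in> C01"
  shows "bdd_above ((\<lambda>t. \<bar>f t - g t\<bar>) ` {0..1})"
proof -
  have "compact ((\<lambda>t. \<bar>f t - g t\<bar>) ` {0..1})"
    using assms unfolding C01_def
    by (intro compact_continuous_image continuous_intros) auto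
  then show ?thesis by (rule bounded_imp_bdd_above[OF compact_imp_bounded])
qed

lemma sup01_upper: "f \<in> C01 \<Longrightarrow> g \<in> C01 \<Longrightarrow> t \<in> {0..1} \<Longrightarrow> \<bar>f t - g t\<bar> \<le> sup01 f g"
  unfolding sup01_def by (rule cSUP_upper[OF _ bdd_sup01])

lemma sup01_least: "(\<And>t. t \<in> {0..1} \<Longrightarrow> \<bar>f t - g t\<bar> \<le> e) \<Longrightarrow> sup01 f g \<le> e"
  unfolding sup01_def by (rule cSUP_least) auto

lemma sup01_nonneg: "f \<in> C01 \<Longrightarrow> g \<in> C01 \<Longrightarrow> 0 \<le> sup01 f g"
  using sup01_upper[of f g 0] by force

lemma sup01_commute: "sup01 f g = sup01 g f"
  unfolding sup01_def by (simp add: abs_minus_commute)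

lemma sup01_refl [simp]: "sup01 f f = 0"
  unfolding sup01_def by simp

lemma sup01_triangle:
  assumes "f \<in> C01" "g \<in> C01" "h \<in> C01"
  shows "sup01 f h \<le> sup01 f g + sup01 g h"
proof (rule sup01_least)
  fix t :: real assume "t \<in> {0..1}"
  then show "\<bar>f t - h t\<bar> \<le> sup01 f g + sup01 g h"
    using sup01_upper[of f g t] sup01_upper[of g h t] assms by linarith
qed

lemma bcont_C01_tendsto:
  assumes F: "bcont_C01 F" and f: "f \<in> C01" and g: "\<And>m. g m \<in> C01"
    and lim: "\<And>e. e > 0 \<Longrightarrow> \<forall>\<^sub>F m in sequentially. sup01 f (g m) \<le> e"
  shows "(\<lambda>m. F (g m)) \<longlonglongrightarrow> F f"
proof (rule tendstoI)
  fix e :: real assume "e > 0"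
  then obtain d where d: "d > 0" "\<And>h. h \<in> C01 \<Longrightarrow> sup01 f h < d \<Longrightarrow> \<bar>F f - F h\<bar> < e"
    using F f unfolding bcont_C01_def by metis
  have "\<forall>\<^sub>F m in sequentially. sup01 f (g m) \<le> d/2" using lim[of "d/2"] d by auto
  then show "\<forall>\<^sub>F m in sequentially. dist (F (g m)) (F f) < e"
    by eventually_elim (use d g in \<open>force simp: dist_real_def abs_minus_commute\<close>)
qed

lemma C01_modulus:
  assumes "f \<in> C01" "e > 0"
  obtains m0 where "\<And>m s t. m \<ge> m0 \<Longrightarrow> s \<in> {0..1} \<Longrightarrow> t \<in> {0..1} \<Longrightarrow>
     \<bar>real m * t - real m * s\<bar> < 1 \<Longrightarrow> \<bar>f t - f s\<bar> \<le> e"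
proof -
  have "uniformly_continuous_on {0..1} f"
    using assms(1) by (auto simp: C01_def intro: compact_uniformly_continuous)
  then obtain d where d: "d > 0"
    "\<And>s t. s \<in> {0..1} \<Longrightarrow> t \<in> {0..1} \<Longrightarrow> \<bar>t - s\<bar> < d \<Longrightarrow> \<bar>f t - f s\<bar> < e"
    using assms(2) unfolding uniformly_continuous_on_def dist_real_def by metis
  obtain m0 :: nat where m0: "1 / d < real m0" using reals_Archimedean2 by blast
  show thesis
  proof (rule that[of m0])
    fix m :: nat and s t :: real
    assume *: "m \<ge> m0" "s \<in> {0..1}" "t \<in> {0..1}" "\<bar>real m * t - real m * s\<bar> < 1"
    have "1 / d < real m" using m0 *(1) by linarith
    moreover have mpos: "real m > 0" using calculation d(1) by (smt (verit) divide_pos_pos)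
    ultimately have "1 / real m < d" using d(1) by (simp add: field_simps)
    moreover have "\<bar>t - s\<bar> * real m < 1"
      using *(4) mpos abs_mult[of "t - s" "real m"] by (simp add: algebra_simps)
    then have "\<bar>t - s\<bar> < 1 / real m" using mpos by (simp add: field_simps)
    ultimately show "\<bar>f t - f s\<bar> \<le> e" using d(2)[of s t] * by fastforce
  qed
qed

text \<open>The tolerance \<open>r m\<close> admits node values that agree with f only
  approximately; the measurability proof needs this because it rounds them.\<close>

lemma interp_tendsto_C01:
  assumes F: "bcont_C01 F" and f: "f \<in> C01"
    and v: "\<And>m i. i \<le> m \<Longrightarrow> \<bar>v m i - f (real i / real m)\<bar> \<le> r m" and r: "r \<longlonglongrightarrow> 0"
  shows "(\<lambda>m. F (interp m (v m))) \<longlonglongrightarrow> F f"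
proof (rule bcont_C01_tendsto[OF F f interp_in_C01])
  fix e :: real assume e: "e > 0"
  obtain m0 where m0: "\<And>m s t. m \<ge> m0 \<Longrightarrow> s \<in> {0..1} \<Longrightarrow> t \<in> {0..1} \<Longrightarrow>
     \<bar>real m * t - real m * s\<bar> < 1 \<Longrightarrow> \<bar>f t - f s\<bar> \<le> e/2"
    using C01_modulus[OF f, of "e/2"] e by auto
  have "\<forall>\<^sub>F m in sequentially. r m < e/2"
    using r e by (intro order_tendstoD) auto
  then show "\<forall>\<^sub>F m in sequentially. sup01 f (interp m (v m)) \<le> e"
    using eventually_ge_at_top[of "Suc m0"]
  proof eventually_elim
    case (elim m)
    show ?case unfolding sup01_commute[of f]
    proof (rule sup01_least, rule interp_close)
      fix t :: real and i assume t: "t \<in> {0..1}" and i: "i \<le> m" "\<bar>real m * t - real i\<bar> < 1"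
      have "\<bar>f t - f (real i / real m)\<bar> \<le> e/2"
        using t i elim by (intro m0[of m]) auto
      then show "\<bar>v m i - f t\<bar> \<le> e" using v[OF i(1)] elim by linarith
    qed auto
  qed
qed

text \<open>Values on the grid of mesh 1/m are rounded down to multiples of 1/m. The rounded data
  take countably many values, so every function of them is measurable, and the functional is a
  pointwise limit of such functions.\<close>

lemma measurable_bcont_C01:
  assumes F: "bcont_C01 F" and P: "\<And>\<omega>. \<omega> \<in> space M \<Longrightarrow> P \<omega> \<in> C01"
    and meas: "\<And>t. t \<in> {0..1} \<Longrightarrow> (\<lambda>\<omega>. P \<omega> t) \<in> borel_measurable M"
  shows "(\<lambda>\<omega>. F (P \<omega>)) \<in> borel_measurable M"
proof (rule borel_measurable_LIMSEQ_real)
  define fl where "fl m \<omega> = map (\<lambda>i. \<lfloor>real m * P \<omega> (real i / real m)\<rfloor>) [0..<Suc m]" for m \<omega>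
  define F' where "F' m xs = F (interp m (\<lambda>i. real_of_int (xs ! i) / real m))" for m and xs :: "int list"
  show "(\<lambda>m. F' m (fl m \<omega>)) \<longlonglongrightarrow> F (P \<omega>)" if "\<omega> \<in> space M" for \<omega>
    unfolding F'_def
  proof (rule interp_tendsto_C01[OF F P[OF that]])
    \<comment> \<open>For m = 0 the quotient is 0, as division by 0 yields 0; hence the separate
      error bound.\<close>
    show "\<bar>real_of_int (fl m \<omega> ! i) / real m - P \<omega> (real i / real m)\<bar> \<le> (if m = 0 then \<bar>P \<omega> 0\<bar> else 1 / real m)"
      if "i \<le> m" for m i
    proof (cases "m = 0")
      case False
      define x where "x = P \<omega> (real i / real m)"
      have 1: "fl m \<omega> ! i = \<lfloor>real m * x\<rfloor>"
        using that unfolding fl_def x_def by (subst nth_map) (auto simp del: upt_Suc)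
      have "\<bar>real_of_int \<lfloor>real m * x\<rfloor> - real m * x\<bar> \<le> 1" by linarith
      then have "\<bar>real_of_int \<lfloor>real m * x\<rfloor> - real m * x\<bar> / real m \<le> 1 / real m"
        by (intro divide_right_mono) auto
      also have "\<bar>real_of_int \<lfloor>real m * x\<rfloor> - real m * x\<bar> / real m = \<bar>real_of_int \<lfloor>real m * x\<rfloor> / real m - x\<bar>"
        using False by (simp add: field_simps abs_mult flip: abs_divide)
      finally show ?thesis using False 1 x_def by simp
    qed (use that in auto)
    show "(\<lambda>m. if m = 0 then \<bar>P \<omega> 0\<bar> else 1 / real m) \<longlonglongrightarrow> 0"
    proof (rule Lim_transform_eventually[OF lim_1_over_n])
      show "\<forall>\<^sub>F m in sequentially. 1 / real m = (if m = 0 then \<bar>P \<omega> 0\<bar> else 1 / real m)"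
        using eventually_gt_at_top[of 0] by eventually_elim auto
    qed
  qed
  show "(\<lambda>\<omega>. F' m (fl m \<omega>)) \<in> borel_measurable M" for m
  proof -
    have "fl m \<in> measurable M (count_space UNIV)"
    proof (subst measurable_count_space_eq2_countable, intro conjI ballI)
      fix xs :: "int list"
      show "fl m -` {xs} \<inter> space M \<in> sets M"
      proof (cases "length xs = Suc m")
        case True
        have "fl m -` {xs} \<inter> space M =
          {\<omega>\<in>space M. \<forall>i\<in>{..m}. \<lfloor>real m * P \<omega> (real i / real m)\<rfloor> = xs ! i}"
          using True unfolding fl_def
          by (auto simp: list_eq_iff_nth_eq less_Suc_eq_le simp del: upt_Suc)
        also have "\<dots> \<in> sets M"
        proof (intro sets.sets_Collect_finite_All')
          fix i assume "i \<in> {..m}"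
          then have [measurable]: "(\<lambda>\<omega>. P \<omega> (real i / real m)) \<in> borel_measurable M"
            by (intro meas) (auto simp: divide_le_eq_1)
          show "{\<omega>\<in>space M. \<lfloor>real m * P \<omega> (real i / real m)\<rfloor> = xs ! i} \<in> sets M"
            by measurable
        qed auto
        finally show ?thesis .
      next
        case False
        then have "fl m -` {xs} = {}" by (auto simp: fl_def)
        then show ?thesis by simp
      qed
    qed auto
    then show ?thesis by (rule measurable_compose) simp
  qed
qed

section \<open>Finite-dimensional convergence from characteristic functions\<close>

context prob_space
begin

text \<open>\<open>D\<close> is the law of y under the probability measure with density w / W.
  Expectations against a nonnegative weight thus become integrals with respect to a law on the line,
  to which Levy's theorem applies.\<close>

lemma
  fixes y w :: "'a \<Rightarrow> real" and f :: "real \<Rightarrow> real"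
  assumes [measurable]: "y \<in> borel_measurable M" "w \<in> borel_measurable M"
    and w: "\<And>\<omega>. 0 \<le> w \<omega>" "\<And>\<omega>. w \<omega> \<le> B"
  defines "W \<equiv> expectation w"
  defines "D \<equiv> distr (density M (\<lambda>\<omega>. ennreal (w \<omega> / W))) borel y"
  assumes W: "0 < W"
  shows real_distribution_weighted: "real_distribution D"
    and integral_weighted: "f \<in> borel_measurable borel \<Longrightarrow>
      (\<integral>x. f x \<partial>D) = expectation (\<lambda>\<omega>. w \<omega> * f (y \<omega>)) / W"
    and char_weighted: "char D t = Complex (expectation (\<lambda>\<omega>. w \<omega> * cos (t * y \<omega>)) / W)
      (expectation (\<lambda>\<omega>. w \<omega> * sin (t * y \<omega>)) / W)"
proof -
  have B: "0 \<le> B" using w[of undefined] by linarith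
  have ub: "\<bar>w \<omega>\<bar> \<le> B" for \<omega> using w[of \<omega>] by simp
  have iw: "integrable M w"
    by (rule integrable_const_bound[where B=B]) (use w in auto)
  have intD: "(\<integral>x. h x \<partial>D) = expectation (\<lambda>\<omega>. (w \<omega> / W) *\<^sub>R h (y \<omega>))"
    if [measurable]: "h \<in> borel_measurable borel" for h :: "real \<Rightarrow> 'c::{banach, second_countable_topology}"
    unfolding D_def using w W
    by (subst integral_distr, simp, simp, subst integral_density) (auto intro!: AE_I2 divide_nonneg_pos)
  have "prob_space (density M (\<lambda>\<omega>. ennreal (w \<omega> / W)))"
  proof (rule prob_spaceI)
    have "emeasure (density M (\<lambda>\<omega>. ennreal (w \<omega> / W))) (space (density M (\<lambda>\<omega>. ennreal (w \<omega> / W)))) =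
        (\<integral>\<^sup>+\<omega>. ennreal (w \<omega> / W) \<partial>M)"
      by (subst emeasure_density) (auto intro!: nn_integral_cong)
    also have "\<dots> = ennreal (expectation (\<lambda>\<omega>. w \<omega> / W))"
      using w W iw by (intro nn_integral_eq_integral) (auto intro!: AE_I2 divide_nonneg_pos)
    also have "\<dots> = 1" using W by (simp add: W_def)
    finally show "emeasure (density M (\<lambda>\<omega>. ennreal (w \<omega> / W))) (space (density M (\<lambda>\<omega>. ennreal (w \<omega> / W)))) = 1" .
  qed
  then show "real_distribution D"
    unfolding D_def by (rule prob_space.real_distribution_distr) simp
  show "(\<integral>x. f x \<partial>D) = expectation (\<lambda>\<omega>. w \<omega> * f (y \<omega>)) / W" if "f \<in> borel_measurable borel"
    by (simp add: intD[OF that])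
  have i: "integrable M (\<lambda>\<omega>. w \<omega> * cos (t * y \<omega>))" "integrable M (\<lambda>\<omega>. w \<omega> * sin (t * y \<omega>))"
    using B mult_mono[OF ub abs_cos_le_one] mult_mono[OF ub abs_sin_le_one]
    by (auto intro!: integrable_const_bound[where B=B] AE_I2 simp: abs_mult)
  have "char D t = expectation (\<lambda>\<omega>. (w \<omega> / W) *\<^sub>R iexp (t * y \<omega>))"
    unfolding char_def by (rule intD) simp
  also have "\<dots> = expectation (\<lambda>\<omega>. complex_of_real (w \<omega> * cos (t * y \<omega>) / W) + \<i> * complex_of_real (w \<omega> * sin (t * y \<omega>) / W))"
    by (intro Bochner_Integration.integral_cong) (auto simp: complex_eq_iff Re_exp Im_exp)
  also have "\<dots> = complex_of_real (expectation (\<lambda>\<omega>. w \<omega> * cos (t * y \<omega>) / W)) + \<i> * complex_of_real (expectation (\<lambda>\<omega>. w \<omega> * sin (t * y \<omega>) / W))"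
    using i by (subst Bochner_Integration.integral_add)
      (auto intro!: integrable_of_real simp del: of_real_divide of_real_mult)
  finally show "char D t = Complex (expectation (\<lambda>\<omega>. w \<omega> * cos (t * y \<omega>)) / W)
      (expectation (\<lambda>\<omega>. w \<omega> * sin (t * y \<omega>)) / W)" by (simp add: complex_eq_iff)
qed

lemma abs_weighted_le:
  fixes g w :: "'a \<Rightarrow> real"
  assumes [measurable]: "g \<in> borel_measurable M" "w \<in> borel_measurable M"
    and w: "\<And>\<omega>. 0 \<le> w \<omega>" "\<And>\<omega>. w \<omega> \<le> B" and g: "\<And>\<omega>. \<bar>g \<omega>\<bar> \<le> C"
  shows "\<bar>expectation (\<lambda>\<omega>. w \<omega> * g \<omega>)\<bar> \<le> expectation w * C"
proof -
  have "integrable M w"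
    by (rule integrable_const_bound[where B=B]) (use w in auto)
  moreover have "\<bar>w \<omega> * g \<omega>\<bar> \<le> w \<omega> * C" for \<omega>
    using w g[of \<omega>] by (auto simp: abs_mult intro!: mult_left_mono)
  ultimately have "\<bar>expectation (\<lambda>\<omega>. w \<omega> * g \<omega>)\<bar> \<le> expectation (\<lambda>\<omega>. w \<omega> * C)"
    by (intro order.trans[OF integral_abs_bound] integral_mono
         Bochner_Integration.integrable_bound[of M "\<lambda>\<omega>. w \<omega> * C" "\<lambda>\<omega>. \<bar>w \<omega> * g \<omega>\<bar>"])
       (auto intro!: AE_I2 intro: order.trans[OF _ abs_ge_self])
  then show ?thesis by simp
qed

end

text \<open>Cosine convergence at t = 0 is convergence of the total weights. If the limit weight is
  positive, the normalized laws converge and the normalization is undone at the end; if it is 0, the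
  integrals are bounded by C times weights that tend to 0.\<close>

lemma weighted_levy_continuity:
  fixes y :: "nat \<Rightarrow> 'a \<Rightarrow> real" and w :: "nat \<Rightarrow> 'a \<Rightarrow> real"
    and y' :: "'b \<Rightarrow> real" and w' :: "'b \<Rightarrow> real" and f :: "real \<Rightarrow> real"
  assumes M: "prob_space M" and Q: "prob_space Q"
    and meas: "\<And>n. y n \<in> borel_measurable M" "\<And>n. w n \<in> borel_measurable M"
      "y' \<in> borel_measurable Q" "w' \<in> borel_measurable Q"
    and w: "\<And>n \<omega>. 0 \<le> w n \<omega>" "\<And>n \<omega>. w n \<omega> \<le> B" and w': "\<And>\<omega>. 0 \<le> w' \<omega>" "\<And>\<omega>. w' \<omega> \<le> B"
    and conv_cos: "\<And>t. (\<lambda>n. \<integral>\<omega>. w n \<omega> * cos (t * y n \<omega>) \<partial>M) \<longlonglongrightarrow> (\<integral>\<omega>. w' \<omega> * cos (t * y' \<omega>) \<partial>Q)"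
    and conv_sin: "\<And>t. (\<lambda>n. \<integral>\<omega>. w n \<omega> * sin (t * y n \<omega>) \<partial>M) \<longlonglongrightarrow> (\<integral>\<omega>. w' \<omega> * sin (t * y' \<omega>) \<partial>Q)"
    and f: "continuous_on UNIV f" "\<And>x. \<bar>f x\<bar> \<le> C"
  shows "(\<lambda>n. \<integral>\<omega>. w n \<omega> * f (y n \<omega>) \<partial>M) \<longlonglongrightarrow> (\<integral>\<omega>. w' \<omega> * f (y' \<omega>) \<partial>Q)"
proof -
  interpret M: prob_space M by fact
  interpret Q: prob_space Q by fact
  note [measurable] = meas
  have mf [measurable]: "f \<in> borel_measurable borel" using f(1) by (rule borel_measurable_continuous_onI)
  define W where "W n = (\<integral>\<omega>. w n \<omega> \<partial>M)" for n
  define W' where "W' = (\<integral>\<omega>. w' \<omega> \<partial>Q)"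
  have WW': "W \<longlonglongrightarrow> W'"
    using conv_cos[of 0] unfolding W_def[abs_def] W'_def by simp
  have leM: "\<bar>\<integral>\<omega>. w n \<omega> * f (y n \<omega>) \<partial>M\<bar> \<le> W n * C" for n
    unfolding W_def by (rule M.abs_weighted_le[OF _ _ w]) (use f in auto)
  have leQ: "\<bar>\<integral>\<omega>. w' \<omega> * f (y' \<omega>) \<partial>Q\<bar> \<le> W' * C"
    unfolding W'_def by (rule Q.abs_weighted_le[OF _ _ w']) (use f in auto)
  have "0 \<le> W'" unfolding W'_def using w' by (intro Bochner_Integration.integral_nonneg) auto
  then consider "W' = 0" | "W' > 0" by linarith
  then show ?thesis
  proof cases
    case 1
    have "(\<lambda>n. \<integral>\<omega>. w n \<omega> * f (y n \<omega>) \<partial>M) \<longlonglongrightarrow> 0"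
    proof (rule Lim_null_comparison)
      show "(\<lambda>n. W n * C) \<longlonglongrightarrow> 0" using WW' 1 by (intro tendsto_mult_left_zero) auto
    qed (use leM in auto)
    then show ?thesis using leQ 1 by simp
  next
    case 2
    \<comment> \<open>Weights can be normalized only once they are positive, so the laws
      \<open>D\<close> are indexed from n0 on.\<close>
    have "\<forall>\<^sub>F n in sequentially. W n > 0" using WW' 2 by (rule order_tendstoD)
    then obtain n0 where n0: "\<And>n. n \<ge> n0 \<Longrightarrow> W n > 0"
      by (auto simp: eventually_sequentially)
    then have Wk: "W (k + n0) > 0" for k by simp
    define D where "D k = distr (density M (\<lambda>\<omega>. ennreal (w (k + n0) \<omega> / W (k + n0)))) borel (y (k + n0))" for k
    define D' where "D' = distr (density Q (\<lambda>\<omega>. ennreal (w' \<omega> / W'))) borel y'"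
    have D: "real_distribution (D k)" for k
      unfolding D_def W_def by (rule M.real_distribution_weighted[OF meas(1,2) w Wk[unfolded W_def]])
    have D': "real_distribution D'"
      unfolding D'_def W'_def by (rule Q.real_distribution_weighted[OF meas(3,4) w' 2[unfolded W'_def]])
    have char_D: "char (D k) t = Complex ((\<integral>\<omega>. w (k + n0) \<omega> * cos (t * y (k + n0) \<omega>) \<partial>M) / W (k + n0))
        ((\<integral>\<omega>. w (k + n0) \<omega> * sin (t * y (k + n0) \<omega>) \<partial>M) / W (k + n0))" for k t
      unfolding D_def W_def by (rule M.char_weighted[OF meas(1,2) w Wk[unfolded W_def]])
    note char_D' = Q.char_weighted[OF meas(3,4) w' 2[unfolded W'_def], folded W'_def, folded D'_def]
    have int_D: "(\<integral>x. f x \<partial>D k) = (\<integral>\<omega>. w (k + n0) \<omega> * f (y (k + n0) \<omega>) \<partial>M) / W (k + n0)" for k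
      unfolding D_def W_def by (rule M.integral_weighted[OF meas(1,2) w Wk[unfolded W_def] mf])
    note int_D' = Q.integral_weighted[OF meas(3,4) w' 2[unfolded W'_def] mf, folded W'_def, folded D'_def]
    have "weak_conv_m D D'"
    proof (rule levy_continuity[OF D D'])
      show "(\<lambda>k. char (D k) t) \<longlonglongrightarrow> char D' t" for t
        unfolding char_D char_D' using 2
        by (intro tendsto_Complex tendsto_divide LIMSEQ_ignore_initial_segment[OF conv_cos]
            LIMSEQ_ignore_initial_segment[OF conv_sin] LIMSEQ_ignore_initial_segment[OF WW']) auto
    qed
    then have "(\<lambda>k. \<integral>x. f x \<partial>D k) \<longlonglongrightarrow> (\<integral>x. f x \<partial>D')"
      by (rule weak_conv_imp_integral_bdd_continuous_conv[OF D D', where B=C])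
         (use f in \<open>auto simp: continuous_on_eq_continuous_at\<close>)
    then have "(\<lambda>k. (\<integral>\<omega>. w (k + n0) \<omega> * f (y (k + n0) \<omega>) \<partial>M) / W (k + n0) * W (k + n0)) \<longlonglongrightarrow>
       (\<integral>\<omega>. w' \<omega> * f (y' \<omega>) \<partial>Q) / W' * W'"
      unfolding int_D int_D' by (intro tendsto_mult LIMSEQ_ignore_initial_segment[OF WW'])
    moreover have "W (k + n0) \<noteq> 0" for k using Wk[of k] by simp
    ultimately have "(\<lambda>k. \<integral>\<omega>. w (k + n0) \<omega> * f (y (k + n0) \<omega>) \<partial>M) \<longlonglongrightarrow> (\<integral>\<omega>. w' \<omega> * f (y' \<omega>) \<partial>Q)"
      using 2 by simp
    then show ?thesis by (rule LIMSEQ_offset)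
  qed
qed

section \<open>From cosines to products of test functions\<close>

lemma cos_product_weight:
  "(1 + cos (a + r)) * cos (b + u :: real) =
     cos (b + u) + (cos ((a + b) + (u + r)) + cos ((a - b) + (- u + r))) / 2"
  by (simp add: cos_add sin_add cos_diff sin_diff field_simps)

text \<open>A cosine changes sign and cannot serve as a weight, but 1 + cos can. Product-to-sum
  formulas express the cosine transform of y under this weight by unweighted cosines with other
  phases and coefficients. Shifting the phase by pi and subtracting recovers the bare cosine, as (1
  + cos x) - (1 + cos (x + pi)) = 2 cos x.\<close>

lemma (in prob_space)
  fixes p r y g :: "'a \<Rightarrow> real"
  assumes [measurable]: "p \<in> borel_measurable M" "r \<in> borel_measurable M"
    and p: "\<And>\<omega>. 0 \<le> p \<omega>" "\<And>\<omega>. p \<omega> \<le> 1"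
  shows expectation_cos_product_weight: "y \<in> borel_measurable M \<Longrightarrow>
      expectation (\<lambda>\<omega>. p \<omega> * (1 + cos (a + r \<omega>)) * cos (b + t * y \<omega>)) = expectation (\<lambda>\<omega>. p \<omega> * cos (b + t * y \<omega>)) +
      (expectation (\<lambda>\<omega>. p \<omega> * cos ((a + b) + (t * y \<omega> + r \<omega>)))
       + expectation (\<lambda>\<omega>. p \<omega> * cos ((a - b) + ((- t) * y \<omega> + r \<omega>)))) / 2"
    and expectation_weight_difference: "g \<in> borel_measurable M \<Longrightarrow> (\<And>\<omega>. 0 \<le> g \<omega>) \<Longrightarrow> (\<And>\<omega>. g \<omega> \<le> 1) \<Longrightarrow>
      expectation (\<lambda>\<omega>. p \<omega> * g \<omega> * cos (a + r \<omega>)) =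
      (expectation (\<lambda>\<omega>. p \<omega> * (1 + cos (a + r \<omega>)) * g \<omega>) - expectation (\<lambda>\<omega>. p \<omega> * (1 + cos (a + pi + r \<omega>)) * g \<omega>)) / 2"
proof -
  have ip: "integrable M (\<lambda>\<omega>. p \<omega> * h \<omega>)" if [measurable]: "h \<in> borel_measurable M" and "\<And>\<omega>. \<bar>h \<omega>\<bar> \<le> 2" for h
    using mult_mono[OF p(2) that(2)] p(1)
    by (intro integrable_const_bound[where B=2]) (auto simp: abs_mult intro!: AE_I2)
  show "expectation (\<lambda>\<omega>. p \<omega> * (1 + cos (a + r \<omega>)) * cos (b + t * y \<omega>)) = expectation (\<lambda>\<omega>. p \<omega> * cos (b + t * y \<omega>)) +
      (expectation (\<lambda>\<omega>. p \<omega> * cos ((a + b) + (t * y \<omega> + r \<omega>)))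
       + expectation (\<lambda>\<omega>. p \<omega> * cos ((a - b) + ((- t) * y \<omega> + r \<omega>)))) / 2"
    if [measurable]: "y \<in> borel_measurable M"
  proof -
    have i: "integrable M (\<lambda>\<omega>. p \<omega> * cos (h \<omega>))" if "h \<in> borel_measurable M" for h
      using that by (intro ip) (auto intro: order.trans[OF abs_cos_le_one])
    have "expectation (\<lambda>\<omega>. p \<omega> * (1 + cos (a + r \<omega>)) * cos (b + t * y \<omega>)) =
       expectation (\<lambda>\<omega>. p \<omega> * cos (b + t * y \<omega>) + (p \<omega> * cos ((a + b) + (t * y \<omega> + r \<omega>))
         + p \<omega> * cos ((a - b) + ((- t) * y \<omega> + r \<omega>))) / 2)"
      unfolding mult.assoc cos_product_weight
      by (intro Bochner_Integration.integral_cong) (auto simp: algebra_simps)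
    then show ?thesis
      by (simp add: Bochner_Integration.integral_add i del: mult_minus_left)
  qed
  show "expectation (\<lambda>\<omega>. p \<omega> * g \<omega> * cos (a + r \<omega>)) =
      (expectation (\<lambda>\<omega>. p \<omega> * (1 + cos (a + r \<omega>)) * g \<omega>) - expectation (\<lambda>\<omega>. p \<omega> * (1 + cos (a + pi + r \<omega>)) * g \<omega>)) / 2"
    if [measurable]: "g \<in> borel_measurable M" and g: "\<And>\<omega>. 0 \<le> g \<omega>" "\<And>\<omega>. g \<omega> \<le> 1"
  proof -
    have c: "0 \<le> 1 + cos x" "1 + cos x \<le> 2" for x :: real
      using cos_ge_minus_one[of x] cos_le_one[of x] by linarith+
    have i: "integrable M (\<lambda>\<omega>. p \<omega> * (1 + cos (c + r \<omega>)) * g \<omega>)" for c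
      unfolding mult.assoc using mult_mono[OF c(2) g(2) _ g(1)] g(1) c(1)
      by (intro ip) (auto simp: abs_mult)
    have "expectation (\<lambda>\<omega>. p \<omega> * (1 + cos (a + r \<omega>)) * g \<omega>) - expectation (\<lambda>\<omega>. p \<omega> * (1 + cos (a + pi + r \<omega>)) * g \<omega>) =
      expectation (\<lambda>\<omega>. p \<omega> * (1 + cos (a + r \<omega>)) * g \<omega> - p \<omega> * (1 + cos (a + pi + r \<omega>)) * g \<omega>)"
      by (rule Bochner_Integration.integral_diff[symmetric, OF i i])
    also have "\<dots> = expectation (\<lambda>\<omega>. 2 * (p \<omega> * g \<omega> * cos (a + r \<omega>)))"
      by (intro Bochner_Integration.integral_cong) (auto simp: algebra_simps cos_add sin_add)
    finally show ?thesis by simp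
  qed
qed

text \<open>The exponentials are replaced by the test functions \<open>f i\<close> one coordinate at a time: the factors
  already treated, together with \<open>1 + cos (\<dots>)\<close> of the coordinates still to come, are a nonnegative
  weight, to which the one-dimensional continuity theorem applies.\<close>

lemma fdd_convergence_aux:
  fixes Y :: "nat \<Rightarrow> nat \<Rightarrow> 'a \<Rightarrow> real" and Z :: "nat \<Rightarrow> 'b \<Rightarrow> real" and f :: "nat \<Rightarrow> real \<Rightarrow> real"
  assumes M: "prob_space M" and Q: "prob_space Q"
    and mY: "\<And>n i. i < k \<Longrightarrow> Y n i \<in> borel_measurable M"
    and mZ: "\<And>i. i < k \<Longrightarrow> Z i \<in> borel_measurable Q"
    and conv: "\<And>c a. (\<lambda>n. \<integral>\<omega>. cos (a + (\<Sum>i<k. c i * Y n i \<omega>)) \<partial>M) \<longlonglongrightarrow>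
                  (\<integral>\<omega>. cos (a + (\<Sum>i<k. c i * Z i \<omega>)) \<partial>Q)"
    and f: "\<And>i. continuous_on UNIV (f i)" "\<And>i x. 0 \<le> f i x" "\<And>i x. f i x \<le> 1"
  shows "j \<le> k \<Longrightarrow> (\<lambda>n. \<integral>\<omega>. (\<Prod>i<j. f i (Y n i \<omega>)) * cos (a + (\<Sum>i\<in>{j..<k}. c i * Y n i \<omega>)) \<partial>M) \<longlonglongrightarrow>
                  (\<integral>\<omega>. (\<Prod>i<j. f i (Z i \<omega>)) * cos (a + (\<Sum>i\<in>{j..<k}. c i * Z i \<omega>)) \<partial>Q)"
proof (induction j arbitrary: a c)
  case 0
  then show ?case using conv[of a c] by (simp add: lessThan_atLeast0)
next
  case (Suc j)
  interpret M: prob_space M by fact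
  interpret Q: prob_space Q by fact
  have jk: "j < k" using Suc.prems by simp
  have [measurable]: "f i \<in> borel_measurable borel" for i
    using f(1) by (rule borel_measurable_continuous_onI)
  have mYj [measurable]: "Y n i \<in> borel_measurable M" if "i < k" for n i using mY that .
  have mZj [measurable]: "Z i \<in> borel_measurable Q" if "i < k" for i using mZ that .
  define p where "p n \<omega> = (\<Prod>i<j. f i (Y n i \<omega>))" for n \<omega>
  define p' where "p' \<omega> = (\<Prod>i<j. f i (Z i \<omega>))" for \<omega>
  define r where "r n \<omega> = (\<Sum>i\<in>{Suc j..<k}. c i * Y n i \<omega>)" for n \<omega>
  define r' where "r' \<omega> = (\<Sum>i\<in>{Suc j..<k}. c i * Z i \<omega>)" for \<omega>
  have [measurable]: "p n \<in> borel_measurable M" "r n \<in> borel_measurable M" "Y n j \<in> borel_measurable M" for n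
    unfolding p_def r_def using jk by (auto intro!: borel_measurable_sum borel_measurable_prod)
  have [measurable]: "p' \<in> borel_measurable Q" "r' \<in> borel_measurable Q" "Z j \<in> borel_measurable Q"
    unfolding p'_def r'_def using jk by (auto intro!: borel_measurable_sum borel_measurable_prod)
  have p: "0 \<le> p n \<omega>" "p n \<omega> \<le> 1" for n \<omega>
    unfolding p_def using f by (auto intro!: prod_nonneg prod_le_1)
  have p': "0 \<le> p' \<omega>" "p' \<omega> \<le> 1" for \<omega>
    unfolding p'_def using f by (auto intro!: prod_nonneg prod_le_1)
  \<comment> \<open>Coordinate j is still untreated in the induction hypothesis, so its coefficient
    may be any real t.\<close>
  have IH: "(\<lambda>n. \<integral>\<omega>. p n \<omega> * cos (a + (t * Y n j \<omega> + r n \<omega>)) \<partial>M) \<longlonglongrightarrow>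
      (\<integral>\<omega>. p' \<omega> * cos (a + (t * Z j \<omega> + r' \<omega>)) \<partial>Q)" for a t
  proof -
    have "{j..<k} = insert j {Suc j..<k}" using jk by auto
    then show ?thesis
      using Suc.IH[of a "c(j := t)"] jk unfolding p_def p'_def r_def r'_def by simp
  qed
  \<comment> \<open>With all later coefficients equal to 0, this covers the summand 1 of the weight
    1 + cos.\<close>
  have IH0: "(\<lambda>n. \<integral>\<omega>. p n \<omega> * cos (a + t * Y n j \<omega>) \<partial>M) \<longlonglongrightarrow>
      (\<integral>\<omega>. p' \<omega> * cos (a + t * Z j \<omega>) \<partial>Q)" for a t
  proof -
    have "{j..<k} = insert j {Suc j..<k}" using jk by auto
    then show ?thesis
      using Suc.IH[of a "(\<lambda>_. 0)(j := t)"] jk unfolding p_def p'_def by simp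
  qed
  define w where "w a n \<omega> = p n \<omega> * (1 + cos (a + r n \<omega>))" for a n \<omega>
  define w' where "w' a \<omega> = p' \<omega> * (1 + cos (a + r' \<omega>))" for a \<omega>
  have [measurable]: "w a n \<in> borel_measurable M" "w' a \<in> borel_measurable Q" for a n
    unfolding w_def[abs_def] w'_def[abs_def] by measurable
  have c1: "0 \<le> 1 + cos x" "1 + cos x \<le> 2" for x :: real
    using cos_ge_minus_one[of x] cos_le_one[of x] by linarith+
  have w: "0 \<le> w a n \<omega>" "w a n \<omega> \<le> 2" for a n \<omega>
    unfolding w_def using mult_mono[OF p(2) c1(2) _ c1(1)] p c1 by (auto intro!: mult_nonneg_nonneg)
  have w': "0 \<le> w' a \<omega>" "w' a \<omega> \<le> 2" for a \<omega>
    unfolding w'_def using mult_mono[OF p'(2) c1(2) _ c1(1)] p' c1 by (auto intro!: mult_nonneg_nonneg)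
  have conv_w: "(\<lambda>n. \<integral>\<omega>. w a n \<omega> * cos (b + t * Y n j \<omega>) \<partial>M) \<longlonglongrightarrow>
      (\<integral>\<omega>. w' a \<omega> * cos (b + t * Z j \<omega>) \<partial>Q)" for a b t
  proof -
    have "(\<integral>\<omega>. w a n \<omega> * cos (b + t * Y n j \<omega>) \<partial>M) = (\<integral>\<omega>. p n \<omega> * cos (b + t * Y n j \<omega>) \<partial>M) +
      ((\<integral>\<omega>. p n \<omega> * cos ((a + b) + (t * Y n j \<omega> + r n \<omega>)) \<partial>M)
       + (\<integral>\<omega>. p n \<omega> * cos ((a - b) + ((- t) * Y n j \<omega> + r n \<omega>)) \<partial>M)) / 2" for n
      unfolding w_def by (rule M.expectation_cos_product_weight) (use p in auto)
    moreover have "(\<integral>\<omega>. w' a \<omega> * cos (b + t * Z j \<omega>) \<partial>Q) = (\<integral>\<omega>. p' \<omega> * cos (b + t * Z j \<omega>) \<partial>Q) +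
      ((\<integral>\<omega>. p' \<omega> * cos ((a + b) + (t * Z j \<omega> + r' \<omega>)) \<partial>Q)
       + (\<integral>\<omega>. p' \<omega> * cos ((a - b) + ((- t) * Z j \<omega> + r' \<omega>)) \<partial>Q)) / 2"
      unfolding w'_def by (rule Q.expectation_cos_product_weight) (use p' in auto)
    ultimately show ?thesis by (simp only:) (intro tendsto_intros IH IH0, simp)
  qed
  have main: "(\<lambda>n. \<integral>\<omega>. w a n \<omega> * f j (Y n j \<omega>) \<partial>M) \<longlonglongrightarrow> (\<integral>\<omega>. w' a \<omega> * f j (Z j \<omega>) \<partial>Q)" for a
  proof (rule weighted_levy_continuity[where w="w a" and w'="w' a" and y="\<lambda>n. Y n j" and y'="Z j"
        and f="f j" and B=2 and C=1, OF M Q _ _ _ _ w w'])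
    show "(\<lambda>n. \<integral>\<omega>. w a n \<omega> * cos (t * Y n j \<omega>) \<partial>M) \<longlonglongrightarrow> (\<integral>\<omega>. w' a \<omega> * cos (t * Z j \<omega>) \<partial>Q)" for t
      using conv_w[of a 0 t] by simp
    show "(\<lambda>n. \<integral>\<omega>. w a n \<omega> * sin (t * Y n j \<omega>) \<partial>M) \<longlonglongrightarrow> (\<integral>\<omega>. w' a \<omega> * sin (t * Z j \<omega>) \<partial>Q)" for t
      \<comment> \<open>The phase - pi / 2 turns the cosine into a sine.\<close>
      using conv_w[of a "- (pi / 2)" t] by (simp add: cos_diff)
    show "continuous_on UNIV (f j)" "\<bar>f j x\<bar> \<le> 1" for x using f[of j] by auto
  qed auto
  have eq: "(\<integral>\<omega>. (\<Prod>i<Suc j. f i (Y n i \<omega>)) * cos (a + (\<Sum>i\<in>{Suc j..<k}. c i * Y n i \<omega>)) \<partial>M) =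
     ((\<integral>\<omega>. w a n \<omega> * f j (Y n j \<omega>) \<partial>M) - (\<integral>\<omega>. w (a + pi) n \<omega> * f j (Y n j \<omega>) \<partial>M)) / 2" for n
    using M.expectation_weight_difference[of "p n" "r n" "\<lambda>\<omega>. f j (Y n j \<omega>)" a] p f
    unfolding w_def by (simp add: p_def r_def)
  have eq': "(\<integral>\<omega>. (\<Prod>i<Suc j. f i (Z i \<omega>)) * cos (a + (\<Sum>i\<in>{Suc j..<k}. c i * Z i \<omega>)) \<partial>Q) =
     ((\<integral>\<omega>. w' a \<omega> * f j (Z j \<omega>) \<partial>Q) - (\<integral>\<omega>. w' (a + pi) \<omega> * f j (Z j \<omega>) \<partial>Q)) / 2"
    using Q.expectation_weight_difference[of p' r' "\<lambda>\<omega>. f j (Z j \<omega>)" a] p' f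
    unfolding w'_def by (simp add: p'_def r'_def)
  show ?case unfolding eq eq' by (intro tendsto_intros main) auto
qed

section \<open>Multilinear interpolation on a grid in k dimensions\<close>

definition hat_box :: "nat \<Rightarrow> real \<Rightarrow> (nat \<Rightarrow> int) \<Rightarrow> (nat \<Rightarrow> real) \<Rightarrow> real" where
  "hat_box k h p v = (\<Prod>i<k. hat (v i / h - real_of_int (p i)))"

definition cube :: "nat \<Rightarrow> nat \<Rightarrow> (nat \<Rightarrow> int) set" where
  "cube k K = {..<k} \<rightarrow>\<^sub>E {- int K..int K}"

lemma hat_box_nonneg: "0 \<le> hat_box k h p v"
  and hat_box_le_1: "hat_box k h p v \<le> 1"
  unfolding hat_box_def by (auto intro!: prod_nonneg prod_le_1)

lemma sum_hat_box: "(\<Sum>p\<in>cube k K. hat_box k h p v) = (\<Prod>i<k. \<Sum>p\<in>{- int K..int K}. hat (v i / h - real_of_int p))"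
  unfolding cube_def hat_box_def by (rule prod_sum_PiE[symmetric]) auto

lemma sum_hat_box_le_1: "(\<Sum>p\<in>cube k K. hat_box k h p v) \<le> 1"
  unfolding sum_hat_box by (auto intro!: prod_le_1 sum_nonneg sum_hat_le_1)

lemma sum_hat_box_eq_1:
  assumes "\<And>i. i < k \<Longrightarrow> \<bar>v i / h\<bar> \<le> real K"
  shows "(\<Sum>p\<in>cube k K. hat_box k h p v) = 1"
proof -
  have "real_of_int (- int K) \<le> v i / h \<and> v i / h \<le> real_of_int (int K)" if "i < k" for i
    using assms[OF that] by linarith
  then show ?thesis unfolding sum_hat_box by (intro prod.neutral ballI sum_hat) auto
qed

text \<open>A grid point whose product of tents is nonzero at v lies within h of v in each
  coordinate; replacing v by such points costs at most L h. The missing mass 1 - sum, positive only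
  if v leaves the cube, costs at most B times its size.\<close>

lemma hat_box_interpolation:
  fixes G :: "(nat \<Rightarrow> real) \<Rightarrow> real"
  assumes G: "\<And>v. \<bar>G v\<bar> \<le> B"
    and Lip: "\<And>u v e. (\<And>i. i < k \<Longrightarrow> \<bar>u i - v i\<bar> \<le> e) \<Longrightarrow> \<bar>G u - G v\<bar> \<le> L * e"
    and L: "0 \<le> L" and h: "0 < h"
  shows "\<bar>G v - (\<Sum>p\<in>cube k K. G (\<lambda>i. h * real_of_int (p i)) * hat_box k h p v)\<bar>
    \<le> L * h + B * (1 - (\<Sum>p\<in>cube k K. hat_box k h p v))"
proof -
  define s where "s = (\<Sum>p\<in>cube k K. hat_box k h p v)"
  define g where "g = (\<Sum>p\<in>cube k K. G (\<lambda>i. h * real_of_int (p i)) * hat_box k h p v)"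
  have s: "s \<le> 1" unfolding s_def by (rule sum_hat_box_le_1)
  have "\<bar>G v * s - g\<bar> \<le> (\<Sum>p\<in>cube k K. \<bar>(G v - G (\<lambda>i. h * real_of_int (p i))) * hat_box k h p v\<bar>)"
    unfolding s_def g_def sum_distrib_left
    by (rule order.trans[OF _ sum_abs]) (simp add: left_diff_distrib sum_subtractf)
  also have "\<dots> \<le> (\<Sum>p\<in>cube k K. L * h * hat_box k h p v)"
  proof (rule sum_mono)
    fix p assume "p \<in> cube k K"
    show "\<bar>(G v - G (\<lambda>i. h * real_of_int (p i))) * hat_box k h p v\<bar> \<le> L * h * hat_box k h p v"
    proof (cases "\<forall>i<k. \<bar>v i / h - real_of_int (p i)\<bar> \<le> 1")
      case True
      have "\<bar>G v - G (\<lambda>i. h * real_of_int (p i))\<bar> \<le> L * h"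
      proof (rule Lip)
        fix i assume "i < k"
        then have "\<bar>v i / h - real_of_int (p i)\<bar> * h \<le> 1 * h"
          using True h by (intro mult_right_mono) auto
        also have "\<bar>v i / h - real_of_int (p i)\<bar> * h = \<bar>(v i / h - real_of_int (p i)) * h\<bar>"
          using h by (simp add: abs_mult)
        also have "(v i / h - real_of_int (p i)) * h = v i - h * real_of_int (p i)"
          using h by (simp add: field_simps)
        finally show "\<bar>v i - h * real_of_int (p i)\<bar> \<le> h" by simp
      qed
      then show ?thesis using hat_box_nonneg[of k h p v] by (auto simp: abs_mult intro!: mult_right_mono)
    next
      case False
      then have "hat_box k h p v = 0"
        unfolding hat_box_def by (force intro!: prod_zero hat_eq_0)
      then show ?thesis by simp
    qed
  qed
  also have "\<dots> = L * h * s" unfolding s_def by (simp add: sum_distrib_left)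
  also have "\<dots> \<le> L * h" using s h L by (simp add: mult_left_le)
  finally have 1: "\<bar>G v * s - g\<bar> \<le> L * h" .
  have "\<bar>G v * (1 - s)\<bar> \<le> B * (1 - s)"
    using G[of v] s by (auto simp: abs_mult intro!: mult_right_mono)
  with 1 show ?thesis unfolding s_def g_def by (simp add: right_diff_distrib)
qed

lemma (in prob_space) expectation_hat_box_interpolation:
  fixes Y :: "nat \<Rightarrow> 'a \<Rightarrow> real" and G :: "(nat \<Rightarrow> real) \<Rightarrow> real"
  assumes G: "\<And>v. \<bar>G v\<bar> \<le> B"
    and Lip: "\<And>u v e. (\<And>i. i < k \<Longrightarrow> \<bar>u i - v i\<bar> \<le> e) \<Longrightarrow> \<bar>G u - G v\<bar> \<le> L * e"
    and L: "0 \<le> L" and h: "0 < h"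
    and mY: "\<And>i. i < k \<Longrightarrow> Y i \<in> borel_measurable M"
    and mG: "(\<lambda>\<omega>. G (\<lambda>i. Y i \<omega>)) \<in> borel_measurable M"
  shows "\<bar>expectation (\<lambda>\<omega>. G (\<lambda>i. Y i \<omega>)) -
      (\<Sum>p\<in>cube k K. G (\<lambda>i. h * real_of_int (p i)) * expectation (\<lambda>\<omega>. hat_box k h p (\<lambda>i. Y i \<omega>)))\<bar>
    \<le> L * h + B * (1 - (\<Sum>p\<in>cube k K. expectation (\<lambda>\<omega>. hat_box k h p (\<lambda>i. Y i \<omega>))))"
proof -
  have mhat [measurable]: "hat \<in> borel_measurable borel"
    by (rule borel_measurable_continuous_onI) (auto intro!: continuous_intros)
  have [measurable]: "(\<lambda>\<omega>. hat_box k h p (\<lambda>i. Y i \<omega>)) \<in> borel_measurable M" for p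
    unfolding hat_box_def using mY by (intro borel_measurable_prod) auto
  have iq: "integrable M (\<lambda>\<omega>. hat_box k h p (\<lambda>i. Y i \<omega>))" for p
    by (rule integrable_const_bound[where B=1]) (use hat_box_nonneg hat_box_le_1 in auto)
  have iG: "integrable M (\<lambda>\<omega>. G (\<lambda>i. Y i \<omega>))"
    by (rule integrable_const_bound[where B=B]) (use G mG in auto)
  let ?s = "\<lambda>\<omega>. \<Sum>p\<in>cube k K. hat_box k h p (\<lambda>i. Y i \<omega>)"
  let ?g = "\<lambda>\<omega>. \<Sum>p\<in>cube k K. G (\<lambda>i. h * real_of_int (p i)) * hat_box k h p (\<lambda>i. Y i \<omega>)"
  have main: "\<bar>G v - (\<Sum>p\<in>cube k K. G (\<lambda>i. h * real_of_int (p i)) * hat_box k h p v)\<bar>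
    \<le> L * h + B * (1 - (\<Sum>p\<in>cube k K. hat_box k h p v))" for v
    by (rule hat_box_interpolation[OF G Lip L h])
  have i: "integrable M ?s" "integrable M ?g" by (auto intro!: iq Bochner_Integration.integrable_sum)
  have "\<bar>expectation (\<lambda>\<omega>. G (\<lambda>i. Y i \<omega>)) - expectation ?g\<bar> = \<bar>expectation (\<lambda>\<omega>. G (\<lambda>i. Y i \<omega>) - ?g \<omega>)\<bar>"
    by (simp only: Bochner_Integration.integral_diff iG i)
  also have "\<dots> \<le> expectation (\<lambda>\<omega>. L * h + B * (1 - ?s \<omega>))"
    using iG i main by (intro order.trans[OF integral_abs_bound] integral_mono) auto
  also have "\<dots> = L * h + B * (1 - expectation ?s)" using i by (simp add: prob_space)
  finally show ?thesis by (simp add: Bochner_Integration.integral_sum iq)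
qed

text \<open>Up to an error, the expectation of G is a finite combination of expectations of products
  of tents, and these converge. The mass missed by the cube is 1 minus a sum of the same
  expectations, so a K that is good for \<open>Q\<close> is good for large n as well; no separate
  tightness argument enters. With e = 0 the hypothesis \<open>Lip\<close> says that G depends on the
  first k coordinates only.\<close>

lemma fdd_convergence_Lipschitz:
  fixes Y :: "nat \<Rightarrow> nat \<Rightarrow> 'a \<Rightarrow> real" and Z :: "nat \<Rightarrow> 'b \<Rightarrow> real" and G :: "(nat \<Rightarrow> real) \<Rightarrow> real"
  assumes M: "prob_space M" and Q: "prob_space Q"
    and mY: "\<And>n i. i < k \<Longrightarrow> Y n i \<in> borel_measurable M"
    and mZ: "\<And>i. i < k \<Longrightarrow> Z i \<in> borel_measurable Q"
    and conv: "\<And>c a. (\<lambda>n. \<integral>\<omega>. cos (a + (\<Sum>i<k. c i * Y n i \<omega>)) \<partial>M) \<longlonglongrightarrow>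
                  (\<integral>\<omega>. cos (a + (\<Sum>i<k. c i * Z i \<omega>)) \<partial>Q)"
    and G: "\<And>v. \<bar>G v\<bar> \<le> B"
    and Lip: "\<And>u v e. (\<And>i. i < k \<Longrightarrow> \<bar>u i - v i\<bar> \<le> e) \<Longrightarrow> \<bar>G u - G v\<bar> \<le> L * e"
    and L: "0 \<le> L"
    and mGY: "\<And>n. (\<lambda>\<omega>. G (\<lambda>i. Y n i \<omega>)) \<in> borel_measurable M"
    and mGZ: "(\<lambda>\<omega>. G (\<lambda>i. Z i \<omega>)) \<in> borel_measurable Q"
  shows "(\<lambda>n. \<integral>\<omega>. G (\<lambda>i. Y n i \<omega>) \<partial>M) \<longlonglongrightarrow> (\<integral>\<omega>. G (\<lambda>i. Z i \<omega>) \<partial>Q)"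
proof -
  interpret M: prob_space M by fact
  interpret Q: prob_space Q by fact
  have B: "0 \<le> B" using G[of undefined] by linarith
  define EM where "EM h p n = (\<integral>\<omega>. hat_box k h p (\<lambda>i. Y n i \<omega>) \<partial>M)" for h p n
  define EQ where "EQ h p = (\<integral>\<omega>. hat_box k h p (\<lambda>i. Z i \<omega>) \<partial>Q)" for h p
  define Gp where "Gp h p = G (\<lambda>i. h * real_of_int (p i))" for h :: real and p :: "nat \<Rightarrow> int"
  have conv_q: "(\<lambda>n. EM h p n) \<longlonglongrightarrow> EQ h p" if "h > 0" for h p
  proof -
    have "continuous_on UNIV (\<lambda>x. hat (x / h - real_of_int (p i)))" for i
      using that by (intro continuous_intros) auto
    \<comment> \<open>At j = k every coordinate has been treated and the remaining cosine is cos 0 =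
      1.\<close>
    from fdd_convergence_aux[OF M Q mY mZ conv this, where j=k and a=0 and c="\<lambda>_. 0"] show ?thesis
      by (simp add: hat_box_def EM_def EQ_def)
  qed
  have bM: "\<bar>(\<integral>\<omega>. G (\<lambda>i. Y n i \<omega>) \<partial>M) - (\<Sum>p\<in>cube k K. Gp h p * EM h p n)\<bar>
      \<le> L * h + B * (1 - (\<Sum>p\<in>cube k K. EM h p n))" if "h > 0" for K h n
    unfolding EM_def Gp_def by (rule M.expectation_hat_box_interpolation[OF G Lip L that mY mGY])
  have bQ: "\<bar>(\<integral>\<omega>. G (\<lambda>i. Z i \<omega>) \<partial>Q) - (\<Sum>p\<in>cube k K. Gp h p * EQ h p)\<bar>
      \<le> L * h + B * (1 - (\<Sum>p\<in>cube k K. EQ h p))" if "h > 0" for K h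
    unfolding EQ_def Gp_def by (rule Q.expectation_hat_box_interpolation[OF G Lip L that mZ mGZ])
  have lim_s: "(\<lambda>K. \<Sum>p\<in>cube k K. EQ h p) \<longlonglongrightarrow> 1" for h
  proof -
    have [measurable]: "hat \<in> borel_measurable borel"
      by (rule borel_measurable_continuous_onI) (auto intro!: continuous_intros)
    have mq [measurable]: "(\<lambda>\<omega>. hat_box k h p (\<lambda>i. Z i \<omega>)) \<in> borel_measurable Q" for p
      unfolding hat_box_def using mZ by (intro borel_measurable_prod) auto
    have iq: "integrable Q (\<lambda>\<omega>. hat_box k h p (\<lambda>i. Z i \<omega>))" for p
      by (rule Q.integrable_const_bound[where B=1]) (use hat_box_nonneg hat_box_le_1 in auto)
    have "(\<lambda>K. \<integral>\<omega>. (\<Sum>p\<in>cube k K. hat_box k h p (\<lambda>i. Z i \<omega>)) \<partial>Q) \<longlonglongrightarrow> (\<integral>\<omega>. 1 \<partial>Q)"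
    proof (rule integral_dominated_convergence[where w="\<lambda>_. 1"])
      show "AE \<omega> in Q. (\<lambda>K. \<Sum>p\<in>cube k K. hat_box k h p (\<lambda>i. Z i \<omega>)) \<longlonglongrightarrow> 1"
      proof (rule AE_I2, rule tendsto_eventually)
        fix \<omega> assume "\<omega> \<in> space Q"
        have "\<forall>\<^sub>F K in sequentially. \<forall>i\<in>{..<k}. \<bar>Z i \<omega> / h\<bar> \<le> real K"
        proof (intro eventually_ball_finite ballI)
          fix i show "\<forall>\<^sub>F K in sequentially. \<bar>Z i \<omega> / h\<bar> \<le> real K"
            by (rule eventually_mono[OF eventually_ge_at_top[of "nat \<lceil>\<bar>Z i \<omega> / h\<bar>\<rceil>"]]) linarith
        qed auto
        then show "\<forall>\<^sub>F K in sequentially. (\<Sum>p\<in>cube k K. hat_box k h p (\<lambda>i. Z i \<omega>)) = 1"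
          by eventually_elim (auto intro!: sum_hat_box_eq_1)
      qed
      show "AE \<omega> in Q. norm (\<Sum>p\<in>cube k K. hat_box k h p (\<lambda>i. Z i \<omega>)) \<le> 1" for K
        by (auto simp: abs_of_nonneg sum_nonneg hat_box_nonneg sum_hat_box_le_1)
    qed auto
    then show ?thesis by (simp add: EQ_def Q.prob_space Bochner_Integration.integral_sum iq)
  qed
  show ?thesis
  proof (rule tendstoI)
    fix e :: real assume e: "e > 0"
    \<comment> \<open>Five errors of at most e / 8 each will be added; L + 1 avoids a division by
      0.\<close>
    define h where "h = e / (8 * (L + 1))"
    have h: "h > 0" using e L unfolding h_def by (simp add: divide_pos_pos)
    have "L * h \<le> (L + 1) * h" using h by simp
    also have "\<dots> = e / 8" unfolding h_def using L by (simp add: divide_simps)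
    finally have Lh: "L * h \<le> e / 8" .
    have "(\<lambda>K. B * (1 - (\<Sum>p\<in>cube k K. EQ h p))) \<longlonglongrightarrow> B * (1 - 1)" by (intro tendsto_intros lim_s)
    then have "\<forall>\<^sub>F K in sequentially. B * (1 - (\<Sum>p\<in>cube k K. EQ h p)) < e / 8"
      using e by (intro order_tendstoD) auto
    then obtain K where K: "B * (1 - (\<Sum>p\<in>cube k K. EQ h p)) < e / 8"
      using eventually_happens[of _ "sequentially"] by auto
    have "(\<lambda>n. B * (1 - (\<Sum>p\<in>cube k K. EM h p n))) \<longlonglongrightarrow> B * (1 - (\<Sum>p\<in>cube k K. EQ h p))" by (intro tendsto_intros conv_q h)
    then have "\<forall>\<^sub>F n in sequentially. B * (1 - (\<Sum>p\<in>cube k K. EM h p n)) < e / 8"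
      using K by (intro order_tendstoD) auto
    moreover have "\<forall>\<^sub>F n in sequentially. dist (\<Sum>p\<in>cube k K. Gp h p * EM h p n) (\<Sum>p\<in>cube k K. Gp h p * EQ h p) < e / 8"
      using e by (intro tendstoD[where e="e / 8"] tendsto_intros conv_q h) auto
    ultimately show "\<forall>\<^sub>F n in sequentially. dist (\<integral>\<omega>. G (\<lambda>i. Y n i \<omega>) \<partial>M) (\<integral>\<omega>. G (\<lambda>i. Z i \<omega>) \<partial>Q) < e"
    proof eventually_elim
      case (elim n)
      show ?case using bM[OF h, of n K] bQ[OF h, of K] elim Lh K e unfolding dist_real_def by linarith
    qed
  qed
qed

section \<open>A criterion for weak convergence in C[0,1]\<close>

text \<open>The infimal convolution of F with k times the uniform distance. For bounded F and k >= 0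
  it is the largest k-Lipschitz functional below F on \<open>C01\<close>.\<close>

definition lip_env :: "((real \<Rightarrow> real) \<Rightarrow> real) \<Rightarrow> real \<Rightarrow> (real \<Rightarrow> real) \<Rightarrow> real" where
  "lip_env F k f = (INF g\<in>C01. F g + k * sup01 f g)"

context
  fixes F :: "(real \<Rightarrow> real) \<Rightarrow> real" and B :: real
  assumes bounded: "\<And>f. f \<in> C01 \<Longrightarrow> \<bar>F f\<bar> \<le> B"
begin

lemma bdd_below_lip_env:
  "f \<in> C01 \<Longrightarrow> 0 \<le> k \<Longrightarrow> bdd_below ((\<lambda>g. F g + k * sup01 f g) ` C01)"
proof (rule bdd_belowI2[of _ "- B"])
  fix g assume "f \<in> C01" "0 \<le> k" "g \<in> C01"
  then show "- B \<le> F g + k * sup01 f g"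
    using bounded[of g] sup01_nonneg[of f g] mult_nonneg_nonneg[of k "sup01 f g"] by linarith
qed

lemma lip_env_le: "f \<in> C01 \<Longrightarrow> g \<in> C01 \<Longrightarrow> 0 \<le> k \<Longrightarrow> lip_env F k f \<le> F g + k * sup01 f g"
  unfolding lip_env_def by (rule cINF_lower[OF bdd_below_lip_env])

lemma C01_nonempty: "C01 \<noteq> {}"
  using interp_in_C01 by blast

lemma lip_env_greatest: "(\<And>g. g \<in> C01 \<Longrightarrow> c \<le> F g + k * sup01 f g) \<Longrightarrow> c \<le> lip_env F k f"
  unfolding lip_env_def by (rule cINF_greatest[OF C01_nonempty])

lemma lip_env_bounded:
  assumes "f \<in> C01" "0 \<le> k"
  shows "\<bar>lip_env F k f\<bar> \<le> B"
proof -
  have "- B \<le> lip_env F k f"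
  proof (rule lip_env_greatest)
    fix g assume "g \<in> C01"
    then show "- B \<le> F g + k * sup01 f g"
      using assms bounded[of g] sup01_nonneg[of f g] mult_nonneg_nonneg[of k "sup01 f g"] by linarith
  qed
  moreover have "lip_env F k f \<le> B"
    using lip_env_le[OF assms(1) assms(1) assms(2)] bounded[OF assms(1)] by simp
  ultimately show ?thesis by simp
qed

lemma lip_env_lipschitz:
  assumes "f \<in> C01" "g \<in> C01" "0 \<le> k"
  shows "\<bar>lip_env F k f - lip_env F k g\<bar> \<le> k * sup01 f g"
proof -
  have *: "lip_env F k f - k * sup01 f g \<le> lip_env F k g" if fg: "f \<in> C01" "g \<in> C01" for f g
  proof (rule lip_env_greatest)
    fix h assume h: "h \<in> C01"
    have "k * sup01 f h \<le> k * (sup01 f g + sup01 g h)"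
      using fg h assms(3) by (intro mult_left_mono sup01_triangle) auto
    then show "lip_env F k f - k * sup01 f g \<le> F h + k * sup01 g h"
      using lip_env_le[OF fg(1) h assms(3)] by (simp add: algebra_simps)
  qed
  from *[OF assms(1,2)] *[OF assms(2,1)] show ?thesis by (simp add: sup01_commute abs_le_iff)
qed

text \<open>Paths at distance at least d from f pay a penalty of at least k d, which outweighs the
  oscillation 2 B once k >= 2 B / d. For nearer paths continuity of F at f is enough.\<close>

lemma lip_env_tendsto:
  assumes F: "bcont_C01 F" and f: "f \<in> C01"
  shows "(\<lambda>k. lip_env F (real k) f) \<longlonglongrightarrow> F f"
proof (rule tendstoI)
  fix e :: real assume e: "e > 0"
  then obtain d where d: "d > 0" "\<And>g. g \<in> C01 \<Longrightarrow> sup01 f g < d \<Longrightarrow> \<bar>F f - F g\<bar> < e/2"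
    using F f unfolding bcont_C01_def by (meson half_gt_zero)
  have "\<forall>\<^sub>F k in sequentially. real k \<ge> 2 * B / d"
    by (rule eventually_mono[OF eventually_ge_at_top[of "nat \<lceil>2 * B / d\<rceil>"]]) linarith
  then show "\<forall>\<^sub>F k in sequentially. dist (lip_env F (real k) f) (F f) < e"
  proof eventually_elim
    case (elim k)
    have "F f - e/2 \<le> lip_env F (real k) f"
    proof (rule lip_env_greatest)
      fix g assume g: "g \<in> C01"
      show "F f - e/2 \<le> F g + real k * sup01 f g"
      proof (cases "sup01 f g < d")
        case True
        then show ?thesis using d(2)[OF g] sup01_nonneg[OF f g]
          mult_nonneg_nonneg[of "real k" "sup01 f g"] by linarith
      next
        case False
        then have "2 * B / d * d \<le> real k * sup01 f g"
          using elim d bounded[OF f] by (intro mult_mono) auto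
        then show ?thesis using d bounded[OF f] bounded[OF g] e by simp
      qed
    qed
    moreover have "lip_env F (real k) f \<le> F f" using lip_env_le[OF f f, of "real k"] by simp
    ultimately show ?case using e by (simp add: dist_real_def)
  qed
qed

end

lemma lipschitz_bcont_C01:
  assumes "\<And>f. f \<in> C01 \<Longrightarrow> \<bar>F f\<bar> \<le> B" "0 \<le> L"
    and Lip: "\<And>f g. f \<in> C01 \<Longrightarrow> g \<in> C01 \<Longrightarrow> \<bar>F f - F g\<bar> \<le> L * sup01 f g"
  shows "bcont_C01 F"
  unfolding bcont_C01_def
proof (intro conjI ballI allI impI)
  show "\<exists>B. \<forall>f\<in>C01. \<bar>F f\<bar> \<le> B" using assms(1) by blast
  fix f :: "real \<Rightarrow> real" and e :: real assume f: "f \<in> C01" and e: "0 < e"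
  have "\<bar>F f - F g\<bar> < e" if g: "g \<in> C01" "sup01 f g < e / (L + 1)" for g
  proof -
    have "\<bar>F f - F g\<bar> \<le> (L + 1) * sup01 f g"
      using Lip[OF f g(1)] sup01_nonneg[OF f g(1)] by (simp add: algebra_simps)
    also have "\<dots> < (L + 1) * (e / (L + 1))"
      using g(2) assms(2) by (intro mult_strict_left_mono) auto
    finally show ?thesis using assms(2) by simp
  qed
  then show "\<exists>d>0. \<forall>g\<in>C01. sup01 f g < d \<longrightarrow> \<bar>F f - F g\<bar> < e"
    using e assms(2) by (intro exI[of _ "e / (L + 1)"]) auto
qed

text \<open>Three comparisons: \<open>P n\<close> with its polygon on the grid of mesh 1/m
  (oscillation bound off a small set, 2 B on it), the polygon of \<open>P n\<close> with that of Z
  (finite-dimensional convergence), and the polygon of Z with Z (continuity of paths). The Lipschitz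
  property makes the first error uniform in the path.\<close>

lemma weak_conv_C01_lipschitz:
  fixes P :: "nat \<Rightarrow> 'a \<Rightarrow> real \<Rightarrow> real" and Z :: "real \<Rightarrow> 'b \<Rightarrow> real"
  assumes M: "prob_space M" and Q: "prob_space Q"
    and P: "\<And>n \<omega>. \<omega> \<in> space M \<Longrightarrow> P n \<omega> \<in> C01"
    and mP: "\<And>n t. t \<in> {0..1} \<Longrightarrow> (\<lambda>\<omega>. P n \<omega> t) \<in> borel_measurable M"
    and Z: "\<And>\<omega>. \<omega> \<in> space Q \<Longrightarrow> (\<lambda>t. Z t \<omega>) \<in> C01"
    and mZ: "\<And>t. t \<in> {0..1} \<Longrightarrow> Z t \<in> borel_measurable Q"
    and fdd: "\<And>k ts c a. (\<And>i::nat. i < k \<Longrightarrow> ts i \<in> {0..1}) \<Longrightarrow>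
       (\<lambda>n. \<integral>\<omega>. cos (a + (\<Sum>i<k. c i * P n \<omega> (ts i))) \<partial>M) \<longlonglongrightarrow>
       (\<integral>\<omega>. cos (a + (\<Sum>i<k. c i * Z (ts i) \<omega>)) \<partial>Q)"
    and tight: "\<And>\<epsilon> \<eta>::real. \<epsilon> > 0 \<Longrightarrow> \<eta> > 0 \<Longrightarrow> \<exists>m0. \<forall>m\<ge>m0. \<forall>\<^sub>F n in sequentially.
       holds_up_to M \<eta> (\<lambda>\<omega>. \<forall>i\<le>m. \<forall>t\<in>{0..1}.
          \<bar>real m * t - real i\<bar> < 1 \<longrightarrow> \<bar>P n \<omega> t - P n \<omega> (real i / real m)\<bar> \<le> \<epsilon>)"
    and F: "\<And>f. f \<in> C01 \<Longrightarrow> \<bar>F f\<bar> \<le> B" and L: "0 \<le> L"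
    and Lip: "\<And>f g. f \<in> C01 \<Longrightarrow> g \<in> C01 \<Longrightarrow> \<bar>F f - F g\<bar> \<le> L * sup01 f g"
  shows "(\<lambda>n. \<integral>\<omega>. F (P n \<omega>) \<partial>M) \<longlonglongrightarrow> (\<integral>\<omega>. F (\<lambda>t. Z t \<omega>) \<partial>Q)"
proof -
  interpret M: prob_space M by fact
  interpret Q: prob_space Q by fact
  have bc: "bcont_C01 F" by (rule lipschitz_bcont_C01[OF F L Lip])
  have B: "0 \<le> B" using F[OF interp_in_C01[of 0 undefined]] by linarith
  have gridI: "real i / real m \<in> {0..1}" if "i \<le> m" for i m :: nat
    using that by (auto simp: divide_le_eq_1)
  have mFP [measurable]: "(\<lambda>\<omega>. F (P n \<omega>)) \<in> borel_measurable M" for n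
    by (rule measurable_bcont_C01[OF bc P mP])
  have mFZ [measurable]: "(\<lambda>\<omega>. F (\<lambda>t. Z t \<omega>)) \<in> borel_measurable Q"
    by (rule measurable_bcont_C01[OF bc Z mZ])
  have mFPm [measurable]: "(\<lambda>\<omega>. F (interp m (\<lambda>i. P n \<omega> (real i / real m)))) \<in> borel_measurable M" for n m
    by (rule measurable_bcont_C01[OF bc interp_in_C01])
       (auto simp: interp_def intro!: borel_measurable_sum borel_measurable_times mP gridI)
  have mFZm [measurable]: "(\<lambda>\<omega>. F (interp m (\<lambda>i. Z (real i / real m) \<omega>))) \<in> borel_measurable Q" for m
    by (rule measurable_bcont_C01[OF bc interp_in_C01])
       (auto simp: interp_def intro!: borel_measurable_sum borel_measurable_times mZ gridI)
  have FP: "integrable M (\<lambda>\<omega>. F (P n \<omega>))" for n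
    by (rule M.integrable_const_bound[where B=B]) (auto intro!: AE_I2 F P)
  have FPm: "integrable M (\<lambda>\<omega>. F (interp m (\<lambda>i. P n \<omega> (real i / real m))))" for n m
    by (rule M.integrable_const_bound[where B=B]) (auto intro!: AE_I2 F interp_in_C01)
  have grid: "(\<lambda>n. \<integral>\<omega>. F (interp m (\<lambda>i. P n \<omega> (real i / real m))) \<partial>M) \<longlonglongrightarrow>
     (\<integral>\<omega>. F (interp m (\<lambda>i. Z (real i / real m) \<omega>)) \<partial>Q)" for m
  proof (rule fdd_convergence_Lipschitz[where k="Suc m" and Y="\<lambda>n i \<omega>. P n \<omega> (real i / real m)"
        and G="\<lambda>v. F (interp m v)" and L=L and B=B, OF M Q])
    show "(\<lambda>n. \<integral>\<omega>. cos (a + (\<Sum>i<Suc m. c i * P n \<omega> (real i / real m))) \<partial>M)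
       \<longlonglongrightarrow> (\<integral>\<omega>. cos (a + (\<Sum>i<Suc m. c i * Z (real i / real m) \<omega>)) \<partial>Q)" for c a
      by (rule fdd) (use gridI in auto)
    show "\<bar>F (interp m u) - F (interp m v)\<bar> \<le> L * e" if "\<And>i. i < Suc m \<Longrightarrow> \<bar>u i - v i\<bar> \<le> e" for u v e
    proof -
      have "sup01 (interp m u) (interp m v) \<le> e"
        by (rule sup01_least, rule interp_diff_le) (use that in auto)
      then show ?thesis
        using Lip[OF interp_in_C01 interp_in_C01, of m u m v] L by (meson mult_left_mono order_trans)
    qed
  qed (use gridI mP mZ F interp_in_C01 L in auto)
  have gridZ: "(\<lambda>m. \<integral>\<omega>. F (interp m (\<lambda>i. Z (real i / real m) \<omega>)) \<partial>Q) \<longlonglongrightarrow> (\<integral>\<omega>. F (\<lambda>t. Z t \<omega>) \<partial>Q)"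
  proof (rule integral_dominated_convergence[where w="\<lambda>_. B"])
    show "AE \<omega> in Q. (\<lambda>m. F (interp m (\<lambda>i. Z (real i / real m) \<omega>))) \<longlonglongrightarrow> F (\<lambda>t. Z t \<omega>)"
      by (intro AE_I2 interp_tendsto_C01[OF bc Z, where r="\<lambda>_. 0"]) auto
  qed (auto intro!: F interp_in_C01)
  show ?thesis
  proof (rule tendstoI)
    fix e :: real assume e: "e > 0"
    \<comment> \<open>With these two choices the first comparison costs at most e / 4; the other two
      cost less than e / 8 each.\<close>
    define eps where "eps = e / (8 * (L + 1))"
    define eta where "eta = e / (16 * (B + 1))"
    have pos: "eps > 0" "eta > 0" unfolding eps_def eta_def using e L B by auto
    have "L * eps \<le> (L + 1) * eps" using pos by simp
    also have "\<dots> = e / 8" unfolding eps_def using L by (simp add: divide_simps)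
    finally have Leps: "L * eps \<le> e / 8" .
    have "2 * B * eta \<le> 2 * (B + 1) * eta" using pos by simp
    also have "\<dots> = e / 8" unfolding eta_def using B by (simp add: divide_simps)
    finally have Beta: "2 * B * eta \<le> e / 8" .
    obtain m0 where m0: "\<And>m. m \<ge> m0 \<Longrightarrow> \<forall>\<^sub>F n in sequentially.
       holds_up_to M eta (\<lambda>\<omega>. \<forall>i\<le>m. \<forall>t\<in>{0..1}.
          \<bar>real m * t - real i\<bar> < 1 \<longrightarrow> \<bar>P n \<omega> t - P n \<omega> (real i / real m)\<bar> \<le> eps)"
      using tight[OF pos] by blast
    have "\<forall>\<^sub>F m in sequentially. dist (\<integral>\<omega>. F (interp m (\<lambda>i. Z (real i / real m) \<omega>)) \<partial>Q) (\<integral>\<omega>. F (\<lambda>t. Z t \<omega>) \<partial>Q) < e/8"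
      using gridZ e by (intro tendstoD) auto
    then have "\<forall>\<^sub>F m in sequentially. m \<ge> m0 \<and>
        dist (\<integral>\<omega>. F (interp m (\<lambda>i. Z (real i / real m) \<omega>)) \<partial>Q) (\<integral>\<omega>. F (\<lambda>t. Z t \<omega>) \<partial>Q) < e/8"
      using eventually_ge_at_top[of m0] by eventually_elim auto
    then obtain m where m: "m \<ge> m0"
        "dist (\<integral>\<omega>. F (interp m (\<lambda>i. Z (real i / real m) \<omega>)) \<partial>Q) (\<integral>\<omega>. F (\<lambda>t. Z t \<omega>) \<partial>Q) < e/8"
      using eventually_happens[of _ sequentially] by auto
    have "\<forall>\<^sub>F n in sequentially. dist (\<integral>\<omega>. F (interp m (\<lambda>i. P n \<omega> (real i / real m))) \<partial>M)
       (\<integral>\<omega>. F (interp m (\<lambda>i. Z (real i / real m) \<omega>)) \<partial>Q) < e/8"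
      using grid[of m] e by (intro tendstoD) auto
    with m0[OF m(1)] show "\<forall>\<^sub>F n in sequentially. dist (\<integral>\<omega>. F (P n \<omega>) \<partial>M) (\<integral>\<omega>. F (\<lambda>t. Z t \<omega>) \<partial>Q) < e"
    proof eventually_elim
      case (elim n)
      then obtain A where A [measurable]: "A \<in> sets M" and Ale: "measure M A \<le> eta"
        and osc: "\<And>\<omega> i t. \<omega> \<in> space M - A \<Longrightarrow> i \<le> m \<Longrightarrow> t \<in> {0..1} \<Longrightarrow>
          \<bar>real m * t - real i\<bar> < 1 \<Longrightarrow> \<bar>P n \<omega> t - P n \<omega> (real i / real m)\<bar> \<le> eps"
        unfolding holds_up_to_def by blast
      let ?d = "\<lambda>\<omega>. F (P n \<omega>) - F (interp m (\<lambda>i. P n \<omega> (real i / real m)))"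
      have d: "\<bar>?d \<omega>\<bar> \<le> L * eps + 2 * B * indicator A \<omega>" if \<omega>: "\<omega> \<in> space M" for \<omega>
      proof (cases "\<omega> \<in> A")
        case True
        have "0 \<le> L * eps" using L pos by simp
        then show ?thesis
          using F[OF P[OF \<omega>, of n]] F[OF interp_in_C01[of m "\<lambda>i. P n \<omega> (real i / real m)"]] True by simp
      next
        case False
        have "sup01 (interp m (\<lambda>i. P n \<omega> (real i / real m))) (P n \<omega>) \<le> eps"
        proof (rule sup01_least, rule interp_close)
          fix t :: real and i assume "t \<in> {0..1}" "i \<le> m" "\<bar>real m * t - real i\<bar> < 1"
          then show "\<bar>P n \<omega> (real i / real m) - P n \<omega> t\<bar> \<le> eps"
            using osc[of \<omega> i t] False \<omega> by (auto simp: abs_minus_commute)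
        qed
        then have "L * sup01 (P n \<omega>) (interp m (\<lambda>i. P n \<omega> (real i / real m))) \<le> L * eps"
          using L by (intro mult_left_mono) (auto simp: sup01_commute)
        then show ?thesis
          using Lip[OF P[OF \<omega>, of n] interp_in_C01[of m "\<lambda>i. P n \<omega> (real i / real m)"]] False by simp
      qed
      have "\<bar>(\<integral>\<omega>. F (P n \<omega>) \<partial>M) - (\<integral>\<omega>. F (interp m (\<lambda>i. P n \<omega> (real i / real m))) \<partial>M)\<bar> = \<bar>\<integral>\<omega>. ?d \<omega> \<partial>M\<bar>"
        by (simp add: FP FPm)
      also have "\<dots> \<le> (\<integral>\<omega>. L * eps + 2 * B * indicator A \<omega> \<partial>M)"
        using d FP FPm by (intro order.trans[OF integral_abs_bound] integral_mono) (auto simp: less_top[symmetric])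
      also have "\<dots> = L * eps + 2 * B * measure M A"
        by (simp add: M.prob_space less_top[symmetric])
      also have "\<dots> \<le> L * eps + 2 * B * eta" using Ale B by (simp add: mult_left_mono)
      finally show ?case using Leps Beta m(2) elim(2) e unfolding dist_real_def by linarith
    qed
  qed
qed

text \<open>A continuous functional need not be uniformly continuous, so polygons approximate it
  with an error that depends on the path. Its Lipschitz envelopes lie below it and converge to it,
  which gives the lower bound for the limit inferior; the same bound for - F is the upper
  one.\<close>

theorem weak_conv_C01_criterion:
  fixes P :: "nat \<Rightarrow> 'a \<Rightarrow> real \<Rightarrow> real" and Z :: "real \<Rightarrow> 'b \<Rightarrow> real"
  assumes M: "prob_space M" and Q: "prob_space Q"
    and P: "\<And>n \<omega>. \<omega> \<in> space M \<Longrightarrow> P n \<omega> \<in> C01"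
    and mP: "\<And>n t. t \<in> {0..1} \<Longrightarrow> (\<lambda>\<omega>. P n \<omega> t) \<in> borel_measurable M"
    and Z: "\<And>\<omega>. \<omega> \<in> space Q \<Longrightarrow> (\<lambda>t. Z t \<omega>) \<in> C01"
    and mZ: "\<And>t. t \<in> {0..1} \<Longrightarrow> Z t \<in> borel_measurable Q"
    and fdd: "\<And>k ts c a. (\<And>i::nat. i < k \<Longrightarrow> ts i \<in> {0..1}) \<Longrightarrow>
       (\<lambda>n. \<integral>\<omega>. cos (a + (\<Sum>i<k. c i * P n \<omega> (ts i))) \<partial>M) \<longlonglongrightarrow>
       (\<integral>\<omega>. cos (a + (\<Sum>i<k. c i * Z (ts i) \<omega>)) \<partial>Q)"
    and tight: "\<And>\<epsilon> \<eta>::real. \<epsilon> > 0 \<Longrightarrow> \<eta> > 0 \<Longrightarrow> \<exists>m0. \<forall>m\<ge>m0. \<forall>\<^sub>F n in sequentially.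
       holds_up_to M \<eta> (\<lambda>\<omega>. \<forall>i\<le>m. \<forall>t\<in>{0..1}.
          \<bar>real m * t - real i\<bar> < 1 \<longrightarrow> \<bar>P n \<omega> t - P n \<omega> (real i / real m)\<bar> \<le> \<epsilon>)"
  shows "weak_conv_C01 M P Q (\<lambda>\<omega> t. Z t \<omega>)"
proof -
  interpret M: prob_space M by fact
  interpret Q: prob_space Q by fact
  have lower: "\<forall>\<^sub>F n in sequentially. (\<integral>\<omega>. F (P n \<omega>) \<partial>M) > (\<integral>\<omega>. F (\<lambda>t. Z t \<omega>) \<partial>Q) - e"
    if F: "bcont_C01 F" and e: "e > 0" for F and e :: real
  proof -
    obtain B where B: "\<And>f. f \<in> C01 \<Longrightarrow> \<bar>F f\<bar> \<le> B" using F unfolding bcont_C01_def by blast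
    have bc: "bcont_C01 (lip_env F (real k))" for k
      by (rule lipschitz_bcont_C01[OF lip_env_bounded[OF B] _ lip_env_lipschitz[OF B]]) auto
    have "(\<lambda>k. \<integral>\<omega>. lip_env F (real k) (\<lambda>t. Z t \<omega>) \<partial>Q) \<longlonglongrightarrow> (\<integral>\<omega>. F (\<lambda>t. Z t \<omega>) \<partial>Q)"
    proof (rule integral_dominated_convergence[where w="\<lambda>_. B"])
      show "AE \<omega> in Q. (\<lambda>k. lip_env F (real k) (\<lambda>t. Z t \<omega>)) \<longlonglongrightarrow> F (\<lambda>t. Z t \<omega>)"
        by (intro AE_I2 lip_env_tendsto[OF B F Z])
      show "AE \<omega> in Q. norm (lip_env F (real k) (\<lambda>t. Z t \<omega>)) \<le> B" for k
        using lip_env_bounded[OF B Z] by auto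
    qed (auto intro!: measurable_bcont_C01[OF F Z mZ] measurable_bcont_C01[OF bc Z mZ])
    then have "\<forall>\<^sub>F k in sequentially. (\<integral>\<omega>. lip_env F (real k) (\<lambda>t. Z t \<omega>) \<partial>Q) > (\<integral>\<omega>. F (\<lambda>t. Z t \<omega>) \<partial>Q) - e"
      using e by (intro order_tendstoD) auto
    then obtain k :: nat where k: "(\<integral>\<omega>. lip_env F (real k) (\<lambda>t. Z t \<omega>) \<partial>Q) > (\<integral>\<omega>. F (\<lambda>t. Z t \<omega>) \<partial>Q) - e"
      using eventually_happens[of _ sequentially] by auto
    have "(\<lambda>n. \<integral>\<omega>. lip_env F (real k) (P n \<omega>) \<partial>M) \<longlonglongrightarrow> (\<integral>\<omega>. lip_env F (real k) (\<lambda>t. Z t \<omega>) \<partial>Q)"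
      by (rule weak_conv_C01_lipschitz[OF M Q P mP Z mZ fdd tight lip_env_bounded[OF B] _ lip_env_lipschitz[OF B]]) auto
    then have "\<forall>\<^sub>F n in sequentially. (\<integral>\<omega>. lip_env F (real k) (P n \<omega>) \<partial>M) > (\<integral>\<omega>. F (\<lambda>t. Z t \<omega>) \<partial>Q) - e"
      using k by (intro order_tendstoD) auto
    then show ?thesis
    proof eventually_elim
      case (elim n)
      have "(\<integral>\<omega>. lip_env F (real k) (P n \<omega>) \<partial>M) \<le> (\<integral>\<omega>. F (P n \<omega>) \<partial>M)"
      proof (rule integral_mono)
        show "integrable M (\<lambda>\<omega>. lip_env F (real k) (P n \<omega>))"
          using lip_env_bounded[OF B P] measurable_bcont_C01[OF bc P mP]
          by (intro M.integrable_const_bound[where B=B]) auto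
        show "integrable M (\<lambda>\<omega>. F (P n \<omega>))"
          using B[OF P] measurable_bcont_C01[OF F P mP]
          by (intro M.integrable_const_bound[where B=B]) auto
        show "lip_env F (real k) (P n \<omega>) \<le> F (P n \<omega>)" if "\<omega> \<in> space M" for \<omega>
          using lip_env_le[OF B P[OF that, of n] P[OF that, of n], where k="real k"] by simp
      qed
      then show ?case using elim by linarith
    qed
  qed
  show ?thesis
    unfolding weak_conv_C01_def
  proof (intro allI impI tendstoI)
    fix F :: "(real \<Rightarrow> real) \<Rightarrow> real" and e :: real
    assume F: "bcont_C01 F" and e: "e > 0"
    have "bcont_C01 (\<lambda>f. - F f)"
      using F unfolding bcont_C01_def by (simp add: abs_minus_commute)
    from lower[OF F e] lower[OF this e]
    show "\<forall>\<^sub>F n in sequentially. dist (\<integral>\<omega>. F (P n \<omega>) \<partial>M) (\<integral>\<omega>. F (\<lambda>t. Z t \<omega>) \<partial>Q) < e"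
      by eventually_elim (simp add: dist_real_def abs_less_iff)
  qed
qed

section \<open>Sums of independent variables: moments and maximal inequalities\<close>

context prob_space
begin

lemma integrable_bounded:
  fixes X :: "'a \<Rightarrow> real"
  assumes "X \<in> borel_measurable M" "\<And>\<omega>. \<bar>X \<omega>\<bar> \<le> C"
  shows "integrable M X"
  by (rule integrable_const_bound[where B=C]) (use assms in auto)

lemma integrable_bounded_power:
  fixes X :: "'a \<Rightarrow> real"
  assumes [measurable]: "X \<in> borel_measurable M" and "\<And>\<omega>. \<bar>X \<omega>\<bar> \<le> C"
  shows "integrable M (\<lambda>\<omega>. X \<omega> ^ k)"
  by (rule integrable_bounded[where C="C ^ k"]) (use assms in \<open>auto simp: power_abs intro!: power_mono\<close>)

lemma prob_abs_gt_le:
  fixes T :: "'a \<Rightarrow> real"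
  assumes [measurable]: "T \<in> borel_measurable M" and int: "integrable M (\<lambda>\<omega>. T \<omega> ^ k)" and k: "even k" and x: "0 < x"
  shows "prob {\<omega>\<in>space M. x < \<bar>T \<omega>\<bar>} \<le> expectation (\<lambda>\<omega>. T \<omega> ^ k) / x ^ k"
proof -
  have le: "x ^ k \<le> T \<omega> ^ k" if "x < \<bar>T \<omega>\<bar>" for \<omega>
    using power_mono[of x "\<bar>T \<omega>\<bar>" k] that x k by (simp add: power_even_abs)
  have "prob {\<omega>\<in>space M. x < \<bar>T \<omega>\<bar>} \<le> prob {\<omega>\<in>space M. x ^ k \<le> T \<omega> ^ k}"
    using le by (intro finite_measure_mono) auto
  also have "\<dots> \<le> expectation (\<lambda>\<omega>. T \<omega> ^ k) / x ^ k"
    using int k x by (intro integral_Markov_inequality_measure[where A="{}"])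
      (auto simp: zero_le_even_power)
  finally show ?thesis .
qed

lemma indep_var_power_mult:
  fixes X Y :: "'a \<Rightarrow> real"
  assumes ind: "indep_var borel X borel Y"
    and X: "\<And>\<omega>. \<bar>X \<omega>\<bar> \<le> C" and Y: "\<And>\<omega>. \<bar>Y \<omega>\<bar> \<le> D"
  shows "expectation (\<lambda>\<omega>. X \<omega> ^ k * Y \<omega> ^ l) = expectation (\<lambda>\<omega>. X \<omega> ^ k) * expectation (\<lambda>\<omega>. Y \<omega> ^ l)"
    and "integrable M (\<lambda>\<omega>. X \<omega> ^ k * Y \<omega> ^ l)"
proof -
  have [measurable]: "X \<in> borel_measurable M" "Y \<in> borel_measurable M"
    using indep_var_rv1[OF ind] indep_var_rv2[OF ind] by auto
  have ind': "indep_var borel (\<lambda>\<omega>. X \<omega> ^ k) borel (\<lambda>\<omega>. Y \<omega> ^ l)"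
    using indep_var_compose[OF ind, of "\<lambda>x. x ^ k" borel "\<lambda>x. x ^ l" borel] by (simp add: comp_def)
  show "expectation (\<lambda>\<omega>. X \<omega> ^ k * Y \<omega> ^ l) = expectation (\<lambda>\<omega>. X \<omega> ^ k) * expectation (\<lambda>\<omega>. Y \<omega> ^ l)"
    "integrable M (\<lambda>\<omega>. X \<omega> ^ k * Y \<omega> ^ l)"
    using integrable_bounded_power[OF _ X] integrable_bounded_power[OF _ Y]
    by (auto intro!: indep_var_lebesgue_integral[OF ind'] indep_var_integrable[OF ind'])
qed

lemma abs_sum_bounded:
  fixes X :: "'i \<Rightarrow> 'a \<Rightarrow> real"
  assumes "\<And>j \<omega>. \<bar>X j \<omega>\<bar> \<le> C"
  shows "\<bar>\<Sum>j\<in>J. X j \<omega>\<bar> \<le> real (card J) * C"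
  using order.trans[OF sum_abs sum_bounded_above[of J "\<lambda>j. \<bar>X j \<omega>\<bar>" C]] assms by simp

lemma second_moment_sum:
  fixes X :: "'i \<Rightarrow> 'a \<Rightarrow> real"
  assumes "finite J" "indep_vars (\<lambda>_. borel) X J" "\<And>j \<omega>. \<bar>X j \<omega>\<bar> \<le> C"
    and "\<And>j. j \<in> J \<Longrightarrow> expectation (X j) = 0"
  shows "expectation (\<lambda>\<omega>. (\<Sum>j\<in>J. X j \<omega>)\<^sup>2) = (\<Sum>j\<in>J. expectation (\<lambda>\<omega>. (X j \<omega>)\<^sup>2))"
  using assms
proof (induction J rule: finite_induct)
  case (insert i J)
  have ind: "indep_var borel (X i) borel (\<lambda>\<omega>. \<Sum>j\<in>J. X j \<omega>)"
    by (rule indep_vars_sum) (use insert in auto)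
  have [measurable]: "X i \<in> borel_measurable M" "(\<lambda>\<omega>. \<Sum>j\<in>J. X j \<omega>) \<in> borel_measurable M"
    using indep_var_rv1[OF ind] indep_var_rv2[OF ind] by auto
  note TB = abs_sum_bounded[where X=X and J=J and C=C, OF insert.prems(2)]
  note m = indep_var_power_mult[OF ind insert.prems(2) TB]
  have int_powers: "integrable M (\<lambda>\<omega>. X i \<omega> ^ k)" "integrable M (\<lambda>\<omega>. (\<Sum>j\<in>J. X j \<omega>) ^ k)" for k
    by (auto intro!: integrable_bounded_power[OF _ TB] integrable_bounded_power[OF _ insert.prems(2)])
  have "expectation (\<lambda>\<omega>. (\<Sum>j\<in>insert i J. X j \<omega>)\<^sup>2) =
     expectation (\<lambda>\<omega>. (X i \<omega>)\<^sup>2 + 2 * (X i \<omega> ^ 1 * (\<Sum>j\<in>J. X j \<omega>) ^ 1) + (\<Sum>j\<in>J. X j \<omega>)\<^sup>2)"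
    using insert by (intro Bochner_Integration.integral_cong) (auto simp: power2_sum)
  also have "\<dots> = expectation (\<lambda>\<omega>. (X i \<omega>)\<^sup>2) + 2 * (expectation (\<lambda>\<omega>. X i \<omega> ^ 1) * expectation (\<lambda>\<omega>. (\<Sum>j\<in>J. X j \<omega>) ^ 1))
      + expectation (\<lambda>\<omega>. (\<Sum>j\<in>J. X j \<omega>)\<^sup>2)"
    by (simp only: Bochner_Integration.integral_add Bochner_Integration.integral_mult_right_zero
        Bochner_Integration.integrable_add integrable_mult_right m int_powers simp_thms)
  also have "expectation (\<lambda>\<omega>. X i \<omega> ^ 1) = 0" using insert.prems(3)[of i] by simp
  also have "expectation (\<lambda>\<omega>. (\<Sum>j\<in>J. X j \<omega>)\<^sup>2) = (\<Sum>j\<in>J. expectation (\<lambda>\<omega>. (X j \<omega>)\<^sup>2))"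
    using insert by (intro insert.IH indep_vars_subset[OF insert.prems(1)]) auto
  finally show ?case using insert by simp
qed simp

text \<open>In the expansion of (x + T)^4 with x independent of T the terms with an odd power of x
  vanish, leaving E x^4 + 6 E x^2 E T^2 + E T^4. The induction closes because 3 (c + 1)^2 = 3 c^2 +
  6 c + 3.\<close>

lemma fourth_moment_sum:
  fixes X :: "'i \<Rightarrow> 'a \<Rightarrow> real"
  assumes "finite J" "indep_vars (\<lambda>_. borel) X J" "\<And>j \<omega>. \<bar>X j \<omega>\<bar> \<le> C"
    and "\<And>j. j \<in> J \<Longrightarrow> expectation (X j) = 0" "\<And>j. j \<in> J \<Longrightarrow> expectation (\<lambda>\<omega>. X j \<omega> ^ 3) = 0"
    and "\<And>j. j \<in> J \<Longrightarrow> expectation (\<lambda>\<omega>. (X j \<omega>)\<^sup>2) = v" "\<And>j. j \<in> J \<Longrightarrow> expectation (\<lambda>\<omega>. X j \<omega> ^ 4) \<le> u"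
  shows "expectation (\<lambda>\<omega>. (\<Sum>j\<in>J. X j \<omega>) ^ 4) \<le> 3 * (real (card J) * v)\<^sup>2 + real (card J) * u"
  using assms
proof (induction J rule: finite_induct)
  case (insert i J)
  have ind: "indep_var borel (X i) borel (\<lambda>\<omega>. \<Sum>j\<in>J. X j \<omega>)"
    by (rule indep_vars_sum) (use insert in auto)
  have [measurable]: "X i \<in> borel_measurable M" "(\<lambda>\<omega>. \<Sum>j\<in>J. X j \<omega>) \<in> borel_measurable M"
    using indep_var_rv1[OF ind] indep_var_rv2[OF ind] by auto
  note TB = abs_sum_bounded[where X=X and J=J and C=C, OF insert.prems(2)]
  note m = indep_var_power_mult[OF ind insert.prems(2) TB]
  have int_powers: "integrable M (\<lambda>\<omega>. X i \<omega> ^ k)" "integrable M (\<lambda>\<omega>. (\<Sum>j\<in>J. X j \<omega>) ^ k)" for k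
    by (auto intro!: integrable_bounded_power[OF _ TB] integrable_bounded_power[OF _ insert.prems(2)])
  have T2: "expectation (\<lambda>\<omega>. (\<Sum>j\<in>J. X j \<omega>)\<^sup>2) = real (card J) * v"
    using insert second_moment_sum[OF insert.hyps(1) indep_vars_subset[OF insert.prems(1)] insert.prems(2)] by auto
  have "expectation (\<lambda>\<omega>. (\<Sum>j\<in>insert i J. X j \<omega>) ^ 4) =
     expectation (\<lambda>\<omega>. X i \<omega> ^ 4 + 4 * (X i \<omega> ^ 3 * (\<Sum>j\<in>J. X j \<omega>) ^ 1)
       + 6 * (X i \<omega> ^ 2 * (\<Sum>j\<in>J. X j \<omega>) ^ 2) + 4 * (X i \<omega> ^ 1 * (\<Sum>j\<in>J. X j \<omega>) ^ 3)
       + (\<Sum>j\<in>J. X j \<omega>) ^ 4)"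
    using insert by (intro Bochner_Integration.integral_cong)
      (auto simp: power2_eq_square power3_eq_cube power4_eq_xxxx algebra_simps)
  also have "\<dots> = expectation (\<lambda>\<omega>. X i \<omega> ^ 4)
     + 4 * (expectation (\<lambda>\<omega>. X i \<omega> ^ 3) * expectation (\<lambda>\<omega>. (\<Sum>j\<in>J. X j \<omega>) ^ 1))
     + 6 * (expectation (\<lambda>\<omega>. X i \<omega> ^ 2) * expectation (\<lambda>\<omega>. (\<Sum>j\<in>J. X j \<omega>) ^ 2))
     + 4 * (expectation (\<lambda>\<omega>. X i \<omega> ^ 1) * expectation (\<lambda>\<omega>. (\<Sum>j\<in>J. X j \<omega>) ^ 3))
      + expectation (\<lambda>\<omega>. (\<Sum>j\<in>J. X j \<omega>) ^ 4)"
    by (simp only: Bochner_Integration.integral_add Bochner_Integration.integral_mult_right_zero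
        Bochner_Integration.integrable_add integrable_mult_right m int_powers simp_thms)
  also have "expectation (\<lambda>\<omega>. X i \<omega> ^ 1) = 0" using insert.prems(3)[of i] by simp
  also have "expectation (\<lambda>\<omega>. X i \<omega> ^ 3) = 0" using insert.prems(4)[of i] by simp
  also have "expectation (\<lambda>\<omega>. X i \<omega> ^ 2) = v" using insert.prems(5)[of i] by simp
  finally have "expectation (\<lambda>\<omega>. (\<Sum>j\<in>insert i J. X j \<omega>) ^ 4) =
     expectation (\<lambda>\<omega>. X i \<omega> ^ 4) + 6 * (v * (real (card J) * v)) + expectation (\<lambda>\<omega>. (\<Sum>j\<in>J. X j \<omega>) ^ 4)"
    using T2 by simp
  also have "\<dots> \<le> u + 6 * (v * (real (card J) * v)) + (3 * (real (card J) * v)\<^sup>2 + real (card J) * u)"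
    using insert.IH[OF indep_vars_subset[OF insert.prems(1)] insert.prems(2)] insert.prems(3,4,5,6) 
    by (intro add_mono) auto
  also have "\<dots> \<le> 3 * (real (card (insert i J)) * v)\<^sup>2 + real (card (insert i J)) * u"
    using insert by (simp add: power2_eq_square algebra_simps)
  finally show ?case .
qed simp

text \<open>The event is split by the first index k at which the partial sum exceeds 2 x
  (\<open>A k\<close>). Independently of the past, the rest of the sum stays within x with
  probability at least 1/2 (\<open>B k\<close>), and then the full sum still exceeds x.\<close>

lemma ottaviani:
  fixes X :: "nat \<Rightarrow> 'a \<Rightarrow> real"
  assumes ind: "indep_vars (\<lambda>_. borel) X {p<..q}" and x: "0 \<le> x"
    and half: "\<And>k. k \<in> {p<..q} \<Longrightarrow> prob {\<omega>\<in>space M. x < \<bar>\<Sum>j\<in>{k<..q}. X j \<omega>\<bar>} \<le> 1/2"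
  shows "prob {\<omega>\<in>space M. \<exists>k\<in>{p..q}. 2 * x < \<bar>\<Sum>j\<in>{p<..k}. X j \<omega>\<bar>}
     \<le> 2 * prob {\<omega>\<in>space M. x < \<bar>\<Sum>j\<in>{p<..q}. X j \<omega>\<bar>}"
proof -
  have [measurable]: "X j \<in> borel_measurable M" if "j \<in> {p<..q}" for j
    using ind that unfolding indep_vars_def by auto
  define T where "T k \<omega> = (\<Sum>j\<in>{p<..k}. X j \<omega>)" for k \<omega>
  define A where "A k = {\<omega>\<in>space M. 2 * x < \<bar>T k \<omega>\<bar> \<and> (\<forall>l\<in>{p<..<k}. \<bar>T l \<omega>\<bar> \<le> 2 * x)}" for k
  define B where "B k = {\<omega>\<in>space M. \<bar>\<Sum>j\<in>{k<..q}. X j \<omega>\<bar> \<le> x}" for k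
  have mT [measurable]: "T k \<in> borel_measurable M" if "k \<le> q" for k
    unfolding T_def[abs_def] using that by (intro borel_measurable_sum) auto
  have mR [measurable]: "(\<lambda>\<omega>. \<Sum>j\<in>{k<..q}. X j \<omega>) \<in> borel_measurable M" if "p \<le> k" for k
    using that by (intro borel_measurable_sum) auto
  have mA [measurable]: "A k \<in> sets M" if "k \<in> {p<..q}" for k
  proof -
    have [measurable]: "T l \<in> borel_measurable M" if "l \<in> {p<..<k}" for l
      using that \<open>k \<in> {p<..q}\<close> by (intro mT) auto
    have [measurable]: "T k \<in> borel_measurable M" using that by (intro mT) auto
    show ?thesis unfolding A_def by measurable
  qed
  have mB [measurable]: "B k \<in> sets M" if "k \<in> {p<..q}" for k
  proof -
    have [measurable]: "(\<lambda>\<omega>. \<Sum>j\<in>{k<..q}. X j \<omega>) \<in> borel_measurable M" using that by (intro mR) auto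
    show ?thesis unfolding B_def by measurable
  qed
  \<comment> \<open>\<open>A k\<close> is determined by the variables up to k and \<open>B k\<close>
    by those after k; both are pulled back from product spaces over these disjoint index
    sets.\<close>
  have indAB: "prob (A k \<inter> B k) = prob (A k) * prob (B k)" if k: "k \<in> {p<..q}" for k
  proof -
    define A' where "A' = {f\<in>space (PiM {p<..k} (\<lambda>_. borel :: real measure)). 2 * x < \<bar>\<Sum>j\<in>{p<..k}. f j\<bar>
        \<and> (\<forall>l\<in>{p<..<k}. \<bar>\<Sum>j\<in>{p<..l}. f j\<bar> \<le> 2 * x)}"
    define B' where "B' = {f\<in>space (PiM {k<..q} (\<lambda>_. borel :: real measure)). \<bar>\<Sum>j\<in>{k<..q}. f j\<bar> \<le> x}"
    have [measurable]: "(\<lambda>f. \<Sum>j\<in>{p<..l}. f j) \<in> borel_measurable (PiM {p<..k} (\<lambda>_. borel :: real measure))" if "l \<le> k" for l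
      using that by (intro borel_measurable_sum measurable_component_singleton) auto
    have A': "A' \<in> sets (PiM {p<..k} (\<lambda>_. borel))" unfolding A'_def
      by (intro sets.sets_Collect_conj sets.sets_Collect_finite_All borel_measurable_less borel_measurable_le) auto
    have B': "B' \<in> sets (PiM {k<..q} (\<lambda>_. borel))" unfolding B'_def by measurable
    have iv: "indep_var (PiM {p<..k} (\<lambda>_. borel)) (\<lambda>\<omega>. restrict (\<lambda>i. X i \<omega>) {p<..k})
        (PiM {k<..q} (\<lambda>_. borel)) (\<lambda>\<omega>. restrict (\<lambda>i. X i \<omega>) {k<..q})"
      by (rule indep_var_restrict[OF ind]) (use k in auto)
    have eA: "(\<lambda>\<omega>. restrict (\<lambda>i. X i \<omega>) {p<..k}) -` A' \<inter> space M = A k"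
      unfolding A'_def A_def T_def
      by (auto simp: space_PiM subset_eq cong: sum.cong_simp)
    have eB: "(\<lambda>\<omega>. restrict (\<lambda>i. X i \<omega>) {k<..q}) -` B' \<inter> space M = B k"
      unfolding B'_def B_def by (auto simp: space_PiM)
    have "(\<lambda>\<omega>. (restrict (\<lambda>i. X i \<omega>) {p<..k}, restrict (\<lambda>i. X i \<omega>) {k<..q})) -` (A' \<times> B') \<inter> space M = A k \<inter> B k"
      unfolding eA[symmetric] eB[symmetric] by auto
    then show ?thesis using indep_varD[OF iv A' B'] unfolding eA eB by simp
  qed
  have "A k \<inter> A l = {}" if "k \<in> {p<..q}" "l \<in> {p<..q}" "k < l" for k l
  proof -
    have "\<bar>T k \<omega>\<bar> \<le> 2 * x" if "\<omega> \<in> A l" for \<omega>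
      using that \<open>k \<in> {p<..q}\<close> \<open>k < l\<close> unfolding A_def by auto
    then show ?thesis unfolding A_def[of k] by force
  qed
  then have disjA: "A k \<inter> A l = {}" if "k \<in> {p<..q}" "l \<in> {p<..q}" "k \<noteq> l" for k l
    using that by (metis Int_commute neq_iff)
  have disj: "disjoint_family_on (\<lambda>k. A k \<inter> B k) {p<..q}" "disjoint_family_on A {p<..q}"
    unfolding disjoint_family_on_def using disjA by blast+
  have PB: "1/2 \<le> prob (B k)" if k: "k \<in> {p<..q}" for k
  proof -
    have "B k = space M - {\<omega>\<in>space M. x < \<bar>\<Sum>j\<in>{k<..q}. X j \<omega>\<bar>}" unfolding B_def by auto
    then have "prob (B k) = 1 - prob {\<omega>\<in>space M. x < \<bar>\<Sum>j\<in>{k<..q}. X j \<omega>\<bar>}"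
      using mR[of k] k by (simp add: prob_compl)
    then show ?thesis using half[OF k] by simp
  qed
  have "prob {\<omega>\<in>space M. \<exists>k\<in>{p..q}. 2 * x < \<bar>\<Sum>j\<in>{p<..k}. X j \<omega>\<bar>} \<le> prob (\<Union>k\<in>{p<..q}. A k)"
  proof (intro finite_measure_mono subsetI)
    fix \<omega> assume "\<omega> \<in> {\<omega>\<in>space M. \<exists>k\<in>{p..q}. 2 * x < \<bar>\<Sum>j\<in>{p<..k}. X j \<omega>\<bar>}"
    then have \<omega>: "\<omega> \<in> space M" and ex: "\<exists>k. k \<le> q \<and> p \<le> k \<and> 2 * x < \<bar>T k \<omega>\<bar>"
      unfolding T_def by auto
    define k where "k = (LEAST k. k \<le> q \<and> p \<le> k \<and> 2 * x < \<bar>T k \<omega>\<bar>)"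
    have k: "k \<le> q \<and> p \<le> k \<and> 2 * x < \<bar>T k \<omega>\<bar>" unfolding k_def by (rule LeastI_ex[OF ex])
    have min: "\<not> (l \<le> q \<and> p \<le> l \<and> 2 * x < \<bar>T l \<omega>\<bar>)" if "l < k" for l
      using not_less_Least that unfolding k_def by blast
    \<comment> \<open>The empty sum at p is 0 and cannot exceed 2 x.\<close>
    have "k \<noteq> p" using k x by (auto simp: T_def)
    with k have "k \<in> {p<..q}" by auto
    moreover have "\<omega> \<in> A k" unfolding A_def using \<omega> k min by (force simp: not_less)
    ultimately show "\<omega> \<in> (\<Union>k\<in>{p<..q}. A k)" by blast
  qed auto
  also have "\<dots> = (\<Sum>k\<in>{p<..q}. prob (A k))"
    by (rule finite_measure_finite_Union) (use disj in auto)
  also have "\<dots> \<le> (\<Sum>k\<in>{p<..q}. 2 * prob (A k \<inter> B k))"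
  proof (rule sum_mono)
    fix k assume k: "k \<in> {p<..q}"
    show "prob (A k) \<le> 2 * prob (A k \<inter> B k)"
      using mult_left_mono[OF PB[OF k], of "prob (A k)"] indAB[OF k] by simp
  qed
  also have "\<dots> = 2 * prob (\<Union>k\<in>{p<..q}. A k \<inter> B k)"
    unfolding sum_distrib_left[symmetric]
    by (subst finite_measure_finite_Union) (use disj in auto)
  also have "prob (\<Union>k\<in>{p<..q}. A k \<inter> B k) \<le> prob {\<omega>\<in>space M. x < \<bar>\<Sum>j\<in>{p<..q}. X j \<omega>\<bar>}"
  proof (intro finite_measure_mono subsetI)
    fix \<omega> assume "\<omega> \<in> (\<Union>k\<in>{p<..q}. A k \<inter> B k)"
    then obtain k where k: "k \<in> {p<..q}" "\<omega> \<in> A k" "\<omega> \<in> B k" by auto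
    have "{p<..q} = {p<..k} \<union> {k<..q}" using k by auto
    then have "(\<Sum>j\<in>{p<..q}. X j \<omega>) = T k \<omega> + (\<Sum>j\<in>{k<..q}. X j \<omega>)"
      unfolding T_def by (simp add: sum.union_disjoint ivl_disj_int)
    then show "\<omega> \<in> {\<omega>\<in>space M. x < \<bar>\<Sum>j\<in>{p<..q}. X j \<omega>\<bar>}"
      using k unfolding A_def B_def by auto
  next
    have [measurable]: "(\<lambda>\<omega>. \<Sum>j\<in>{p<..q}. X j \<omega>) \<in> borel_measurable M" by (rule mR) simp
    show "{\<omega>\<in>space M. x < \<bar>\<Sum>j\<in>{p<..q}. X j \<omega>\<bar>} \<in> events" by measurable
  qed
  finally show ?thesis by simp
qed

text \<open>Chebyshev's inequality bounds the tail of every final segment by s / x^2, which is what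
  \<open>ottaviani\<close> needs if s / x^2 is at most 1/2. Otherwise the right side of the first
  bound exceeds 1.\<close>

lemma maximal_inequality_2:
  fixes X :: "nat \<Rightarrow> 'a \<Rightarrow> real"
  assumes ind: "indep_vars (\<lambda>_. borel) X {p<..q}" and bd: "\<And>j \<omega>. \<bar>X j \<omega>\<bar> \<le> C" and x: "0 < x"
    and mean: "\<And>j. j \<in> {p<..q} \<Longrightarrow> expectation (X j) = 0"
    and var: "\<And>j. j \<in> {p<..q} \<Longrightarrow> expectation (\<lambda>\<omega>. (X j \<omega>)\<^sup>2) \<le> v"
    and L: "real (q - p) * v \<le> s"
  shows "prob {\<omega>\<in>space M. \<exists>k\<in>{p..q}. 2 * x < \<bar>\<Sum>j\<in>{p<..k}. X j \<omega>\<bar>} \<le> 2 * s / x\<^sup>2"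
    and "s / x\<^sup>2 \<le> 1/2 \<Longrightarrow> prob {\<omega>\<in>space M. \<exists>k\<in>{p..q}. 2 * x < \<bar>\<Sum>j\<in>{p<..k}. X j \<omega>\<bar>}
     \<le> 2 * prob {\<omega>\<in>space M. x < \<bar>\<Sum>j\<in>{p<..q}. X j \<omega>\<bar>}"
proof -
  have [measurable]: "X j \<in> borel_measurable M" if "j \<in> {p<..q}" for j
    using ind that unfolding indep_vars_def by auto
  have tail: "prob {\<omega>\<in>space M. x < \<bar>\<Sum>j\<in>{k<..q}. X j \<omega>\<bar>} \<le> s / x\<^sup>2" if k: "p \<le> k" for k
  proof (cases "p < q")
    case False
    have "{k<..q} = {}" using k False by auto
    then show ?thesis using x L False by simp
  next
    case True
    have v: "0 \<le> v" using True by (intro order.trans[OF Bochner_Integration.integral_nonneg var[of q]]) auto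
    have [measurable]: "(\<lambda>\<omega>. \<Sum>j\<in>{k<..q}. X j \<omega>) \<in> borel_measurable M"
      using k by (intro borel_measurable_sum) auto
    have "prob {\<omega>\<in>space M. x < \<bar>\<Sum>j\<in>{k<..q}. X j \<omega>\<bar>} \<le> expectation (\<lambda>\<omega>. (\<Sum>j\<in>{k<..q}. X j \<omega>)\<^sup>2) / x\<^sup>2"
      using x by (intro prob_abs_gt_le integrable_bounded_power[OF _ abs_sum_bounded[OF bd]]) auto
    also have "expectation (\<lambda>\<omega>. (\<Sum>j\<in>{k<..q}. X j \<omega>)\<^sup>2) = (\<Sum>j\<in>{k<..q}. expectation (\<lambda>\<omega>. (X j \<omega>)\<^sup>2))"
      using k by (intro second_moment_sum[OF _ indep_vars_subset[OF ind] bd] mean) auto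
    also have "\<dots> \<le> (\<Sum>j\<in>{k<..q}. v)" using k by (intro sum_mono var) auto
    also have "\<dots> \<le> real (q - p) * v" using k v by (auto intro!: mult_right_mono)
    also have "\<dots> \<le> s" by (rule L)
    finally show ?thesis using x by (simp add: divide_right_mono)
  qed
  show 2: "prob {\<omega>\<in>space M. \<exists>k\<in>{p..q}. 2 * x < \<bar>\<Sum>j\<in>{p<..k}. X j \<omega>\<bar>}
     \<le> 2 * prob {\<omega>\<in>space M. x < \<bar>\<Sum>j\<in>{p<..q}. X j \<omega>\<bar>}" if "s / x\<^sup>2 \<le> 1/2"
  proof (rule ottaviani[OF ind])
    fix k assume "k \<in> {p<..q}"
    then show "prob {\<omega>\<in>space M. x < \<bar>\<Sum>j\<in>{k<..q}. X j \<omega>\<bar>} \<le> 1/2"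
      using order.trans[OF tail[of k] that] by auto
  qed (use x in auto)
  show "prob {\<omega>\<in>space M. \<exists>k\<in>{p..q}. 2 * x < \<bar>\<Sum>j\<in>{p<..k}. X j \<omega>\<bar>} \<le> 2 * s / x\<^sup>2"
  proof (cases "s / x\<^sup>2 \<le> 1/2")
    case True
    then show ?thesis using 2 tail[of p] by simp
  next
    case False
    then have "1 \<le> 2 * s / x\<^sup>2" by (simp add: mult.commute)
    then show ?thesis using prob_le_1 order.trans by blast
  qed
qed

text \<open>The leading term is quadratic in s. Summed over m blocks with s of order 1/m it is of
  order 1/m, whereas the linear bound from second moments would stay of order 1; this gain yields
  tightness.\<close>

lemma maximal_inequality_4:
  fixes X :: "nat \<Rightarrow> 'a \<Rightarrow> real"
  assumes ind: "indep_vars (\<lambda>_. borel) X {p<..q}" and bd: "\<And>j \<omega>. \<bar>X j \<omega>\<bar> \<le> C" and x: "0 < x"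
    and mean: "\<And>j. j \<in> {p<..q} \<Longrightarrow> expectation (X j) = 0" "\<And>j. j \<in> {p<..q} \<Longrightarrow> expectation (\<lambda>\<omega>. X j \<omega> ^ 3) = 0"
    and var: "\<And>j. j \<in> {p<..q} \<Longrightarrow> expectation (\<lambda>\<omega>. (X j \<omega>)\<^sup>2) = v" 
        "\<And>j. j \<in> {p<..q} \<Longrightarrow> expectation (\<lambda>\<omega>. X j \<omega> ^ 4) \<le> u"
    and L: "real (q - p) * v \<le> s" "s / x\<^sup>2 \<le> 1/2" "real (q - p) * u \<le> r" "0 \<le> v"
  shows "prob {\<omega>\<in>space M. \<exists>k\<in>{p..q}. 2 * x < \<bar>\<Sum>j\<in>{p<..k}. X j \<omega>\<bar>} \<le> 2 * (3 * s\<^sup>2 + r) / x ^ 4"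
proof -
  have [measurable]: "X j \<in> borel_measurable M" if "j \<in> {p<..q}" for j
    using ind that unfolding indep_vars_def by auto
  have [measurable]: "(\<lambda>\<omega>. \<Sum>j\<in>{p<..q}. X j \<omega>) \<in> borel_measurable M"
    by (intro borel_measurable_sum) auto
  have "prob {\<omega>\<in>space M. \<exists>k\<in>{p..q}. 2 * x < \<bar>\<Sum>j\<in>{p<..k}. X j \<omega>\<bar>}
     \<le> 2 * prob {\<omega>\<in>space M. x < \<bar>\<Sum>j\<in>{p<..q}. X j \<omega>\<bar>}"
    by (rule maximal_inequality_2(2)[OF ind bd x mean(1) _ L(1,2)]) (use var in auto)
  also have "prob {\<omega>\<in>space M. x < \<bar>\<Sum>j\<in>{p<..q}. X j \<omega>\<bar>} \<le> expectation (\<lambda>\<omega>. (\<Sum>j\<in>{p<..q}. X j \<omega>) ^ 4) / x ^ 4"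
    using x by (intro prob_abs_gt_le integrable_bounded_power[OF _ abs_sum_bounded[OF bd]]) auto
  also have "expectation (\<lambda>\<omega>. (\<Sum>j\<in>{p<..q}. X j \<omega>) ^ 4) \<le>
      3 * (real (card {p<..q}) * v)\<^sup>2 + real (card {p<..q}) * u"
    by (rule fourth_moment_sum[OF _ ind bd mean var]) auto
  also have "\<dots> \<le> 3 * s\<^sup>2 + r"
    using L by (intro add_mono mult_left_mono power_mono) auto
  finally show ?thesis using x by (simp add: divide_right_mono)
qed

section \<open>Characteristic functions of weighted sums\<close>

text \<open>Taylor expansion of order four, in which the odd terms vanish. Its remainder and its
  quartic term contribute m4 (1/12 + 1/24) = m4 / 8, and replacing 1 - z by exp (- z) with z = t^2 v
  / 2 costs z^2 / 2 = t^4 v^2 / 8.\<close>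

lemma char_symmetric_approx:
  fixes X :: "'a \<Rightarrow> real"
  assumes [measurable]: "X \<in> borel_measurable M" and bd: "\<And>\<omega>. \<bar>X \<omega>\<bar> \<le> C"
    and "expectation X = 0" "expectation (\<lambda>\<omega>. X \<omega> ^ 3) = 0"
    and "expectation (\<lambda>\<omega>. (X \<omega>)\<^sup>2) = v" "expectation (\<lambda>\<omega>. X \<omega> ^ 4) \<le> u"
  shows "cmod (char (distr M borel X) t - complex_of_real (exp (- (t\<^sup>2 * v) / 2))) \<le> t ^ 4 * (u + v\<^sup>2) / 8"
proof -
  define m4 where "m4 = expectation (\<lambda>\<omega>. X \<omega> ^ 4)"
  have m4: "0 \<le> m4" unfolding m4_def by (intro Bochner_Integration.integral_nonneg) auto
  have v: "0 \<le> v" using assms(5) Bochner_Integration.integral_nonneg[of M "\<lambda>\<omega>. (X \<omega>)\<^sup>2"] by simp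
  have "cmod (char (distr M borel X) t - (\<Sum>k\<le>4. ((\<i> * t)^k / fact k) * expectation (\<lambda>x. (X x)^k))) \<le>
    (2 * \<bar>t\<bar>^4 / fact 4) * expectation (\<lambda>x. \<bar>X x\<bar>^4)"
    by (rule char_approx1') (auto intro!: integrable_bounded_power bd)
  also have "(2 * \<bar>t\<bar>^4 / fact 4) * expectation (\<lambda>x. \<bar>X x\<bar>^4) = t ^ 4 * m4 / 12"
    unfolding m4_def by (simp add: fact_numeral power_even_abs)
  also have "(\<Sum>k\<le>4. ((\<i> * t)^k / fact k) * expectation (\<lambda>x. (X x)^k)) =
      complex_of_real (1 - t\<^sup>2 * v / 2 + t ^ 4 * m4 / 24)"
    using assms prob_space unfolding m4_def
    by (simp add: eval_nat_numeral numeral_eq_Suc atMost_Suc fact_numeral)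
       (simp add: complex_eq_iff power2_eq_square eval_nat_numeral)
  finally have 1: "cmod (char (distr M borel X) t - complex_of_real (1 - t\<^sup>2 * v / 2 + t ^ 4 * m4 / 24)) \<le> t ^ 4 * m4 / 12" .
  define z where "z = t\<^sup>2 * v / 2"
  have z: "0 \<le> z" unfolding z_def using v by simp
  \<comment> \<open>For z >= 0 the cubic remainder is nonpositive, so exp (- z) lies between 1 - z
    and 1 - z + z^2 / 2.\<close>
  have "\<bar>exp (- z) - (1 - z)\<bar> \<le> z\<^sup>2 / 2"
  proof -
    obtain w where "exp (- z) = (\<Sum>m<3. (- z) ^ m / fact m) + exp w / fact 3 * (- z) ^ 3"
      using Maclaurin_exp_le[of "- z" 3] by auto
    then have "exp (- z) = 1 - z + z\<^sup>2 / 2 - exp w / 6 * z ^ 3"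
      by (simp add: eval_nat_numeral fact_numeral)
    moreover have "0 \<le> exp w / 6 * z ^ 3" using z by simp
    moreover have "1 - z \<le> exp (- z)" using exp_ge_add_one_self[of "- z"] by simp
    ultimately show ?thesis by simp
  qed
  moreover have "z\<^sup>2 / 2 = t ^ 4 * v\<^sup>2 / 8" "exp (- (t\<^sup>2 * v) / 2) = exp (- z)"
      "t\<^sup>2 * v / 2 = z" "0 \<le> t ^ 4 * m4 / 24"
    using m4 by (simp_all add: z_def power_divide power_mult_distrib flip: power_mult)
  ultimately have "cmod (complex_of_real (1 - t\<^sup>2 * v / 2 + t ^ 4 * m4 / 24) - complex_of_real (exp (- (t\<^sup>2 * v) / 2)))
     \<le> t ^ 4 * m4 / 24 + t ^ 4 * v\<^sup>2 / 8"
    unfolding of_real_diff[symmetric] norm_of_real by linarith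
  with 1 have "cmod (char (distr M borel X) t - complex_of_real (exp (- (t\<^sup>2 * v) / 2))) \<le>
      t ^ 4 * m4 / 12 + (t ^ 4 * m4 / 24 + t ^ 4 * v\<^sup>2 / 8)"
    by (rule norm_diff_triangle_le)
  also have "\<dots> = t ^ 4 * (m4 + v\<^sup>2) / 8" by (simp add: field_simps)
  also have "\<dots> \<le> t ^ 4 * (u + v\<^sup>2) / 8"
    using assms(6) unfolding m4_def by (intro divide_right_mono mult_left_mono add_mono) auto
  finally show ?thesis .
qed

lemma expectation_cos_char:
  fixes R :: "'a \<Rightarrow> real"
  assumes [measurable]: "R \<in> borel_measurable M"
  shows "expectation (\<lambda>\<omega>. cos (a + R \<omega>)) = Re (cis a * char (distr M borel R) 1)"
proof -
  define c where "c = char (distr M borel R) 1"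
  have "c = expectation (\<lambda>\<omega>. iexp (R \<omega>))"
    unfolding c_def char_def by (subst integral_distr) auto
  then have "cis a * c = expectation (\<lambda>\<omega>. cis a * iexp (R \<omega>))" by simp
  moreover have "integrable M (\<lambda>\<omega>. cis a * iexp (R \<omega>))"
    by (intro integrable_mult_right integrable_const_bound[where B=1]) auto
  ultimately have "Re (cis a * c) = expectation (\<lambda>\<omega>. Re (cis a * iexp (R \<omega>)))"
    by (simp only: integral_Re)
  also have "\<dots> = expectation (\<lambda>\<omega>. cos (a + R \<omega>))"
    by (intro Bochner_Integration.integral_cong) (auto simp: cos_add Re_exp Im_exp)
  finally show ?thesis unfolding c_def ..
qed

text \<open>A quantitative central limit theorem: all factors have modulus at most 1, so the two
  products differ by at most the sum of the differences of their factors. The phase costs nothing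
  because \<open>cis a\<close> has modulus 1.\<close>

lemma expectation_cos_weighted_sum:
  fixes X :: "nat \<Rightarrow> 'a \<Rightarrow> real"
  assumes fin: "finite J" and ind: "indep_vars (\<lambda>_. borel) X J" and bd: "\<And>j \<omega>. \<bar>X j \<omega>\<bar> \<le> C"
    and mean: "\<And>j. j \<in> J \<Longrightarrow> expectation (X j) = 0" "\<And>j. j \<in> J \<Longrightarrow> expectation (\<lambda>\<omega>. X j \<omega> ^ 3) = 0"
    and var: "\<And>j. j \<in> J \<Longrightarrow> expectation (\<lambda>\<omega>. (X j \<omega>)\<^sup>2) = v" 
        "\<And>j. j \<in> J \<Longrightarrow> expectation (\<lambda>\<omega>. X j \<omega> ^ 4) \<le> u"
  shows "\<bar>expectation (\<lambda>\<omega>. cos (a + (\<Sum>j\<in>J. b j * X j \<omega>))) - cos a * exp (- ((\<Sum>j\<in>J. (b j)\<^sup>2) * v) / 2)\<bar>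
     \<le> (\<Sum>j\<in>J. b j ^ 4) * (u + v\<^sup>2) / 8"
proof -
  have [measurable]: "X j \<in> borel_measurable M" if "j \<in> J" for j
    using ind that unfolding indep_vars_def by auto
  define R where "R \<omega> = (\<Sum>j\<in>J. b j * X j \<omega>)" for \<omega>
  have [measurable]: "R \<in> borel_measurable M" unfolding R_def[abs_def] by measurable
  define c where "c = char (distr M borel R) 1"
  have cprod: "c = (\<Prod>j\<in>J. char (distr M borel (X j)) (b j))"
  proof -
    have "c = (\<Prod>j\<in>J. char (distr M borel (\<lambda>\<omega>. b j * X j \<omega>)) 1)"
      unfolding c_def R_def[abs_def]
      by (rule char_distr_sum) (rule indep_vars_compose2[OF ind], auto)
    also have "\<dots> = (\<Prod>j\<in>J. char (distr M borel (X j)) (b j))"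
      by (intro prod.cong refl) (simp add: char_def integral_distr)
    finally show ?thesis .
  qed
  have eprod: "complex_of_real (exp (- ((\<Sum>j\<in>J. (b j)\<^sup>2) * v) / 2)) = (\<Prod>j\<in>J. complex_of_real (exp (- ((b j)\<^sup>2 * v) / 2)))"
    unfolding of_real_prod[symmetric] exp_sum[OF fin, symmetric]
    by (simp add: sum_distrib_right sum_negf sum_divide_distrib)
  have diff: "cmod (c - complex_of_real (exp (- ((\<Sum>j\<in>J. (b j)\<^sup>2) * v) / 2))) \<le> (\<Sum>j\<in>J. b j ^ 4) * (u + v\<^sup>2) / 8"
  proof -
    have v: "0 \<le> v" if "j \<in> J" for j
      using var(1)[OF that] Bochner_Integration.integral_nonneg[of M "\<lambda>\<omega>. (X j \<omega>)\<^sup>2"] by simp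
    have "cmod (c - complex_of_real (exp (- ((\<Sum>j\<in>J. (b j)\<^sup>2) * v) / 2))) \<le>
        (\<Sum>j\<in>J. cmod (char (distr M borel (X j)) (b j) - complex_of_real (exp (- ((b j)\<^sup>2 * v) / 2))))"
      unfolding cprod eprod
      by (rule norm_prod_diff) (use v in \<open>auto intro!: real_distribution.cmod_char_le_1 real_distribution_distr\<close>)
    also have "\<dots> \<le> (\<Sum>j\<in>J. b j ^ 4 * (u + v\<^sup>2) / 8)"
      by (intro sum_mono char_symmetric_approx[OF _ bd]) (use mean var in auto)
    also have "\<dots> = (\<Sum>j\<in>J. b j ^ 4) * (u + v\<^sup>2) / 8"
      by (simp add: sum_distrib_right sum_divide_distrib)
    finally show ?thesis .
  qed
  have "expectation (\<lambda>\<omega>. cos (a + R \<omega>)) = Re (cis a * c)"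
    unfolding c_def by (rule expectation_cos_char) measurable
  then have "\<bar>expectation (\<lambda>\<omega>. cos (a + R \<omega>)) - cos a * exp (- ((\<Sum>j\<in>J. (b j)\<^sup>2) * v) / 2)\<bar> =
      \<bar>Re (cis a * (c - complex_of_real (exp (- ((\<Sum>j\<in>J. (b j)\<^sup>2) * v) / 2))))\<bar>"
    by (simp add: algebra_simps)
  also have "\<dots> \<le> cmod (cis a * (c - complex_of_real (exp (- ((\<Sum>j\<in>J. (b j)\<^sup>2) * v) / 2))))"
    by (rule abs_Re_le_cmod)
  also have "\<dots> \<le> (\<Sum>j\<in>J. b j ^ 4) * (u + v\<^sup>2) / 8" using diff by (simp add: norm_mult)
  finally show ?thesis unfolding R_def .
qed

end

section \<open>The domain of attraction of the normal law\<close>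

lemma one_minus_cos_le: "1 - cos u \<le> u\<^sup>2 / 2" for u :: real
proof -
  have "1 - cos u = 2 * (sin (u / 2))\<^sup>2" using cos_double_sin[of "u / 2"] by simp
  also have "(sin (u / 2))\<^sup>2 \<le> (u / 2)\<^sup>2"
    using abs_sin_x_le_abs_x[of "u / 2"] by (simp only: abs_le_square_iff)
  finally show ?thesis by (simp add: power_divide)
qed

text \<open>By Taylor the right side is at least u^2 / 2 - u^4 / 24, and u^4 <= 4 u^2 in this
  range.\<close>

lemma one_minus_cos_ge:
  assumes "\<bar>u\<bar> \<le> (2::real)"
  shows "u\<^sup>2 / 3 \<le> 1 - cos u"
proof -
  obtain t where "cos u = (\<Sum>m<4. cos_coeff m * u ^ m) + (cos (t + 1/2 * real 4 * pi) / fact 4) * u ^ 4"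
    using Maclaurin_cos_expansion[of u 4] by blast
  then have "cos u = 1 - u\<^sup>2 / 2 + cos (t + 2 * pi) / 24 * u ^ 4"
    by (simp add: cos_coeff_Suc sin_coeff_Suc numeral_eq_Suc fact_numeral)
  also have "cos (t + 2 * pi) / 24 * u ^ 4 \<le> 1 / 24 * u ^ 4"
    by (intro mult_right_mono divide_right_mono) auto
  also have "u ^ 4 \<le> 4 * u\<^sup>2"
    using mult_right_mono[of "u\<^sup>2" 4 "u\<^sup>2"] power_mono[OF assms, of 2]
    by (simp add: power2_eq_square power4_eq_xxxx)
  finally show ?thesis by simp
qed

lemma one_minus_cos_squared: "(1 - cos u)\<^sup>2 = 2 * (1 - cos u) - (1 - cos (2 * u)) / 2" for u :: real
  unfolding cos_double_cos by (simp add: power2_eq_square field_simps)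

text \<open>Beyond the level the value keeps modulus 1 instead of dropping to 0, so the fourth
  moment of a clipped variable also dominates the probability of exceeding the level. Clipping is
  odd and therefore preserves symmetry.\<close>

definition clip :: "real \<Rightarrow> real" where
  "clip y = max (- 1) (min 1 y)"

lemma abs_clip_le: "\<bar>clip y\<bar> \<le> 1"
  and clip_minus: "clip (- y) = - clip y"
  and clip_eq: "\<bar>y\<bar> \<le> 1 \<Longrightarrow> clip y = y"
  by (auto simp: clip_def)

lemma clip_measurable [measurable]: "clip \<in> borel_measurable borel"
  unfolding clip_def by measurable

lemma clip_cases: "1 < \<bar>y\<bar> \<Longrightarrow> clip y = 1 \<or> clip y = - 1"
  by (auto simp: clip_def abs_if split: if_splits)

lemma clip_sq: "(clip y)\<^sup>2 = min 1 (y\<^sup>2)"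
proof (cases "\<bar>y\<bar> \<le> 1")
  case True
  then show ?thesis using abs_square_le_1[of y] by (simp add: clip_eq)
next
  case False
  then have "1 \<le> y\<^sup>2" using abs_square_le_1[of y] by linarith
  then show ?thesis using False clip_cases[of y] by auto
qed

lemma clip_power4_eq_1: "1 < \<bar>y\<bar> \<Longrightarrow> clip y ^ 4 = 1"
  using clip_cases[of y] by auto

text \<open>This serves the lower estimate: it keeps the second moment of the clipped variable from
  being too small.\<close>

lemma one_minus_cos_le_clip: "1 - cos u \<le> 2 * (clip u)\<^sup>2"
proof -
  have "1 - cos u \<le> 2" using cos_ge_minus_one[of u] by linarith
  moreover have "1 - cos u \<le> 2 * u\<^sup>2" using one_minus_cos_le[of u] zero_le_power2[of u] by linarith
  ultimately show ?thesis by (simp add: clip_sq min_def)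
qed

text \<open>For t = 1 alone the integrand vanishes at all multiples of 2 pi; averaging over t
  removes these zeros.\<close>

definition cos_avg :: "real \<Rightarrow> real" where
  "cos_avg y = (\<integral>t. indicator {0..1} t * (1 - cos (t * y))\<^sup>2 \<partial>lborel)"

lemma cos_avg_nonneg: "0 \<le> cos_avg y"
  unfolding cos_avg_def by (intro Bochner_Integration.integral_nonneg) auto

text \<open>With s = 1 - cos (t y), (s - 1/2)^2 >= 0 gives s^2 >= s - 1/4 = 3/4 - cos (t y). The
  latter integrates to 3/4 - sin y / y, which is at least 3/4 - 1/2.\<close>

lemma cos_avg_ge:
  assumes "2 \<le> \<bar>y\<bar>"
  shows "1 / 4 \<le> cos_avg y"
proof -
  have y: "y \<noteq> 0" using assms by auto
  have i1: "integrable lborel (\<lambda>t. indicator {0..1::real} t *\<^sub>R f t)" if "continuous_on UNIV f" for f :: "real \<Rightarrow> real"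
    by (rule borel_integrable_compact) (auto intro: continuous_on_subset[OF that])
  have "(\<integral>t. (3/4 - cos (t * y)) * indicator {0..1} t \<partial>lborel) =
      (3/4 * 1 - sin (1 * y) / y) - (3/4 * 0 - sin (0 * y) / y)"
    by (rule integral_FTC_Icc_real) (auto intro!: derivative_eq_intros continuous_intros simp: y)
  then have e: "(\<integral>t. indicator {0..1} t *\<^sub>R (3/4 - cos (t * y)) \<partial>lborel) = 3/4 - sin y / y"
    by (simp add: mult.commute)
  have "sin y / y \<le> \<bar>sin y\<bar> / \<bar>y\<bar>" by (metis abs_divide abs_ge_self)
  also have "\<dots> \<le> 1 / 2" using assms abs_sin_le_one[of y] by (intro frac_le) auto
  finally have "1 / 4 \<le> 3/4 - sin y / y" by linarith
  also have "\<dots> \<le> cos_avg y"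
    unfolding e[symmetric] cos_avg_def
  proof (rule integral_mono)
    show "integrable lborel (\<lambda>t. indicator {0..1} t *\<^sub>R (3/4 - cos (t * y)))"
      by (intro i1 continuous_intros)
    show "integrable lborel (\<lambda>t. indicator {0..1} t * (1 - cos (t * y))\<^sup>2)"
    proof -
      have "continuous_on UNIV (\<lambda>t. (1 - cos (t * y))\<^sup>2)" by (intro continuous_intros)
      from i1[OF this] show ?thesis by simp
    qed
    show "indicator {0..1} t *\<^sub>R (3/4 - cos (t * y)) \<le> indicator {0..1} t * (1 - cos (t * y))\<^sup>2" for t
    proof -
      have "0 \<le> ((1 - cos (t * y)) - 1/2)\<^sup>2" by simp
      then have "3/4 - cos (t * y) \<le> (1 - cos (t * y))\<^sup>2" by (simp add: power2_eq_square algebra_simps)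
      then show ?thesis by (auto split: split_indicator)
    qed
  qed
  finally show ?thesis .
qed

text \<open>For |y| < 2 the bound y^2 <= 3 (1 - cos y) is squared, whence the 9. For larger |y| the
  left side is at most 1 and \<open>cos_avg y\<close> is at least 1/4.\<close>

lemma clip_power4_le: "clip y ^ 4 \<le> 9 * (1 - cos y)\<^sup>2 + 4 * cos_avg y"
proof (cases "2 \<le> \<bar>y\<bar>")
  case True
  have "clip y ^ 4 \<le> 1" using power_mono[OF abs_clip_le[of y], of 4] by (simp add: power_even_abs)
  then show ?thesis using cos_avg_ge[OF True] zero_le_power2[of "1 - cos y"] by linarith
next
  case False
  have "(clip y)\<^sup>2 \<le> y\<^sup>2" by (simp add: clip_sq)
  also have "\<dots> \<le> 3 * (1 - cos y)" using one_minus_cos_ge[of y] False by simp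
  finally have "((clip y)\<^sup>2)\<^sup>2 \<le> (3 * (1 - cos y))\<^sup>2" by (intro power_mono) auto
  also have "\<dots> = 9 * (1 - cos y)\<^sup>2" unfolding power_mult_distrib by simp
  finally show ?thesis using cos_avg_nonneg[of y] by (simp flip: power_mult)
qed

section \<open>Moments of clipped variables from convergence of characteristic functions\<close>

context
  fixes \<mu> :: "real measure" and a :: "nat \<Rightarrow> real" and h :: "nat \<Rightarrow> real \<Rightarrow> real"
  assumes \<mu>: "real_distribution \<mu>" and a: "\<And>n. a n > 0"
    and conv: "\<And>t. (\<lambda>n. (\<integral>x. cos (t * x / a n) \<partial>\<mu>) ^ n) \<longlonglongrightarrow> exp (- t\<^sup>2 / 2)"
    and equi: "\<forall>\<^sub>F n in sequentially. \<forall>t. \<bar>t\<bar> \<le> 1/4 \<longrightarrow> (\<integral>x. cos (t * x / a n) \<partial>\<mu>) ^ n \<ge> 1/2"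
  defines "h \<equiv> \<lambda>n t. real n * (\<integral>x. 1 - cos (t * x / a n) \<partial>\<mu>)"
begin

interpretation real_distribution \<mu> by (rule \<mu>)

lemma mu_UNIV: "measure \<mu> UNIV = 1"
  using prob_space by simp

lemma integrable_cos: "integrable \<mu> (\<lambda>x. cos (c * x / d))" "integrable \<mu> (\<lambda>x. (1 - cos (c * x / d)))"
    "integrable \<mu> (\<lambda>x. (1 - cos (c * x / d))\<^sup>2)"
proof -
  have "\<bar>1 - cos x\<bar> \<le> 2" for x :: real
    using cos_ge_minus_one[of x] by (simp add: abs_le_iff)
  moreover have "(1 - cos x)\<^sup>2 \<le> 4" for x :: real
    using power_mono[of "1 - cos x" 2 2] cos_ge_minus_one[of x] by simp
  ultimately show "integrable \<mu> (\<lambda>x. (1 - cos (c * x / d)))" "integrable \<mu> (\<lambda>x. (1 - cos (c * x / d))\<^sup>2)"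
    by (intro integrable_const_bound[where B=2] integrable_const_bound[where B=4]; simp)+
  show "integrable \<mu> (\<lambda>x. cos (c * x / d))"
    by (rule integrable_const_bound[where B=1]) auto
qed

lemma h_alt: "h n t = real n * (1 - (\<integral>x. cos (t * x / a n) \<partial>\<mu>))"
  unfolding h_def by (simp add: integrable_cos mu_UNIV)

lemma h_nonneg: "0 \<le> h n t"
  unfolding h_def by (intro mult_nonneg_nonneg Bochner_Integration.integral_nonneg) auto

lemma continuous_phi: "continuous_on UNIV (\<lambda>t. \<integral>x. cos (t * x / d) \<partial>\<mu>)"
proof -
  have "isCont (\<lambda>t. \<integral>x. cos (t * x / d) \<partial>\<mu>) t" for t
    unfolding continuous_at_sequentially comp_def
  proof safe
    fix s assume s: "s \<longlonglongrightarrow> t"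
    show "(\<lambda>n. \<integral>x. cos (s n * x / d) \<partial>\<mu>) \<longlonglongrightarrow> (\<integral>x. cos (t * x / d) \<partial>\<mu>)"
      by (rule integral_dominated_convergence[where w="\<lambda>_. 1"])
         (auto intro!: AE_I2 isCont_tendsto_compose[OF isCont_cos] tendsto_divide_0 tendsto_mult s tendsto_const
            simp: divide_inverse)
  qed
  then show ?thesis by (auto simp: continuous_on_eq_continuous_at)
qed

text \<open>Convergence of u^n, with u the characteristic function at t / \<open>a n\<close>, leaves
  the sign of u open for even n. The bound \<open>equi\<close> excludes zeros of u on |t| <= 1/4,
  and u = 1 at t = 0 together with continuity makes u positive there, so logarithms can be taken.
  For l = - n ln u one has u l <= n (1 - u) <= l, and u >= 1 - 1/n.\<close>

lemma h_sandwich: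
  "\<forall>\<^sub>F n in sequentially. \<forall>t. \<bar>t\<bar> \<le> 1/4 \<longrightarrow> h n t \<le> 1 \<and>
     h n t \<le> - ln ((\<integral>x. cos (t * x / a n) \<partial>\<mu>) ^ n) \<and>
     (1 - 1 / real n) * (- ln ((\<integral>x. cos (t * x / a n) \<partial>\<mu>) ^ n)) \<le> h n t"
  using equi eventually_gt_at_top[of 0]
proof eventually_elim
  case (elim n)
  define u where "u t = (\<integral>x. cos (t * x / a n) \<partial>\<mu>)" for t
  have half: "1/2 \<le> u t ^ n" if "\<bar>t\<bar> \<le> 1/4" for t using elim that unfolding u_def by blast
  have u0: "u 0 = 1" unfolding u_def by (simp add: mu_UNIV)
  have cont: "continuous_on A u" for A
    unfolding u_def[abs_def] by (rule continuous_on_subset[OF continuous_phi]) auto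
  have nz: "u t \<noteq> 0" if "\<bar>t\<bar> \<le> 1/4" for t
    using half[OF that] elim by (auto simp: power_0_left)
  have pos: "u t > 0" if t: "\<bar>t\<bar> \<le> 1/4" for t
  proof (rule ccontr)
    assume "\<not> u t > 0"
    then have ut: "u t \<le> 0" by simp
    show False
    proof (cases "t \<ge> 0")
      case True
      then obtain s where "0 \<le> s" "s \<le> t" "u s = 0"
        using IVT2'[of u t 0 0, OF ut _ True cont] u0 by auto
      then show False using nz[of s] t by auto
    next
      case False
      then obtain s where "t \<le> s" "s \<le> 0" "u s = 0"
        using IVT'[of u t 0 0, OF ut _ _ cont] u0 by auto
      then show False using nz[of s] t by auto
    qed
  qed
  show ?case
  proof (intro allI impI)
    fix t :: real assume t: "\<bar>t\<bar> \<le> 1/4"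
    define l where "l = - ln (u t ^ n)"
    have l: "l = - real n * ln (u t)" unfolding l_def using pos[OF t] by (simp add: ln_realpow)
    have h: "h n t = real n * (1 - u t)" unfolding h_alt u_def by simp
    have 1: "h n t \<le> l"
      unfolding h l using ln_le_minus_one[OF pos[OF t]] mult_left_mono[of "ln (u t)" "u t - 1" "real n"]
      by (simp add: algebra_simps)
    \<comment> \<open>l <= ln 2 < 1 gives \<open>h n t \<le> 1\<close> uniformly in t; this will
      dominate the integral over t in \<open>cos_avg_tendsto\<close>.\<close>
    have "ln (1/2) \<le> ln (u t ^ n)" using half[OF t] pos[OF t] by (subst ln_le_cancel_iff) auto
    then have "l \<le> ln 2" unfolding l_def by (simp add: ln_div)
    then have l1: "l \<le> 1" using ln_2_less_1 by linarith
    have "1 - u t \<le> 1 / real n" using 1 l1 elim unfolding h by (simp add: field_simps)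
    then have "1 - 1 / real n \<le> u t" by simp
    moreover have l0: "0 \<le> l" using 1 h_nonneg[of n t] by linarith
    ultimately have "(1 - 1 / real n) * l \<le> u t * l" by (intro mult_right_mono)
    also have "u t * l \<le> h n t"
    proof -
      have "- ln (u t) \<le> inverse (u t) - 1"
        using ln_le_minus_one[of "inverse (u t)"] pos[OF t] by (simp add: ln_inverse)
      then have "u t * (- ln (u t)) \<le> u t * (inverse (u t) - 1)"
        using pos[OF t] by (intro mult_left_mono) auto
      also have "\<dots> = 1 - u t" using pos[OF t] by (simp add: algebra_simps)
      finally have "real n * (u t * (- ln (u t))) \<le> real n * (1 - u t)" by (intro mult_left_mono) auto
      then show ?thesis unfolding h l by (simp add: algebra_simps)
    qed
    finally show "h n t \<le> 1 \<and> h n t \<le> - ln ((\<integral>x. cos (t * x / a n) \<partial>\<mu>) ^ n) \<and>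
     (1 - 1 / real n) * (- ln ((\<integral>x. cos (t * x / a n) \<partial>\<mu>) ^ n)) \<le> h n t"
      using 1 l1 unfolding l_def u_def by simp
  qed
qed

lemma h_tendsto:
  assumes t: "\<bar>t\<bar> \<le> 1/4"
  shows "(\<lambda>n. h n t) \<longlonglongrightarrow> t\<^sup>2 / 2"
proof (rule tendsto_sandwich)
  show "\<forall>\<^sub>F n in sequentially. (1 - 1 / real n) * (- ln ((\<integral>x. cos (t * x / a n) \<partial>\<mu>) ^ n)) \<le> h n t"
    using h_sandwich by eventually_elim (use t in auto)
  show "\<forall>\<^sub>F n in sequentially. h n t \<le> - ln ((\<integral>x. cos (t * x / a n) \<partial>\<mu>) ^ n)"
    using h_sandwich by eventually_elim (use t in auto)
  show l: "(\<lambda>n. - ln ((\<integral>x. cos (t * x / a n) \<partial>\<mu>) ^ n)) \<longlonglongrightarrow> t\<^sup>2 / 2"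
    using tendsto_minus[OF tendsto_ln[OF conv[of t]]] by simp
  have "(\<lambda>n. (1 - 1 / real n) * (- ln ((\<integral>x. cos (t * x / a n) \<partial>\<mu>) ^ n))) \<longlonglongrightarrow> (1 - 0) * (t\<^sup>2 / 2)"
    by (intro tendsto_intros lim_1_over_n l)
  then show "(\<lambda>n. (1 - 1 / real n) * (- ln ((\<integral>x. cos (t * x / a n) \<partial>\<mu>) ^ n))) \<longlonglongrightarrow> t\<^sup>2 / 2" by simp
qed

text \<open>The scale \<open>8 * a n\<close> puts both the angle t / 8 and its double t / 4 into the
  range of \<open>h_tendsto\<close> whenever |t| <= 1.\<close>

lemma integral_one_minus_cos_squared:
  "real n * (\<integral>x. (1 - cos (t * (x / (8 * a n))))\<^sup>2 \<partial>\<mu>) = 2 * h n (t / 8) - h n (t / 4) / 2"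
proof -
  have "(\<integral>x. (1 - cos (t * (x / (8 * a n))))\<^sup>2 \<partial>\<mu>) =
     (\<integral>x. 2 * (1 - cos ((t / 8) * x / a n)) - (1 - cos ((t / 4) * x / a n)) / 2 \<partial>\<mu>)"
    unfolding one_minus_cos_squared by (intro Bochner_Integration.integral_cong) (auto simp: field_simps)
  also have "\<dots> = 2 * (\<integral>x. 1 - cos ((t / 8) * x / a n) \<partial>\<mu>) - (\<integral>x. 1 - cos ((t / 4) * x / a n) \<partial>\<mu>) / 2"
    using integrable_cos(2)[of "t / 8" "a n"] integrable_cos(2)[of "t / 4" "a n"]
    by (simp only: Bochner_Integration.integral_diff integrable_mult_right integrable_divide
        Bochner_Integration.integral_mult_right_zero Bochner_Integration.integral_divide_zero simp_thms)
  finally have *: "(\<integral>x. (1 - cos (t * (x / (8 * a n))))\<^sup>2 \<partial>\<mu>) =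
     2 * (\<integral>x. 1 - cos ((t / 8) * x / a n) \<partial>\<mu>) - (\<integral>x. 1 - cos ((t / 4) * x / a n) \<partial>\<mu>) / 2" .
  show ?thesis unfolding h_def * by (simp only: right_diff_distrib mult.left_commute times_divide_eq_right)
qed

lemma cos_squared_tendsto:
  assumes "\<bar>t\<bar> \<le> 1"
  shows "(\<lambda>n. real n * (\<integral>x. (1 - cos (t * (x / (8 * a n))))\<^sup>2 \<partial>\<mu>)) \<longlonglongrightarrow> 0"
proof -
  have "(\<lambda>n. 2 * h n (t / 8) - h n (t / 4) / 2) \<longlonglongrightarrow> 2 * ((t / 8)\<^sup>2 / 2) - ((t / 4)\<^sup>2 / 2) / 2"
    by (intro tendsto_intros h_tendsto) (use assms in auto)
  then show ?thesis unfolding integral_one_minus_cos_squared by (simp add: power_divide)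
qed

text \<open>By Fubini the claim concerns an integral over t of the quantities in
  \<open>cos_squared_tendsto\<close>. They are dominated by 2, since \<open>h\<close> is at most 1
  from n0 on and the subtracted term is nonnegative.\<close>

lemma cos_avg_tendsto: "(\<lambda>n. real n * (\<integral>x. cos_avg (x / (8 * a n)) \<partial>\<mu>)) \<longlonglongrightarrow> 0"
  and integrable_cos_avg: "integrable \<mu> (\<lambda>x. cos_avg (x / d))"
proof -
  interpret P: pair_sigma_finite \<mu> lborel ..
  have sq: "(1 - cos x)\<^sup>2 \<le> 4" for x :: real
    using power_mono[of "1 - cos x" 2 2] cos_ge_minus_one[of x] by simp
  have int: "integrable (\<mu> \<Otimes>\<^sub>M lborel) (\<lambda>p. indicator (UNIV \<times> {0..1}) p *\<^sub>R (1 - cos (snd p * (fst p / d)))\<^sup>2)" for d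
    by (intro integrableI_bounded_set_indicator[where B=4])
       (auto simp: lborel.emeasure_pair_measure_Times emeasure_space_1[simplified space_eq_univ] sq)
  then have int': "integrable (\<mu> \<Otimes>\<^sub>M lborel) (\<lambda>(x, t). indicator {0..1} t * (1 - cos (t * (x / d)))\<^sup>2)" for d
    by (simp add: split_beta' indicator_times)
  have fub: "(\<integral>x. cos_avg (x / d) \<partial>\<mu>) = (\<integral>t. indicator {0..1} t * (\<integral>x. (1 - cos (t * (x / d)))\<^sup>2 \<partial>\<mu>) \<partial>lborel)" for d
    unfolding cos_avg_def using P.Fubini_integral[OF int', symmetric] by simp
  show "integrable \<mu> (\<lambda>x. cos_avg (x / d))" for d
    unfolding cos_avg_def using P.integrable_fst'[OF int'] by simp
  obtain n0 where n0: "\<And>n t. n \<ge> n0 \<Longrightarrow> \<bar>t\<bar> \<le> 1/4 \<Longrightarrow> h n t \<le> 1"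
    using h_sandwich unfolding eventually_sequentially by blast
  define g where "g n t = real n * (\<integral>x. (1 - cos (t * (x / (8 * a n))))\<^sup>2 \<partial>\<mu>)" for n t
  have "(\<lambda>k. \<integral>t. indicator {0..1} t * g (k + n0) t \<partial>lborel) \<longlonglongrightarrow> (\<integral>t. 0 \<partial>(lborel :: real measure))"
  proof (rule integral_dominated_convergence[where w="\<lambda>t. indicator {0..1} t *\<^sub>R 2"])
    show "integrable lborel (\<lambda>t::real. indicator {0..1} t *\<^sub>R (2::real))"
      by (rule borel_integrable_compact) auto
    show "AE t in lborel. (\<lambda>k. indicator {0..1} t * g (k + n0) t) \<longlonglongrightarrow> 0"
      using LIMSEQ_ignore_initial_segment[OF cos_squared_tendsto, of _ n0]
      by (intro AE_I2) (auto simp: g_def split: split_indicator)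
    show "AE t in lborel. norm (indicator {0..1} t * g (k + n0) t) \<le> indicator {0..1} t *\<^sub>R 2" for k
    proof (rule AE_I2)
      fix t :: real
      have "0 \<le> g n t" for n unfolding g_def by (intro mult_nonneg_nonneg Bochner_Integration.integral_nonneg) auto
      moreover have "g (k + n0) t \<le> 2" if "t \<in> {0..1}"
        using n0[of "k + n0" "t / 8"] h_nonneg[of "k + n0" "t / 4"] that
        unfolding g_def integral_one_minus_cos_squared by simp
      ultimately show "norm (indicator {0..1} t * g (k + n0) t) \<le> indicator {0..1} t *\<^sub>R 2"
        by (auto split: split_indicator)
    qed
    show "(\<lambda>t. indicator {0..1} t * g (k + n0) t) \<in> borel_measurable lborel" for k
      unfolding g_def by measurable
  qed auto
  then have "(\<lambda>k. real (k + n0) * (\<integral>x. cos_avg (x / (8 * a (k + n0))) \<partial>\<mu>)) \<longlonglongrightarrow> 0"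
    unfolding fub g_def by (simp add: mult.left_commute)
  then show "(\<lambda>n. real n * (\<integral>x. cos_avg (x / (8 * a n)) \<partial>\<mu>)) \<longlonglongrightarrow> 0"
    by (rule LIMSEQ_offset)
qed

lemma integrable_clip: "integrable \<mu> (\<lambda>x. clip (x / d) ^ k)"
  by (rule integrable_const_bound[where B=1])
     (auto simp: power_abs intro!: power_le_one abs_clip_le)

lemma clip_moment4_tendsto: "(\<lambda>n. real n * (\<integral>x. clip (x / (8 * a n)) ^ 4 \<partial>\<mu>)) \<longlonglongrightarrow> 0"
proof (rule tendsto_sandwich[OF always_eventually always_eventually tendsto_const])
  show "\<forall>n. 0 \<le> real n * (\<integral>x. clip (x / (8 * a n)) ^ 4 \<partial>\<mu>)"
    by (auto intro!: mult_nonneg_nonneg Bochner_Integration.integral_nonneg zero_le_even_power)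
  show "\<forall>n. real n * (\<integral>x. clip (x / (8 * a n)) ^ 4 \<partial>\<mu>) \<le>
     9 * (real n * (\<integral>x. (1 - cos (1 * (x / (8 * a n))))\<^sup>2 \<partial>\<mu>)) + 4 * (real n * (\<integral>x. cos_avg (x / (8 * a n)) \<partial>\<mu>))"
  proof
    fix n
    have i: "integrable \<mu> (\<lambda>x. (1 - cos (1 * (x / (8 * a n))))\<^sup>2)"
      using integrable_cos(3)[of 1 "8 * a n"] by simp
    have "(\<integral>x. clip (x / (8 * a n)) ^ 4 \<partial>\<mu>) \<le>
      (\<integral>x. 9 * (1 - cos (1 * (x / (8 * a n))))\<^sup>2 + 4 * cos_avg (x / (8 * a n)) \<partial>\<mu>)"
      using i clip_power4_le integrable_cos_avg[of "8 * a n"] by (intro integral_mono integrable_clip) auto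
    also have "\<dots> = 9 * (\<integral>x. (1 - cos (1 * (x / (8 * a n))))\<^sup>2 \<partial>\<mu>) + 4 * (\<integral>x. cos_avg (x / (8 * a n)) \<partial>\<mu>)"
      using i integrable_cos_avg[of "8 * a n"] by simp
    finally have "(\<integral>x. clip (x / (8 * a n)) ^ 4 \<partial>\<mu>) \<le>
      9 * (\<integral>x. (1 - cos (1 * (x / (8 * a n))))\<^sup>2 \<partial>\<mu>) + 4 * (\<integral>x. cos_avg (x / (8 * a n)) \<partial>\<mu>)" .
    then show "real n * (\<integral>x. clip (x / (8 * a n)) ^ 4 \<partial>\<mu>) \<le>
     9 * (real n * (\<integral>x. (1 - cos (1 * (x / (8 * a n))))\<^sup>2 \<partial>\<mu>)) + 4 * (real n * (\<integral>x. cos_avg (x / (8 * a n)) \<partial>\<mu>))"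
    proof (elim order.trans[OF mult_left_mono])
      show "real n * (9 * (\<integral>x. (1 - cos (1 * (x / (8 * a n))))\<^sup>2 \<partial>\<mu>) + 4 * (\<integral>x. cos_avg (x / (8 * a n)) \<partial>\<mu>))
        \<le> 9 * (real n * (\<integral>x. (1 - cos (1 * (x / (8 * a n))))\<^sup>2 \<partial>\<mu>)) + 4 * (real n * (\<integral>x. cos_avg (x / (8 * a n)) \<partial>\<mu>))"
        by (simp only: distrib_left mult.left_commute order.refl)
    qed simp
  qed
  have "(\<lambda>n. 9 * (real n * (\<integral>x. (1 - cos (1 * (x / (8 * a n))))\<^sup>2 \<partial>\<mu>)) + 4 * (real n * (\<integral>x. cos_avg (x / (8 * a n)) \<partial>\<mu>)))
     \<longlonglongrightarrow> 9 * 0 + 4 * 0"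
    by (intro tendsto_intros cos_squared_tendsto cos_avg_tendsto) auto
  then show "(\<lambda>n. 9 * (real n * (\<integral>x. (1 - cos (1 * (x / (8 * a n))))\<^sup>2 \<partial>\<mu>)) + 4 * (real n * (\<integral>x. cos_avg (x / (8 * a n)) \<partial>\<mu>)))
     \<longlonglongrightarrow> 0" by simp
qed

text \<open>At t = 1/8 the limit of \<open>h\<close> is 1/128, so \<open>h\<close> eventually
  exceeds 1/256; the factor 2 in \<open>one_minus_cos_le_clip\<close> halves this once more.\<close>

lemma clip_moment2_ge: "\<forall>\<^sub>F n in sequentially. 1/512 \<le> real n * (\<integral>x. (clip (x / (8 * a n)))\<^sup>2 \<partial>\<mu>)"
proof -
  have "(\<lambda>n. h n (1/8)) \<longlonglongrightarrow> (1/8)\<^sup>2 / 2" by (rule h_tendsto) auto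
  then have "\<forall>\<^sub>F n in sequentially. h n (1/8) > 1/256"
    by (rule order_tendstoD) (auto simp: power2_eq_square)
  then show ?thesis
  proof eventually_elim
    case (elim n)
    have "(\<integral>x. 1 - cos ((1/8) * x / a n) \<partial>\<mu>) \<le> (\<integral>x. 2 * (clip (x / (8 * a n)))\<^sup>2 \<partial>\<mu>)"
    proof (intro integral_mono integrable_cos integrable_mult_right integrable_clip)
      show "1 - cos (1/8 * x / a n) \<le> 2 * (clip (x / (8 * a n)))\<^sup>2" for x
        using one_minus_cos_le_clip[of "x / (8 * a n)"] by (simp add: field_simps)
    qed
    then have "h n (1/8) \<le> real n * (2 * (\<integral>x. (clip (x / (8 * a n)))\<^sup>2 \<partial>\<mu>))"
      unfolding h_def by (intro mult_left_mono) auto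
    then show ?case using elim by simp
  qed
qed

end

section \<open>Rows of a triangular array\<close>

text \<open>Up to sign, b - a is the difference of the inverse roots multiplied by the product of
  both roots and their sum, and this multiplier is at least (3/4) (7/4) > 1. The threshold 3/4 is
  what an error of 1/4 leaves of a value l / n >= 1.\<close>

lemma inverse_sqrt_diff:
  fixes a b :: real
  assumes a: "3/4 \<le> a" and b: "1 \<le> b"
  shows "\<bar>1 / sqrt a - 1 / sqrt b\<bar> \<le> \<bar>a - b\<bar>"
proof -
  have sa: "3/4 \<le> sqrt a"
    using a by (intro real_le_rsqrt) (simp add: power2_eq_square)
  have sb: "1 \<le> sqrt b" using b by simp
  have "(3/4) * 1 * (3/4 + 1) \<le> sqrt a * sqrt b * (sqrt a + sqrt b)"
    using sa sb a b by (intro mult_mono add_mono mult_nonneg_nonneg) auto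
  then have den: "1 \<le> sqrt a * sqrt b * (sqrt a + sqrt b)" by simp
  have "(1 / sqrt a - 1 / sqrt b) * (sqrt a * sqrt b * (sqrt a + sqrt b)) = (sqrt b)\<^sup>2 - (sqrt a)\<^sup>2"
    using sa sb a b by (simp add: field_simps power2_eq_square)
  also have "\<dots> = b - a" using a b by simp
  finally have e: "(1 / sqrt a - 1 / sqrt b) * (sqrt a * sqrt b * (sqrt a + sqrt b)) = b - a" .
  have "\<bar>1 / sqrt a - 1 / sqrt b\<bar> * 1 \<le> \<bar>1 / sqrt a - 1 / sqrt b\<bar> * (sqrt a * sqrt b * (sqrt a + sqrt b))"
    using den by (intro mult_left_mono) auto
  also have "\<dots> = \<bar>b - a\<bar>"
    unfolding e[symmetric] abs_mult[of "1 / sqrt a - 1 / sqrt b"] using den by simp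
  finally show ?thesis by simp
qed

text \<open>One row of the array, for fixed n. Variance 1/n makes the index l correspond to the time
  l / n. \<open>rho\<close> measures the distance from normality, while \<open>C\<close> only
  secures the existence of moments and enters no estimate.\<close>

locale row_array = prob_space M for M :: "'a measure" +
  fixes xi :: "nat \<Rightarrow> 'a \<Rightarrow> real" and n :: nat and rho C :: real
  assumes n_pos: "0 < n"
    and indep: "indep_vars (\<lambda>_. borel) xi {1..}"
    and bound: "\<And>j \<omega>. \<bar>xi j \<omega>\<bar> \<le> C"
    and mean: "\<And>j. 1 \<le> j \<Longrightarrow> expectation (xi j) = 0"
    and third: "\<And>j. 1 \<le> j \<Longrightarrow> expectation (\<lambda>\<omega>. xi j \<omega> ^ 3) = 0"
    and var: "\<And>j. 1 \<le> j \<Longrightarrow> expectation (\<lambda>\<omega>. (xi j \<omega>)\<^sup>2) = 1 / real n"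
    and fourth: "\<And>j. 1 \<le> j \<Longrightarrow> expectation (\<lambda>\<omega>. xi j \<omega> ^ 4) \<le> rho / real n"
begin

definition T :: "nat \<Rightarrow> 'a \<Rightarrow> real" where
  "T l \<omega> = (\<Sum>j\<in>{1..l}. xi j \<omega>)"

definition U :: "nat \<Rightarrow> 'a \<Rightarrow> real" where
  "U l \<omega> = (\<Sum>j\<in>{1..l}. (xi j \<omega>)\<^sup>2)"

lemma xi_measurable [measurable]: "1 \<le> j \<Longrightarrow> xi j \<in> borel_measurable M"
  using indep unfolding indep_vars_def by auto

lemma T_measurable [measurable]: "T l \<in> borel_measurable M"
  unfolding T_def by (intro borel_measurable_sum) auto

lemma U_measurable [measurable]: "U l \<in> borel_measurable M"
  unfolding U_def by (intro borel_measurable_sum borel_measurable_power) auto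

lemma T_diff: "p \<le> k \<Longrightarrow> (\<Sum>j\<in>{p<..k}. xi j \<omega>) = T k \<omega> - T p \<omega>"
proof -
  assume "p \<le> k"
  then have "{1..k} = {1..p} \<union> {p<..k}" by auto
  then have "T k \<omega> = T p \<omega> + (\<Sum>j\<in>{p<..k}. xi j \<omega>)"
    unfolding T_def by (simp add: sum.union_disjoint ivl_disj_int)
  then show ?thesis by simp
qed

lemma rho_nonneg: "0 \<le> rho"
proof -
  have "0 \<le> expectation (\<lambda>\<omega>. xi 1 \<omega> ^ 4)"
    by (intro Bochner_Integration.integral_nonneg) auto
  also have "\<dots> \<le> rho / real n" using fourth[of 1] by simp
  finally show ?thesis using n_pos by (simp add: zero_le_divide_iff)
qed

lemma block_oscillation_sets:
  "{\<omega>\<in>space M. \<not> (\<forall>k\<in>{p..q}. \<bar>T k \<omega> - T p \<omega>\<bar> \<le> 2 * x)} \<in> events"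
  "{\<omega>\<in>space M. \<not> (\<forall>k\<in>{p..q}. \<bar>T k \<omega> - T p \<omega>\<bar> \<le> 2 * x)} =
   {\<omega>\<in>space M. \<exists>k\<in>{p..q}. 2 * x < \<bar>\<Sum>j\<in>{p<..k}. xi j \<omega>\<bar>}"
proof -
  show "{\<omega>\<in>space M. \<not> (\<forall>k\<in>{p..q}. \<bar>T k \<omega> - T p \<omega>\<bar> \<le> 2 * x)} \<in> events" by measurable
  show "{\<omega>\<in>space M. \<not> (\<forall>k\<in>{p..q}. \<bar>T k \<omega> - T p \<omega>\<bar> \<le> 2 * x)} =
   {\<omega>\<in>space M. \<exists>k\<in>{p..q}. 2 * x < \<bar>\<Sum>j\<in>{p<..k}. xi j \<omega>\<bar>}"
    by (auto simp: T_diff not_le)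
qed

lemma block_2:
  assumes "real (q - p) / real n \<le> d" "0 < x"
  shows "holds_up_to M (2 * d / x\<^sup>2) (\<lambda>\<omega>. \<forall>k\<in>{p..q}. \<bar>T k \<omega> - T p \<omega>\<bar> \<le> 2 * x)"
proof (rule holds_up_to_complement)
  show "prob {\<omega>\<in>space M. \<not> (\<forall>k\<in>{p..q}. \<bar>T k \<omega> - T p \<omega>\<bar> \<le> 2 * x)} \<le> 2 * d / x\<^sup>2"
    unfolding block_oscillation_sets
    by (rule maximal_inequality_2(1)[OF indep_vars_subset[OF indep] bound assms(2), where v="1 / real n"])
       (use mean var assms(1) in auto)
qed (rule block_oscillation_sets)

lemma block_4:
  assumes "real (q - p) / real n \<le> d" "0 < x" "d / x\<^sup>2 \<le> 1/2"
  shows "holds_up_to M (2 * (3 * d\<^sup>2 + rho * d) / x ^ 4) (\<lambda>\<omega>. \<forall>k\<in>{p..q}. \<bar>T k \<omega> - T p \<omega>\<bar> \<le> 2 * x)"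
proof (rule holds_up_to_complement)
  have "real (q - p) / real n * rho \<le> d * rho" using assms(1) rho_nonneg by (intro mult_right_mono)
  then show "prob {\<omega>\<in>space M. \<not> (\<forall>k\<in>{p..q}. \<bar>T k \<omega> - T p \<omega>\<bar> \<le> 2 * x)} \<le> 2 * (3 * d\<^sup>2 + rho * d) / x ^ 4"
    unfolding block_oscillation_sets
    by (intro maximal_inequality_4[OF indep_vars_subset[OF indep] bound assms(2),
         where v="1 / real n" and u="rho / real n"])
       (use mean var third fourth assms in \<open>auto simp: mult.commute\<close>)
qed (rule block_oscillation_sets)

text \<open>The block from 0 to 3n has total variance 3.\<close>

lemma max_T:
  assumes "0 < K"
  shows "holds_up_to M (6 / K\<^sup>2) (\<lambda>\<omega>. \<forall>k\<in>{0..3*n}. \<bar>T k \<omega>\<bar> \<le> 2 * K)"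
  using block_2[of "3*n" 0 3 K] assms n_pos by (simp add: T_def)

text \<open>A uniform law of large numbers for the squares: each centred square has variance at most
  the fourth moment, hence at most \<open>rho\<close> / n, which adds up to 3 \<open>rho\<close>
  over 3n indices.\<close>

lemma max_U:
  assumes x: "0 < x"
  shows "holds_up_to M (6 * rho / x\<^sup>2) (\<lambda>\<omega>. \<forall>k\<in>{0..3*n}. \<bar>U k \<omega> - real k / real n\<bar> \<le> 2 * x)"
proof -
  define D where "D j \<omega> = (xi j \<omega>)\<^sup>2 - 1 / real n" for j \<omega>
  have sq: "\<bar>(xi j \<omega>)\<^sup>2\<bar> \<le> C\<^sup>2" for j \<omega>
    using power_mono[OF bound[of j \<omega>], of 2] by simp
  have i2: "integrable M (\<lambda>\<omega>. (xi j \<omega>)\<^sup>2)" "integrable M (\<lambda>\<omega>. xi j \<omega> ^ 4)" if "1 \<le> j" for j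
    using that by (auto intro!: integrable_bounded_power bound)
  have "prob {\<omega>\<in>space M. \<exists>k\<in>{0..3*n}. 2 * x < \<bar>\<Sum>j\<in>{0<..k}. D j \<omega>\<bar>} \<le> 2 * (3 * rho) / x\<^sup>2"
  proof (rule maximal_inequality_2(1)[where v="rho / real n"])
    show "indep_vars (\<lambda>_. borel) D {0<..3*n}"
      unfolding D_def
      by (rule indep_vars_compose2[OF indep_vars_subset[OF indep], where Y="\<lambda>_ y. y\<^sup>2 - 1 / real n"]) auto
    show "\<bar>D j \<omega>\<bar> \<le> C\<^sup>2 + 1" for j \<omega>
    proof -
      have "1 / real n \<le> 1" "0 \<le> 1 / real n" using n_pos by auto
      then show ?thesis using sq[of j \<omega>] zero_le_power2[of "xi j \<omega>"] zero_le_power2[of C] unfolding D_def abs_le_iff by linarith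
    qed
    show "expectation (D j) = 0" if "j \<in> {0<..3*n}" for j
      unfolding D_def using that var[of j] i2[of j] by (simp add: prob_space)
    show "expectation (\<lambda>\<omega>. (D j \<omega>)\<^sup>2) \<le> rho / real n" if j: "j \<in> {0<..3*n}" for j
    proof -
      have "expectation (\<lambda>\<omega>. (D j \<omega>)\<^sup>2) =
        expectation (\<lambda>\<omega>. xi j \<omega> ^ 4 - (2 / real n) * (xi j \<omega>)\<^sup>2 + (1 / real n)\<^sup>2)"
        unfolding D_def
        by (intro Bochner_Integration.integral_cong) (auto simp: power2_eq_square power4_eq_xxxx algebra_simps)
      also have "\<dots> = expectation (\<lambda>\<omega>. xi j \<omega> ^ 4) - (2 / real n) * (1 / real n) + (1 / real n)\<^sup>2"
        using j var[of j] i2[of j] by (simp add: prob_space)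
      also have "\<dots> \<le> expectation (\<lambda>\<omega>. xi j \<omega> ^ 4)" by (simp add: power2_eq_square)
      also have "\<dots> \<le> rho / real n" using fourth[of j] j by simp
      finally show ?thesis .
    qed
    show "real (3 * n - 0) * (rho / real n) \<le> 3 * rho" using n_pos by simp
  qed fact
  moreover have "(\<Sum>j\<in>{0<..k}. D j \<omega>) = U k \<omega> - real k / real n" for k \<omega>
  proof -
    have "{0<..k} = {1..k}" by auto
    then show ?thesis unfolding D_def U_def by (simp add: sum_subtractf)
  qed
  ultimately show ?thesis by (intro holds_up_to_complement) (auto simp: not_le)
qed

lemma self_normalized_close:
  assumes "\<bar>U l \<omega> - real l / real n\<bar> \<le> 2 * x" "x \<le> 1/8" "\<bar>T l \<omega>\<bar> \<le> 2 * K" "n \<le> l"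
  shows "\<bar>T l \<omega> / sqrt (U l \<omega>) - T l \<omega> / sqrt (real l / real n)\<bar> \<le> 4 * K * x"
proof -
  define a where "a = U l \<omega>"
  define b where "b = real l / real n"
  have b: "1 \<le> b" unfolding b_def using assms(4) n_pos by simp
  have ab: "\<bar>a - b\<bar> \<le> 2 * x" using assms(1) a_def b_def by simp
  then have "3/4 \<le> a" using assms(2) b by linarith
  from inverse_sqrt_diff[OF this b] ab have d: "\<bar>1 / sqrt a - 1 / sqrt b\<bar> \<le> 2 * x" by simp
  have "\<bar>T l \<omega> / sqrt a - T l \<omega> / sqrt b\<bar> = \<bar>T l \<omega>\<bar> * \<bar>1 / sqrt a - 1 / sqrt b\<bar>"
    unfolding abs_mult[symmetric] by (simp add: right_diff_distrib)
  also have "\<dots> \<le> (2 * K) * (2 * x)" using assms(3) d by (intro mult_mono) auto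
  finally show ?thesis unfolding a_def b_def by simp
qed

text \<open>Interchanging sums turns the combination of row sums into a weighted sum of the
  independent \<open>xi j\<close>, where \<open>b j\<close> collects the times \<open>l i\<close>
  not before j. In the sum of squared weights two times share min (\<open>l i\<close>)
  (\<open>l i'\<close>) indices, which is the Brownian covariance. As \<open>l i\<close> >= n, all
  \<open>s i\<close> are at most 1 and the weights are bounded uniformly in n.\<close>

lemma expectation_cos_fdd:
  fixes l :: "nat \<Rightarrow> nat"
  assumes l: "\<And>i. i < k \<Longrightarrow> n \<le> l i" "\<And>i. i < k \<Longrightarrow> l i \<le> 3 * n"
  shows "\<bar>expectation (\<lambda>\<omega>. cos (a + (\<Sum>i<k. c i * (T (l i) \<omega> / sqrt (real (l i) / real n)))))
     - cos a * exp (- (\<Sum>i<k. \<Sum>i'<k. c i * c i' *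
         (real (min (l i) (l i')) / real n / (sqrt (real (l i) / real n) * sqrt (real (l i') / real n)))) / 2)\<bar>
     \<le> (\<Sum>i<k. \<bar>c i\<bar>) ^ 4 * (rho + 1 / real n)"
proof -
  define s where "s i = 1 / sqrt (real (l i) / real n)" for i
  define b where "b j = (\<Sum>i<k. c i * s i * of_bool (j \<le> l i))" for j
  have s: "0 \<le> s i" "s i \<le> 1" if "i < k" for i
    unfolding s_def using l(1)[OF that] n_pos by auto
  have b4: "b j ^ 4 \<le> (\<Sum>i<k. \<bar>c i\<bar>) ^ 4" for j
  proof -
    have "\<bar>b j\<bar> \<le> (\<Sum>i<k. \<bar>c i\<bar>)"
      unfolding b_def
    proof (intro order.trans[OF sum_abs] sum_mono)
      fix i assume "i \<in> {..<k}"
      then show "\<bar>c i * s i * of_bool (j \<le> l i)\<bar> \<le> \<bar>c i\<bar>"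
        using s[of i] by (auto simp: abs_mult mult_left_le)
    qed
    then have "\<bar>b j\<bar> ^ 4 \<le> (\<Sum>i<k. \<bar>c i\<bar>) ^ 4" by (intro power_mono) auto
    then show ?thesis by (simp add: power_even_abs)
  qed
  have R: "(\<Sum>i<k. c i * (T (l i) \<omega> / sqrt (real (l i) / real n))) = (\<Sum>j\<in>{1..3*n}. b j * xi j \<omega>)" for \<omega>
  proof -
    have "(\<Sum>j\<in>{1..3*n}. b j * xi j \<omega>) = (\<Sum>i<k. \<Sum>j\<in>{1..3*n}. c i * s i * of_bool (j \<le> l i) * xi j \<omega>)"
      unfolding b_def sum_distrib_right by (rule sum.swap)
    also have "\<dots> = (\<Sum>i<k. c i * s i * T (l i) \<omega>)"
    proof (rule sum.cong[OF refl])
      fix i assume i: "i \<in> {..<k}"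
      have "(\<Sum>j\<in>{1..3*n}. c i * s i * of_bool (j \<le> l i) * xi j \<omega>) = (\<Sum>j\<in>{1..l i}. c i * s i * xi j \<omega>)"
        using l(2)[of i] i by (intro sum.mono_neutral_cong_right) auto
      then show "(\<Sum>j\<in>{1..3*n}. c i * s i * of_bool (j \<le> l i) * xi j \<omega>) = c i * s i * T (l i) \<omega>"
        by (simp add: T_def sum_distrib_left)
    qed
    finally show ?thesis by (simp add: s_def)
  qed
  have B: "(\<Sum>j\<in>{1..3*n}. (b j)\<^sup>2) * (1 / real n) = (\<Sum>i<k. \<Sum>i'<k. c i * c i' *
         (real (min (l i) (l i')) / real n / (sqrt (real (l i) / real n) * sqrt (real (l i') / real n))))"
  proof -
    have "(\<Sum>j\<in>{1..3*n}. (b j)\<^sup>2) = (\<Sum>j\<in>{1..3*n}. \<Sum>i<k. \<Sum>i'<k.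
        c i * c i' * s i * s i' * of_bool (j \<le> min (l i) (l i')))"
      unfolding b_def power2_eq_square sum_product
      by (intro sum.cong refl) auto
    also have "\<dots> = (\<Sum>i<k. \<Sum>i'<k. \<Sum>j\<in>{1..3*n}. c i * c i' * s i * s i' * of_bool (j \<le> min (l i) (l i')))"
      by (subst sum.swap) (intro sum.cong refl sum.swap)
    also have "\<dots> = (\<Sum>i<k. \<Sum>i'<k. c i * c i' * s i * s i' * real (min (l i) (l i')))"
    proof (intro sum.cong refl)
      fix i i' assume i: "i \<in> {..<k}" "i' \<in> {..<k}"
      have "(\<Sum>j\<in>{1..3*n}. c i * c i' * s i * s i' * of_bool (j \<le> min (l i) (l i'))) =
         (\<Sum>j\<in>{1..min (l i) (l i')}. c i * c i' * s i * s i')"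
        using l(2)[of i] i by (intro sum.mono_neutral_cong_right) auto
      then show "(\<Sum>j\<in>{1..3*n}. c i * c i' * s i * s i' * of_bool (j \<le> min (l i) (l i'))) =
         c i * c i' * s i * s i' * real (min (l i) (l i'))" by simp
    qed
    finally show ?thesis by (simp add: sum_distrib_right sum_divide_distrib s_def mult_ac)
  qed
  have "\<bar>expectation (\<lambda>\<omega>. cos (a + (\<Sum>j\<in>{1..3*n}. b j * xi j \<omega>))) - cos a * exp (- ((\<Sum>j\<in>{1..3*n}. (b j)\<^sup>2) * (1 / real n)) / 2)\<bar>
     \<le> (\<Sum>j\<in>{1..3*n}. b j ^ 4) * (rho / real n + (1 / real n)\<^sup>2) / 8"
    by (rule expectation_cos_weighted_sum[OF _ indep_vars_subset[OF indep] bound])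
       (use mean third var fourth in auto)
  also have "\<dots> \<le> (\<Sum>j\<in>{1..3*n}. (\<Sum>i<k. \<bar>c i\<bar>) ^ 4) * (rho / real n + (1 / real n)\<^sup>2) / 8"
    using rho_nonneg by (intro divide_right_mono mult_right_mono sum_mono b4) auto
  also have "\<dots> = (\<Sum>i<k. \<bar>c i\<bar>) ^ 4 * (rho + 1 / real n) * (3 / 8)"
    using n_pos by (simp add: field_simps power2_eq_square)
  also have "\<dots> \<le> (\<Sum>i<k. \<bar>c i\<bar>) ^ 4 * (rho + 1 / real n) * 1"
    using rho_nonneg by (intro mult_left_mono mult_nonneg_nonneg) auto
  finally show ?thesis unfolding R B by simp
qed

end

section \<open>Reduction to a triangular array\<close>

text \<open>min 2 (y^2 / 32) dominates 1 - cos (t y) for all |t| <= 1/4 at once. Being bounded and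
  continuous, it is admissible in weak convergence, so a single limit controls all these t.\<close>

lemma (in prob_space) expectation_min_equicontinuity:
  fixes Y :: "'a \<Rightarrow> real"
  assumes [measurable]: "Y \<in> borel_measurable M" and t: "\<bar>t\<bar> \<le> 1/4"
    and E: "expectation (\<lambda>\<omega>. min 2 ((Y \<omega>)\<^sup>2 / 32)) \<le> 1/2"
  shows "expectation (\<lambda>\<omega>. cos (t * Y \<omega>)) \<ge> 1/2"
proof -
  have i1: "integrable M (\<lambda>\<omega>. min 2 ((Y \<omega>)\<^sup>2 / 32))"
    by (rule integrable_const_bound[where B=2]) auto
  have i2: "integrable M (\<lambda>\<omega>. cos (t * Y \<omega>))"
    by (rule integrable_const_bound[where B=1]) auto
  have "expectation (\<lambda>\<omega>. 1 - min 2 ((Y \<omega>)\<^sup>2 / 32)) \<le> expectation (\<lambda>\<omega>. cos (t * Y \<omega>))"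
  proof (rule integral_mono)
    fix \<omega>
    have "t\<^sup>2 \<le> (1/4)\<^sup>2" using power_mono[OF t, of 2] by simp
    then have "t\<^sup>2 * (Y \<omega>)\<^sup>2 \<le> (1/4)\<^sup>2 * (Y \<omega>)\<^sup>2" by (intro mult_right_mono) auto
    then have "1 - cos (t * Y \<omega>) \<le> (Y \<omega>)\<^sup>2 / 32"
      using one_minus_cos_le[of "t * Y \<omega>"] by (simp add: power_mult_distrib power_divide)
    moreover have "1 - cos (t * Y \<omega>) \<le> 2" using cos_ge_minus_one[of "t * Y \<omega>"] by linarith
    ultimately show "1 - min 2 ((Y \<omega>)\<^sup>2 / 32) \<le> cos (t * Y \<omega>)" by (simp add: min_def)
  qed (use i1 i2 in auto)
  moreover have "expectation (\<lambda>\<omega>. 1 - min 2 ((Y \<omega>)\<^sup>2 / 32)) = 1 - expectation (\<lambda>\<omega>. min 2 ((Y \<omega>)\<^sup>2 / 32))"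
    using i1 by (simp add: prob_space)
  ultimately show ?thesis using E by linarith
qed

lemma expectation_min_std_normal:
  "(\<integral>x. min 2 (x\<^sup>2 / 32) \<partial>std_normal_distribution) \<le> 1 / 32"
proof -
  interpret N: real_distribution std_normal_distribution by (rule real_dist_normal_dist)
  have 1: "integrable std_normal_distribution (\<lambda>x::real. x\<^sup>2)"
    by (rule integrable_std_normal_distribution_moment)
  have 2: "(\<integral>x. x\<^sup>2 \<partial>std_normal_distribution) = 1"
    using std_normal_distribution_even_moments[of 1] by (simp add: fact_numeral)
  have "(\<integral>x. min 2 (x\<^sup>2 / 32) \<partial>std_normal_distribution) \<le> (\<integral>x. x\<^sup>2 / 32 \<partial>std_normal_distribution)"
  proof (rule integral_mono)
    show "integrable std_normal_distribution (\<lambda>x::real. min 2 (x\<^sup>2 / 32))"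
      by (rule N.integrable_const_bound[where B=2]) auto
  qed (use 1 in auto)
  then show ?thesis using 2 by simp
qed

section \<open>The symmetric common law and the reduction to a row array\<close>

context
  fixes M :: "'a measure" and X :: "nat \<Rightarrow> 'a \<Rightarrow> real"
  assumes M: "prob_space M"
    and mX [measurable]: "\<And>i. i \<ge> 1 \<Longrightarrow> X i \<in> borel_measurable M"
    and indepX: "prob_space.indep_vars M (\<lambda>_. borel) X {1..}"
    and ident: "\<And>i. i \<ge> 1 \<Longrightarrow> distr M borel (X i) = distr M borel (X 1)"
    and sym: "distr M borel (\<lambda>\<omega>. - X 1 \<omega>) = distr M borel (X 1)"
begin

interpretation prob_space M by (rule M)

abbreviation (input) "law \<equiv> distr M borel (X 1)"

lemma law: "real_distribution law"
  by (rule real_distribution_distr) (rule mX, simp)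

lemma expectation_X:
  fixes f :: "real \<Rightarrow> 'c::{banach, second_countable_topology}"
  assumes [measurable]: "f \<in> borel_measurable borel" and i: "1 \<le> i"
  shows "expectation (\<lambda>\<omega>. f (X i \<omega>)) = (\<integral>x. f x \<partial>law)"
  unfolding ident[OF i, symmetric] using i by (subst integral_distr) auto

lemma law_odd:
  fixes f :: "real \<Rightarrow> real"
  assumes [measurable]: "f \<in> borel_measurable borel" and odd: "\<And>x. f (- x) = - f x"
  shows "(\<integral>x. f x \<partial>law) = 0"
proof -
  have "(\<integral>x. f x \<partial>law) = (\<integral>x. f x \<partial>distr M borel (\<lambda>\<omega>. - X 1 \<omega>))" by (simp only: sym)
  also have "\<dots> = expectation (\<lambda>\<omega>. - f (X 1 \<omega>))" by (subst integral_distr) (auto simp: odd)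
  also have "\<dots> = - (\<integral>x. f x \<partial>law)" by (simp add: expectation_X)
  finally show ?thesis by simp
qed

lemma char_law: "char law t = complex_of_real (\<integral>x. cos (t * x) \<partial>law)"
proof -
  interpret L: real_distribution law by (rule law)
  have i: "integrable law (\<lambda>x. cos (t * x))" "integrable law (\<lambda>x. sin (t * x))"
    by (rule L.integrable_const_bound[where B=1]; simp)+
  have "char law t = (\<integral>x. complex_of_real (cos (t * x)) + \<i> * complex_of_real (sin (t * x)) \<partial>law)"
    unfolding char_def by (intro Bochner_Integration.integral_cong) (auto simp: complex_eq_iff Re_exp Im_exp)
  also have "\<dots> = complex_of_real (\<integral>x. cos (t * x) \<partial>law) + \<i> * complex_of_real (\<integral>x. sin (t * x) \<partial>law)"
    using i by (subst Bochner_Integration.integral_add) (auto intro!: integrable_of_real simp del: One_nat_def)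
  also have "(\<integral>x. sin (t * x) \<partial>law) = 0" by (rule law_odd) auto
  finally show ?thesis by simp
qed

lemma char_S_sum: "char (distr M borel (\<lambda>\<omega>. S_sum X n \<omega> / b)) t = complex_of_real ((\<integral>x. cos (t * x / b) \<partial>law) ^ n)"
proof -
  have "char (distr M borel (\<lambda>\<omega>. \<Sum>i\<in>{1..n}. X i \<omega> / b)) t = (\<Prod>i\<in>{1..n}. char (distr M borel (\<lambda>\<omega>. X i \<omega> / b)) t)"
    by (rule char_distr_sum)
       (rule indep_vars_compose2[OF indep_vars_subset[OF indepX], where Y="\<lambda>_ x. x / b"], auto)
  also have "\<dots> = (\<Prod>i\<in>{1..n}. char law (t / b))"
  proof (rule prod.cong[OF refl])
    fix i assume i: "i \<in> {1..n}"
    have "char (distr M borel (\<lambda>\<omega>. X i \<omega> / b)) t = expectation (\<lambda>\<omega>. iexp (t * (X i \<omega> / b)))"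
      unfolding char_def using i by (subst integral_distr) auto
    also have "\<dots> = (\<integral>x. iexp (t * (x / b)) \<partial>law)" using i by (intro expectation_X) auto
    finally show "char (distr M borel (\<lambda>\<omega>. X i \<omega> / b)) t = char law (t / b)" by (simp add: char_def)
  qed
  finally have "char (distr M borel (\<lambda>\<omega>. S_sum X n \<omega> / b)) t = char law (t / b) ^ n"
    by (simp add: S_sum_def sum_divide_distrib)
  then show ?thesis unfolding char_law by (simp only: times_divide_eq_left of_real_power)
qed

text \<open>\<open>xi n j\<close> is X j / (8 \<open>a n\<close>) clipped at level 1 and divided by
  \<open>s n\<close>, which makes its variance exactly 1/n. The factor \<open>b n\<close> = 8
  \<open>a n\<close> \<open>s n\<close> undoes both scalings wherever nothing has been
  clipped.\<close>

lemma array_reduction: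
  assumes DA: "in_DA_normal M X"
  obtains xi :: "nat \<Rightarrow> nat \<Rightarrow> 'a \<Rightarrow> real" and b rho C :: "nat \<Rightarrow> real"
  where "rho \<longlonglongrightarrow> 0"
    and "\<forall>\<^sub>F n in sequentially. row_array M (xi n) n (rho n) (C n) \<and> b n > 0 \<and>
      holds_up_to M (3 * rho n) (\<lambda>\<omega>. \<forall>j\<in>{1..3*n}. X j \<omega> = b n * xi n j \<omega>)"
proof -
  obtain a :: "nat \<Rightarrow> real" where a: "\<And>n. a n > 0"
    and wc: "weak_conv_m (\<lambda>n. distr M borel (\<lambda>\<omega>. S_sum X n \<omega> / a n)) std_normal_distribution"
    using DA unfolding in_DA_normal_def by blast
  have [measurable]: "S_sum X n \<in> borel_measurable M" for n
    unfolding S_sum_def[abs_def] by (intro borel_measurable_sum) auto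
  have rd: "real_distribution (distr M borel (\<lambda>\<omega>. S_sum X n \<omega> / a n))" for n
    by (rule real_distribution_distr) auto
  have conv: "(\<lambda>n. (\<integral>x. cos (t * x / a n) \<partial>law) ^ n) \<longlonglongrightarrow> exp (- t\<^sup>2 / 2)" for t
    using levy_continuity1[OF rd real_dist_normal_dist wc, of t]
    unfolding char_S_sum char_std_normal_distribution tendsto_of_real_iff by simp
  have "(\<lambda>n. \<integral>x. min 2 (x\<^sup>2 / 32) \<partial>distr M borel (\<lambda>\<omega>. S_sum X n \<omega> / a n)) \<longlonglongrightarrow>
      (\<integral>x. min 2 (x\<^sup>2 / 32) \<partial>std_normal_distribution)"
    by (rule weak_conv_imp_integral_bdd_continuous_conv[OF rd real_dist_normal_dist wc, where B=2])
       (auto intro!: continuous_intros)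
  then have "\<forall>\<^sub>F n in sequentially. (\<integral>x. min 2 (x\<^sup>2 / 32) \<partial>distr M borel (\<lambda>\<omega>. S_sum X n \<omega> / a n)) < 1/2"
    by (rule order_tendstoD) (use expectation_min_std_normal in linarith)
  \<comment> \<open>The condition on n below concerns one test function and does not involve t, so a
    single range of n serves all |t| <= 1/4.\<close>
  then have equi: "\<forall>\<^sub>F n in sequentially. \<forall>t. \<bar>t\<bar> \<le> 1/4 \<longrightarrow> (\<integral>x. cos (t * x / a n) \<partial>law) ^ n \<ge> 1/2"
  proof eventually_elim
    case (elim n)
    show ?case
    proof (intro allI impI)
      fix t :: real assume t: "\<bar>t\<bar> \<le> 1/4"
      have "(\<integral>x. min 2 (x\<^sup>2 / 32) \<partial>distr M borel (\<lambda>\<omega>. S_sum X n \<omega> / a n)) =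
          expectation (\<lambda>\<omega>. min 2 ((S_sum X n \<omega> / a n)\<^sup>2 / 32))"
        by (subst integral_distr) auto
      then have "1/2 \<le> expectation (\<lambda>\<omega>. cos (t * (S_sum X n \<omega> / a n)))"
        using elim t by (intro expectation_min_equicontinuity) auto
      also have "\<dots> = Re (char (distr M borel (\<lambda>\<omega>. S_sum X n \<omega> / a n)) t)"
      proof -
        have "integrable M (\<lambda>\<omega>. iexp (t * (S_sum X n \<omega> / a n)))"
          by (rule integrable_const_bound[where B=1]) auto
        moreover have "char (distr M borel (\<lambda>\<omega>. S_sum X n \<omega> / a n)) t = expectation (\<lambda>\<omega>. iexp (t * (S_sum X n \<omega> / a n)))"
          unfolding char_def by (subst integral_distr) auto
        ultimately have "Re (char (distr M borel (\<lambda>\<omega>. S_sum X n \<omega> / a n)) t) =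
            expectation (\<lambda>\<omega>. Re (iexp (t * (S_sum X n \<omega> / a n))))"
          by (simp only: integral_Re)
        then show ?thesis by (simp add: Re_exp)
      qed
      finally show "1/2 \<le> (\<integral>x. cos (t * x / a n) \<partial>law) ^ n"
        unfolding char_S_sum by simp
    qed
  qed
  define m2 where "m2 n = real n * (\<integral>x. (clip (x / (8 * a n)))\<^sup>2 \<partial>law)" for n
  define m4 where "m4 n = real n * (\<integral>x. clip (x / (8 * a n)) ^ 4 \<partial>law)" for n
  define s where "s n = sqrt (m2 n)" for n
  define xi where "xi n j \<omega> = clip (X j \<omega> / (8 * a n)) / s n" for n j \<omega>
  \<comment> \<open>Dividing the fourth moment by \<open>s n ^ 4 = (m2 n)\<^sup>2\<close>, which is
    at least 1/512^2, costs the factor 512^2.\<close>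
  define rho where "rho n = 512\<^sup>2 * m4 n" for n
  have "m4 \<longlonglongrightarrow> 0"
    unfolding m4_def[abs_def] by (rule clip_moment4_tendsto[OF law a conv equi])
  then have rho0: "rho \<longlonglongrightarrow> 0" unfolding rho_def[abs_def] by (intro tendsto_mult_right_zero)
  have m2ge: "\<forall>\<^sub>F n in sequentially. 1/512 \<le> m2 n"
    unfolding m2_def by (rule clip_moment2_ge[OF law a conv equi])
  have m4_nonneg: "0 \<le> m4 n" for n
    unfolding m4_def by (intro mult_nonneg_nonneg Bochner_Integration.integral_nonneg) auto
  have "\<forall>\<^sub>F n in sequentially. row_array M (xi n) n (rho n) (1 / s n) \<and> 8 * a n * s n > 0 \<and>
      holds_up_to M (3 * rho n) (\<lambda>\<omega>. \<forall>j\<in>{1..3*n}. X j \<omega> = 8 * a n * s n * xi n j \<omega>)"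
    using m2ge eventually_gt_at_top[of 0]
  proof eventually_elim
    case (elim n)
    have s: "s n > 0" "(s n)\<^sup>2 = m2 n" using elim unfolding s_def by auto
    have s4: "s n ^ 4 = (m2 n)\<^sup>2" unfolding s(2)[symmetric] by (simp flip: power_mult)
    have odd: "expectation (\<lambda>\<omega>. xi n j \<omega> ^ k) = 0" if "odd k" "1 \<le> j" for j k
    proof -
      have "expectation (\<lambda>\<omega>. xi n j \<omega> ^ k) = (\<integral>x. (clip (x / (8 * a n)) / s n) ^ k \<partial>law)"
        unfolding xi_def using that by (intro expectation_X) auto
      also have "\<dots> = 0" using that by (intro law_odd) (auto simp: clip_minus power_minus_odd)
      finally show ?thesis .
    qed
    have "row_array M (xi n) n (rho n) (1 / s n)"
    proof
      show "0 < n" by (rule elim)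
      show "indep_vars (\<lambda>_. borel) (xi n) {1..}"
        unfolding xi_def
        by (rule indep_vars_compose2[OF indepX, where Y="\<lambda>_ x. clip (x / (8 * a n)) / s n"]) auto
      show "\<bar>xi n j \<omega>\<bar> \<le> 1 / s n" for j \<omega>
        unfolding xi_def using abs_clip_le s by (simp add: abs_divide divide_right_mono)
      fix j :: nat assume j: "1 \<le> j"
      show "expectation (xi n j) = 0" using odd[of 1 j] j by simp
      show "expectation (\<lambda>\<omega>. xi n j \<omega> ^ 3) = 0" using odd[of 3 j] j by simp
      have "expectation (\<lambda>\<omega>. (xi n j \<omega>)\<^sup>2) = (\<integral>x. (clip (x / (8 * a n)) / s n)\<^sup>2 \<partial>law)"
        unfolding xi_def using j by (intro expectation_X) auto
      also have "\<dots> = (\<integral>x. (clip (x / (8 * a n)))\<^sup>2 \<partial>law) / m2 n"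
        unfolding power_divide s by simp
      also have "\<dots> = 1 / real n"
      proof -
        have "(\<integral>x. (clip (x / (8 * a n)))\<^sup>2 \<partial>law) \<noteq> 0" using elim unfolding m2_def by auto
        then show ?thesis unfolding m2_def by simp
      qed
      finally show "expectation (\<lambda>\<omega>. (xi n j \<omega>)\<^sup>2) = 1 / real n" .
      have "expectation (\<lambda>\<omega>. xi n j \<omega> ^ 4) = (\<integral>x. (clip (x / (8 * a n)) / s n) ^ 4 \<partial>law)"
        unfolding xi_def using j by (intro expectation_X) auto
      also have "\<dots> = (\<integral>x. clip (x / (8 * a n)) ^ 4 \<partial>law) / (m2 n)\<^sup>2"
        unfolding power_divide s4 by simp
      also have "\<dots> = m4 n / real n / (m2 n)\<^sup>2"
        using elim unfolding m4_def by simp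
      also have "\<dots> \<le> m4 n / real n / (1/512)\<^sup>2"
        using elim m4_nonneg by (intro divide_left_mono power_mono mult_pos_pos zero_less_power) auto
      also have "\<dots> = rho n / real n" unfolding rho_def by (simp add: power_divide)
      finally show "expectation (\<lambda>\<omega>. xi n j \<omega> ^ 4) \<le> rho n / real n" .
    qed
    moreover have "8 * a n * s n > 0" using a s by simp
    moreover have "holds_up_to M (3 * rho n) (\<lambda>\<omega>. \<forall>j\<in>{1..3*n}. X j \<omega> = 8 * a n * s n * xi n j \<omega>)"
      unfolding holds_up_to_def
    proof (intro bexI conjI ballI)
      define A where "A j = {\<omega>\<in>space M. 1 < \<bar>X j \<omega> / (8 * a n)\<bar>}" for j
      have mA: "A j \<in> sets M" if "j \<in> {1..3*n}" for j
      proof -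
        have [measurable]: "X j \<in> borel_measurable M" using that by auto
        show ?thesis unfolding A_def by measurable
      qed
      have PA: "measure M (A j) \<le> m4 n / real n" if j: "j \<in> {1..3*n}" for j
      proof -
        have [measurable]: "X j \<in> borel_measurable M" "A j \<in> sets M" using j mA by auto
        have "measure M (A j) = expectation (indicator (A j))" by simp
        \<comment> \<open>Above the level the clipped value has modulus 1, so its fourth power
          dominates the indicator.\<close>
        also have "\<dots> \<le> expectation (\<lambda>\<omega>. clip (X j \<omega> / (8 * a n)) ^ 4)"
        proof (rule integral_mono)
          show "integrable M (indicator (A j) :: 'a \<Rightarrow> real)"
            by (rule integrable_const_bound[where B=1]) auto
          have "clip y ^ 4 \<le> 1" for y
            using power_mono[OF abs_clip_le[of y], of 4] by (simp add: power_even_abs)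
          then show "integrable M (\<lambda>\<omega>. clip (X j \<omega> / (8 * a n)) ^ 4)"
            by (intro integrable_const_bound[where B=1]) auto
          show "indicator (A j) \<omega> \<le> clip (X j \<omega> / (8 * a n)) ^ 4" for \<omega>
            using clip_power4_eq_1[of "X j \<omega> / (8 * a n)"] by (auto simp: A_def split: split_indicator)
        qed
        also have "\<dots> = (\<integral>x. clip (x / (8 * a n)) ^ 4 \<partial>law)" using j by (intro expectation_X) auto
        also have "\<dots> = m4 n / real n" unfolding m4_def using elim by simp
        finally show ?thesis .
      qed
      show "(\<Union>j\<in>{1..3*n}. A j) \<in> sets M" using mA by auto
      have "measure M (\<Union>j\<in>{1..3*n}. A j) \<le> (\<Sum>j\<in>{1..3*n}. measure M (A j))"
        by (rule finite_measure_subadditive_finite) (use mA in auto)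
      also have "\<dots> \<le> (\<Sum>j\<in>{1..3*n}. m4 n / real n)" by (intro sum_mono PA) auto
      also have "\<dots> = 3 * m4 n" using elim by simp
      also have "\<dots> \<le> 3 * rho n" unfolding rho_def using m4_nonneg[of n] by simp
      finally show "measure M (\<Union>j\<in>{1..3*n}. A j) \<le> 3 * rho n" .
      fix \<omega> j assume \<omega>: "\<omega> \<in> space M - (\<Union>j\<in>{1..3*n}. A j)" and j: "j \<in> {1..3*n}"
      then have "\<bar>X j \<omega> / (8 * a n)\<bar> \<le> 1" by (auto simp: A_def not_less)
      then show "X j \<omega> = 8 * a n * s n * xi n j \<omega>"
        unfolding xi_def using s a[of n] by (simp add: clip_eq)
    qed
    ultimately show ?case by blast
  qed
  then show thesis by (rule that[OF rho0])
qed

end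

section \<open>The logarithmic time change\<close>

text \<open>For t >= 0 this is the largest l >= n with \<open>tau n l \<le> t\<close>, the left node
  of the segment used by \<open>Yproc\<close> at time t.\<close>

definition idx :: "nat \<Rightarrow> real \<Rightarrow> nat" where
  "idx n t = (LEAST l. n \<le> l \<and> t < tau n (Suc l))"

lemma tau_self [simp]: "tau n n = 0"
  by (simp add: tau_def)

lemma tau_Suc: "n \<le> l \<Longrightarrow> tau n (Suc l) = tau n l + 1 / real (Suc l)"
  by (simp add: tau_def)

lemma tau_split: "n \<le> p \<Longrightarrow> p \<le> q \<Longrightarrow> tau n q = tau n p + (\<Sum>j\<in>{p<..q}. 1 / real j)"
proof -
  assume "n \<le> p" "p \<le> q"
  then have "{n+1..q} = {n+1..p} \<union> {p<..q}" by auto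
  then show ?thesis unfolding tau_def by (simp add: sum.union_disjoint ivl_disj_int)
qed

lemma tau_mono: "n \<le> p \<Longrightarrow> p \<le> q \<Longrightarrow> tau n p \<le> tau n q"
  using tau_split[of n p q] by (simp add: sum_nonneg)

lemma tau_diff_ge: "n \<le> p \<Longrightarrow> p \<le> q \<Longrightarrow> real (q - p) / real q \<le> tau n q - tau n p"
proof -
  assume a: "n \<le> p" "p \<le> q"
  have "real (card {p<..q}) * (1 / real q) \<le> (\<Sum>j\<in>{p<..q}. 1 / real j)"
    by (rule sum_bounded_below) (auto simp: frac_le)
  then show ?thesis using tau_split[OF a] by simp
qed

text \<open>Harmonic sum against logarithm, with \<open>tau_upper\<close> as the counterpart from
  above. Together they place time t near the index n e^t.\<close>

lemma tau_lower:
  assumes "n \<le> l"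
  shows "ln ((real l + 1) / (real n + 1)) \<le> tau n l"
  using assms
proof (induction l rule: dec_induct)
  case (step l)
  have "ln ((real (Suc l) + 1) / (real n + 1)) =
      ln ((real l + 1) / (real n + 1)) + ln (1 + 1 / real (Suc l))"
  proof (subst ln_mult_pos[symmetric])
    show "ln ((real (Suc l) + 1) / (real n + 1)) = ln ((real l + 1) / (real n + 1) * (1 + 1 / real (Suc l)))"
      by (rule arg_cong[where f=ln]) (simp add: divide_simps)
  qed (auto intro: add_pos_nonneg)
  also have "\<dots> \<le> tau n l + 1 / real (Suc l)"
    by (intro add_mono step.IH ln_add_one_self_le_self) auto
  finally show ?case using step.hyps by (simp add: tau_Suc)
qed simp

lemma tau_upper:
  assumes n: "0 < n" and "n \<le> l"
  shows "tau n l \<le> ln (real l / real n)"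
  using assms(2)
proof (induction l rule: dec_induct)
  case (step l)
  have l: "0 < l" using step n by simp
  \<comment> \<open>This is ln (1 + x) <= x at x = - 1 / (l + 1).\<close>
  have "1 / real (Suc l) \<le> - ln (1 - 1 / real (Suc l))"
    using ln_add_one_self_le_self2[of "- (1 / real (Suc l))"] l by (simp add: field_simps)
  also have "1 - 1 / real (Suc l) = inverse (real (Suc l) / real l)" using l by (simp add: field_simps)
  also have "- ln (inverse (real (Suc l) / real l)) = ln (real (Suc l) / real l)"
    using l by (subst ln_inverse) auto
  finally have "tau n (Suc l) \<le> ln (real l / real n) + ln (real (Suc l) / real l)"
    using step by (simp add: tau_Suc)
  also have "\<dots> = ln (real (Suc l) / real n)"
    using l n by (subst ln_mult_pos[symmetric]) auto
  finally show ?case .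
qed simp

lemma tau_unbounded: "\<exists>l\<ge>n. t < tau n (Suc l)"
proof -
  obtain m :: nat where m: "(real n + 1) * exp t < real m" using reals_Archimedean2 by blast
  have "t = ln (exp t)" by simp
  also have "\<dots> < ln ((real (Suc (n + m)) + 1) / (real n + 1))"
  proof (subst ln_less_cancel_iff)
    show "exp t < (real (Suc (n + m)) + 1) / (real n + 1)"
      using m by (simp add: pos_less_divide_eq mult.commute)
  qed auto
  also have "\<dots> \<le> tau n (Suc (n + m))" by (rule tau_lower) auto
  finally show ?thesis by (intro exI[of _ "n + m"]) auto
qed

lemma idx_ge: "n \<le> idx n t" and idx_upper: "t < tau n (Suc (idx n t))"
proof -
  have "\<exists>l. n \<le> l \<and> t < tau n (Suc l)" using tau_unbounded by blast
  from LeastI_ex[OF this] show "n \<le> idx n t" "t < tau n (Suc (idx n t))" unfolding idx_def by auto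
qed

lemma idx_le: "n \<le> l \<Longrightarrow> t < tau n (Suc l) \<Longrightarrow> idx n t \<le> l"
  unfolding idx_def by (rule Least_le) auto

lemma idx_mono: "s \<le> t \<Longrightarrow> idx n s \<le> idx n t"
  by (rule idx_le[OF idx_ge]) (use idx_upper[of t n] in simp)

lemma idx_lower:
  assumes "0 \<le> t"
  shows "tau n (idx n t) \<le> t"
proof (cases "idx n t = n")
  case False
  then obtain l where l: "idx n t = Suc l" "n \<le> l" using idx_ge[of n t] by (cases "idx n t") auto
  then have "\<not> t < tau n (Suc l)" using idx_le[of n l t] by auto
  then show ?thesis using l by simp
qed (use assms in simp)

lemma idx_unique: "n \<le> l \<Longrightarrow> tau n l \<le> t \<Longrightarrow> t < tau n (Suc l) \<Longrightarrow> idx n t = l"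
proof (rule antisym)
  assume a: "n \<le> l" "tau n l \<le> t" "t < tau n (Suc l)"
  show "idx n t \<le> l" by (rule idx_le) (use a in auto)
  show "l \<le> idx n t"
  proof (rule ccontr)
    assume "\<not> l \<le> idx n t"
    then have "tau n (Suc (idx n t)) \<le> tau n l" using idx_ge[of n t] by (intro tau_mono) auto
    then show False using idx_upper[of t n] a by simp
  qed
qed

lemma idx_exp_bounds:
  assumes "0 < n" "0 \<le> t"
  shows "real n * exp t < real (idx n t) + 1" "real (idx n t) + 1 \<le> (real n + 1) * exp t"
proof -
  have "t < ln (real (Suc (idx n t)) / real n)"
    using idx_upper[of t n] tau_upper[of n "Suc (idx n t)"] idx_ge[of n t] assms by simp
  then have "exp t < exp (ln (real (Suc (idx n t)) / real n))" by (simp only: exp_less_cancel_iff)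
  also have "\<dots> = real (Suc (idx n t)) / real n" using assms by (intro exp_ln) auto
  finally show "real n * exp t < real (idx n t) + 1"
    using assms by (simp add: pos_less_divide_eq mult.commute)
  have "ln ((real (idx n t) + 1) / (real n + 1)) \<le> t"
    using tau_lower[OF idx_ge, of n t] idx_lower[OF assms(2), of n] by linarith
  then have "exp (ln ((real (idx n t) + 1) / (real n + 1))) \<le> exp t" by (simp only: exp_le_cancel_iff)
  moreover have "exp (ln ((real (idx n t) + 1) / (real n + 1))) = (real (idx n t) + 1) / (real n + 1)"
    by (intro exp_ln) auto
  ultimately show "real (idx n t) + 1 \<le> (real n + 1) * exp t"
    by (simp add: pos_divide_le_eq mult.commute)
qed

lemma idx_tendsto:
  assumes "0 \<le> t"
  shows "(\<lambda>n. real (idx n t) / real n) \<longlonglongrightarrow> exp t"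
proof (rule tendsto_sandwich)
  show "\<forall>\<^sub>F n in sequentially. exp t - 1 / real n \<le> real (idx n t) / real n"
    using eventually_gt_at_top[of 0]
  proof eventually_elim
    case (elim n)
    have "real n * exp t - 1 \<le> real (idx n t)" using idx_exp_bounds(1)[OF elim assms] by linarith
    then have "(real n * exp t - 1) / real n \<le> real (idx n t) / real n" by (intro divide_right_mono) auto
    then show ?case using elim by (simp add: diff_divide_distrib)
  qed
  show "\<forall>\<^sub>F n in sequentially. real (idx n t) / real n \<le> exp t + exp t * (1 / real n)"
    using eventually_gt_at_top[of 0]
  proof eventually_elim
    case (elim n)
    have "real (idx n t) \<le> (real n + 1) * exp t" using idx_exp_bounds(2)[OF elim assms] by linarith
    then have "real (idx n t) / real n \<le> ((real n + 1) * exp t) / real n" by (intro divide_right_mono) auto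
    then show ?case using elim by (simp add: add_divide_distrib distrib_right)
  qed
  have "(\<lambda>n. exp t - 1 / real n) \<longlonglongrightarrow> exp t - 0" by (intro tendsto_intros lim_1_over_n)
  then show "(\<lambda>n. exp t - 1 / real n) \<longlonglongrightarrow> exp t" by simp
  have "(\<lambda>n. exp t + exp t * (1 / real n)) \<longlonglongrightarrow> exp t + exp t * 0" by (intro tendsto_intros lim_1_over_n)
  then show "(\<lambda>n. exp t + exp t * (1 / real n)) \<longlonglongrightarrow> exp t" by simp
qed

lemma idx_less_3n:
  assumes "10 \<le> n" "t \<in> {0..1}"
  shows "idx n t + 1 \<le> 3 * n"
proof -
  have "real (idx n t) + 1 \<le> (real n + 1) * exp t"
    using assms by (intro idx_exp_bounds) auto
  \<comment> \<open>2.72 bounds e, and 2.72 (n + 1) <= 3 n is what requires n >= 10.\<close>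
  also have "\<dots> \<le> (real n + 1) * (272/100)"
  proof (rule mult_left_mono)
    have "exp t \<le> exp 1" using assms by simp
    then show "exp t \<le> 272/100" using e_less_272 by linarith
  qed simp
  also have "\<dots> \<le> 3 * real n" using assms by simp
  finally show ?thesis by linarith
qed

text \<open>Segments ending at an index up to 3n last at least 1 / (3n). The additional 1 counts the
  segment containing s, which may lie only partly in [s, t].\<close>

lemma idx_diff_le:
  assumes n: "10 \<le> n" and st: "s \<in> {0..1}" "t \<in> {0..1}" "s \<le> t"
  shows "real (idx n t - idx n s) \<le> 3 * real n * (t - s) + 1"
proof (cases "idx n t \<le> Suc (idx n s)")
  case True
  have "0 \<le> 3 * real n * (t - s)" using st by simp
  moreover have "idx n t - idx n s \<le> 1" using True by simp
  ultimately show ?thesis by linarith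
next
  case False
  have q: "idx n t \<le> 3 * n" using idx_less_3n[OF n st(2)] by simp
  have "real (idx n t - Suc (idx n s)) / real (3 * n) \<le> real (idx n t - Suc (idx n s)) / real (idx n t)"
    using q False by (intro divide_left_mono) auto
  also have "\<dots> \<le> tau n (idx n t) - tau n (Suc (idx n s))"
    using False idx_ge[of n s] by (intro tau_diff_ge) auto
  also have "\<dots> \<le> t - s" using idx_lower[of t n] idx_upper[of s n] st by simp
  finally have "real (idx n t - Suc (idx n s)) \<le> 3 * real n * (t - s)"
    using n by (simp add: field_simps)
  then show ?thesis using False by linarith
qed

section \<open>The interpolated process\<close>

lemma Yproc_idx:
  "Yproc X n \<omega> t = Y_self X (idx n t) \<omega> + (t - tau n (idx n t)) / (tau n (Suc (idx n t)) - tau n (idx n t))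
      * (Y_self X (Suc (idx n t)) \<omega> - Y_self X (idx n t) \<omega>)"
  unfolding Yproc_def idx_def[symmetric] Let_def ..

lemma Yproc_close:
  assumes "0 \<le> t" and Y: "\<bar>Y_self X (idx n t) \<omega> - c\<bar> \<le> e" "\<bar>Y_self X (Suc (idx n t)) \<omega> - c\<bar> \<le> e"
  shows "\<bar>Yproc X n \<omega> t - c\<bar> \<le> e"
proof -
  define u where "u = (t - tau n (idx n t)) / (tau n (Suc (idx n t)) - tau n (idx n t))"
  have "tau n (idx n t) \<le> t" "t < tau n (Suc (idx n t))"
    using idx_lower[OF assms(1)] idx_upper by auto
  then have u: "0 \<le> u" "u \<le> 1" unfolding u_def by (auto simp: field_simps)
  have "Yproc X n \<omega> t - c = (1 - u) * (Y_self X (idx n t) \<omega> - c) + u * (Y_self X (Suc (idx n t)) \<omega> - c)"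
    unfolding Yproc_idx u_def[symmetric] by (simp add: algebra_simps)
  also have "\<bar>\<dots>\<bar> \<le> (1 - u) * \<bar>Y_self X (idx n t) \<omega> - c\<bar> + u * \<bar>Y_self X (Suc (idx n t)) \<omega> - c\<bar>"
    using u by (intro order.trans[OF abs_triangle_ineq]) (simp add: abs_mult)
  also have "\<dots> \<le> (1 - u) * e + u * e" using u Y by (intro add_mono mult_left_mono) auto
  finally show ?thesis by (simp add: algebra_simps)
qed

lemma Yproc_C01: "Yproc X n \<omega> \<in> C01"
proof -
  have cont: "continuous_on {0..tau n l} (Yproc X n \<omega>)" if "n \<le> l" for l
    using that
  proof (induction l rule: dec_induct)
    case (step l)
    define g where "g t = Y_self X l \<omega> + (t - tau n l) / (tau n (Suc l) - tau n l) * (Y_self X (Suc l) \<omega> - Y_self X l \<omega>)" for t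
    have lt: "tau n l < tau n (Suc l)" and "0 \<le> tau n l"
      using step tau_mono[of n n l] by (auto simp: tau_Suc)
    then have eq: "{0..tau n (Suc l)} = {0..tau n l} \<union> {tau n l..tau n (Suc l)}" by auto
    have "Yproc X n \<omega> t = g t" if "t \<in> {tau n l..tau n (Suc l)}" for t
    \<comment> \<open>At the right end \<open>idx\<close> has already moved on to
      \<open>Suc l\<close>, but both segment formulas give the same node value there.\<close>
    proof (cases "t = tau n (Suc l)")
      case True
      have "idx n t = Suc l"
        using step.hyps True by (intro idx_unique) (auto simp: tau_Suc)
      then show ?thesis unfolding Yproc_idx g_def using True lt by simp
    next
      case False
      then have "idx n t = l" using that step.hyps by (intro idx_unique) auto
      then show ?thesis unfolding Yproc_idx g_def by simp
    qed
    moreover have "continuous_on {tau n l..tau n (Suc l)} g"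
      unfolding g_def using lt by (intro continuous_intros) auto
    ultimately have "continuous_on {tau n l..tau n (Suc l)} (Yproc X n \<omega>)"
      by (metis (no_types, lifting) continuous_on_eq)
    then show ?case unfolding eq by (intro continuous_on_closed_Un step.IH) auto
  qed simp
  obtain l where "l \<ge> n" "1 < tau n (Suc l)" using tau_unbounded by blast
  then show ?thesis
    unfolding C01_def using continuous_on_subset[OF cont[of "Suc l"]] by simp
qed

lemma Y_self_measurable:
  assumes "\<And>i. i \<ge> 1 \<Longrightarrow> X i \<in> borel_measurable M"
  shows "Y_self X j \<in> borel_measurable M"
  unfolding Y_self_def[abs_def] S_sum_def V_sum_def using assms
  by (intro borel_measurable_divide borel_measurable_sum borel_measurable_sqrt borel_measurable_power) auto

lemma Yproc_measurable:
  assumes "\<And>i. i \<ge> 1 \<Longrightarrow> X i \<in> borel_measurable M"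
  shows "(\<lambda>\<omega>. Yproc X n \<omega> t) \<in> borel_measurable M"
  unfolding Yproc_idx using Y_self_measurable[OF assms]
  by (intro borel_measurable_add borel_measurable_times borel_measurable_diff borel_measurable_const) auto

section \<open>Convergence of the self-normalized process\<close>

lemma abs_cos_diff_le: "\<bar>cos x - cos y\<bar> \<le> \<bar>x - y\<bar>" for x y :: real
proof -
  have "\<bar>cos x - cos y\<bar> = 2 * \<bar>sin ((x + y) / 2)\<bar> * \<bar>sin ((y - x) / 2)\<bar>"
    unfolding cos_diff_cos by (simp add: abs_mult)
  also have "\<dots> \<le> 2 * 1 * \<bar>(y - x) / 2\<bar>"
    by (intro mult_mono abs_sin_x_le_abs_x mult_nonneg_nonneg) auto
  finally show ?thesis by simp
qed

text \<open>For a Brownian motion B, exp (- t / 2) B (exp t) is the stationary Ornstein-Uhlenbeck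
  process; this is its covariance.\<close>

lemma min_exp_correlation:
  "min (exp s) (exp t) / (sqrt (exp s) * sqrt (exp t)) = exp (- \<bar>s - t\<bar> / 2 :: real)"
proof -
  have "sqrt (exp s) = exp (s / 2)" for s :: real
    by (rule real_sqrt_unique) (simp_all add: power2_eq_square mult_exp_exp)
  then have "min (exp s) (exp t) / (sqrt (exp s) * sqrt (exp t)) = exp (min s t) / exp (s / 2 + t / 2)"
    by (auto simp: min_def exp_add)
  also have "\<dots> = exp (min s t - (s / 2 + t / 2))" by (simp add: exp_diff)
  also have "min s t - (s / 2 + t / 2) = - \<bar>s - t\<bar> / 2"
    unfolding min_def by (cases "s \<le> t") (simp_all add: abs_if diff_divide_distrib)
  finally show ?thesis .
qed

lemma stationary_OU_cos:
  fixes Z :: "real \<Rightarrow> 'b \<Rightarrow> real" and ts :: "nat \<Rightarrow> real"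
  assumes OU: "stationary_OU Q Z" and ts: "\<And>i. i < k \<Longrightarrow> ts i \<in> {0..1}"
  shows "(\<integral>\<omega>. cos (a + (\<Sum>i<k. c i * Z (ts i) \<omega>)) \<partial>Q) =
     cos a * exp (- (\<Sum>i<k. \<Sum>j<k. c i * c j * exp (- \<bar>ts i - ts j\<bar> / 2)) / 2)"
proof -
  interpret Q: prob_space Q using OU unfolding stationary_OU_def by blast
  have [measurable]: "(\<lambda>\<omega>. \<Sum>i<k. c i * Z (ts i) \<omega>) \<in> borel_measurable Q"
    using OU ts unfolding stationary_OU_def by (intro borel_measurable_sum borel_measurable_times) auto
  have "char (distr Q borel (\<lambda>\<omega>. \<Sum>i<k. c i * Z (ts i) \<omega>)) 1 =
     complex_of_real (exp (- (\<Sum>i<k. \<Sum>j<k. c i * c j * exp (- \<bar>ts i - ts j\<bar> / 2)) * 1\<^sup>2 / 2))"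
    using OU ts unfolding stationary_OU_def Let_def by (elim conjE allE[of _ k] allE[of _ ts] allE[of _ c]) auto
  then show ?thesis by (subst Q.expectation_cos_char) auto
qed

section \<open>Comparison with normalized row sums, tightness and finite-dimensional limits\<close>

context
  fixes M :: "'a measure" and X :: "nat \<Rightarrow> 'a \<Rightarrow> real"
    and xi :: "nat \<Rightarrow> nat \<Rightarrow> 'a \<Rightarrow> real" and b rho C :: "nat \<Rightarrow> real"
  assumes M: "prob_space M"
    and mX: "\<And>i. i \<ge> 1 \<Longrightarrow> X i \<in> borel_measurable M"
    and rho0: "rho \<longlonglongrightarrow> 0"
    and array: "\<forall>\<^sub>F n in sequentially. row_array M (xi n) n (rho n) (C n) \<and> b n > 0 \<and>
      holds_up_to M (3 * rho n) (\<lambda>\<omega>. \<forall>j\<in>{1..3*n}. X j \<omega> = b n * xi n j \<omega>)"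
begin

interpretation prob_space M by (rule M)

abbreviation (input) "row_sum n \<equiv> row_array.T (xi n)"

definition Rn :: "nat \<Rightarrow> nat \<Rightarrow> 'a \<Rightarrow> real" where
  "Rn n l \<omega> = row_sum n l \<omega> / sqrt (real l / real n)"

text \<open>Off the exceptional sets X j = \<open>b n * xi n j\<close> for j <= 3n, so
  \<open>b n\<close> cancels in the quotient, the sum of squares is close to l / n and the row sums
  are bounded by 2 K. The exceptional probabilities that involve \<open>rho\<close> tend to 0, the
  one for the row sums is bounded through the choice of K; hence twice \<eta>.\<close>

lemma Y_self_close:
  assumes eps: "0 < \<epsilon>" and K: "0 < K" "6 / K\<^sup>2 \<le> \<eta>" and eta: "0 < \<eta>"
  shows "\<forall>\<^sub>F n in sequentially. holds_up_to M (2 * \<eta>)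
     (\<lambda>\<omega>. \<forall>l\<in>{n..3*n}. \<bar>Y_self X l \<omega> - Rn n l \<omega>\<bar> \<le> \<epsilon> \<and> \<bar>row_sum n l \<omega>\<bar> \<le> 2 * K)"
proof -
  \<comment> \<open>\<open>self_normalized_close\<close> requires x <= 1/8 and gives the error 4 K
    x.\<close>
  define x where "x = min (1/8) (\<epsilon> / (4 * K))"
  have x: "0 < x" "x \<le> 1/8" "4 * K * x \<le> \<epsilon>"
    using eps K unfolding x_def by (auto simp: min_def field_simps)
  have "(\<lambda>n. 3 * rho n + 6 * rho n / x\<^sup>2) \<longlonglongrightarrow> 3 * 0 + 6 * 0 / x\<^sup>2"
    using x by (intro tendsto_intros rho0) auto
  then have "\<forall>\<^sub>F n in sequentially. 3 * rho n + 6 * rho n / x\<^sup>2 < \<eta>"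
    using eta by (intro order_tendstoD) auto
  with array show ?thesis
  proof eventually_elim
    case (elim n)
    then have row: "row_array M (xi n) n (rho n) (C n)" and bpos: "b n > 0" by auto
    interpret row_array M "xi n" n "rho n" "C n" by (rule row)
    have "holds_up_to M (3 * rho n + 6 * rho n / x\<^sup>2 + 6 / K\<^sup>2) (\<lambda>\<omega>.
       ((\<forall>j\<in>{1..3*n}. X j \<omega> = b n * xi n j \<omega>) \<and> (\<forall>k\<in>{0..3*n}. \<bar>U k \<omega> - real k / real n\<bar> \<le> 2 * x)) \<and>
       (\<forall>k\<in>{0..3*n}. \<bar>T k \<omega>\<bar> \<le> 2 * K))"
      using elim x K by (intro holds_up_to_conj max_U max_T) auto
    then show ?case
    proof (rule holds_up_to_mono; (intro ballI)?)
      show "3 * rho n + 6 * rho n / x\<^sup>2 + 6 / K\<^sup>2 \<le> 2 * \<eta>" using elim K(2) by linarith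
      fix \<omega> l assume \<omega>: "((\<forall>j\<in>{1..3*n}. X j \<omega> = b n * xi n j \<omega>) \<and> (\<forall>k\<in>{0..3*n}. \<bar>U k \<omega> - real k / real n\<bar> \<le> 2 * x)) \<and>
       (\<forall>k\<in>{0..3*n}. \<bar>T k \<omega>\<bar> \<le> 2 * K)" and l: "l \<in> {n..3*n}"
      have XA: "X j \<omega> = b n * xi n j \<omega>" if "j \<in> {1..3*n}" for j using \<omega> that by blast
      have Tl: "\<bar>T l \<omega>\<bar> \<le> 2 * K" and Ul: "\<bar>U l \<omega> - real l / real n\<bar> \<le> 2 * x" using \<omega> l by auto
      have S: "S_sum X l \<omega> = b n * T l \<omega>"
        unfolding S_sum_def T_def sum_distrib_left
        by (rule sum.cong[OF refl], rule XA) (use \<omega> l in auto)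
      have "(\<Sum>i\<in>{1..l}. (X i \<omega>)\<^sup>2) = (b n)\<^sup>2 * U l \<omega>"
        unfolding U_def sum_distrib_left
        by (rule sum.cong[OF refl], subst XA) (use \<omega> l in \<open>auto simp: power_mult_distrib\<close>)
      then have "V_sum X l \<omega> = b n * sqrt (U l \<omega>)"
        unfolding V_sum_def using bpos by (simp add: real_sqrt_mult)
      then have "Y_self X l \<omega> = T l \<omega> / sqrt (U l \<omega>)"
        unfolding Y_self_def S using bpos by simp
      then have "\<bar>Y_self X l \<omega> - Rn n l \<omega>\<bar> \<le> 4 * K * x"
        using self_normalized_close[OF Ul x(2) Tl] l unfolding Rn_def by simp
      then show "\<bar>Y_self X l \<omega> - Rn n l \<omega>\<bar> \<le> \<epsilon> \<and> \<bar>T l \<omega>\<bar> \<le> 2 * K" using x(3) Tl by linarith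
    qed
  qed
qed

text \<open>With u_l = 1 / sqrt (l / n), the difference is (T_k - T_p) u_k + T_p (u_k - u_p). For l
  >= n, u_l is at most 1 and Lipschitz in l / n with constant 1.\<close>

lemma Rn_diff_le:
  assumes "0 < n" "n \<le> p" "p \<le> k" "\<bar>row_sum n p \<omega>\<bar> \<le> 2 * K"
  shows "\<bar>Rn n k \<omega> - Rn n p \<omega>\<bar> \<le> \<bar>row_sum n k \<omega> - row_sum n p \<omega>\<bar> + 2 * K * (real (k - p) / real n)"
proof -
  define u where "u l = 1 / sqrt (real l / real n)" for l
  have ge1: "1 \<le> real p / real n" "1 \<le> real k / real n" using assms by auto
  then have "0 \<le> u k" "u k \<le> 1" unfolding u_def by auto
  then have 1: "\<bar>row_sum n k \<omega> - row_sum n p \<omega>\<bar> * u k \<le> \<bar>row_sum n k \<omega> - row_sum n p \<omega>\<bar>" by (simp add: mult_left_le)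
  have "\<bar>u k - u p\<bar> \<le> \<bar>real k / real n - real p / real n\<bar>"
    unfolding u_def by (rule inverse_sqrt_diff) (use ge1 in linarith)+
  also have "\<dots> = real (k - p) / real n"
  proof -
    have "real p / real n \<le> real k / real n" using assms by (intro divide_right_mono) auto
    then show ?thesis using assms by (simp add: of_nat_diff diff_divide_distrib)
  qed
  finally have "\<bar>row_sum n p \<omega>\<bar> * \<bar>u k - u p\<bar> \<le> 2 * K * (real (k - p) / real n)"
    using assms by (intro mult_mono) auto
  moreover have "Rn n k \<omega> - Rn n p \<omega> = (row_sum n k \<omega> - row_sum n p \<omega>) * u k + row_sum n p \<omega> * (u k - u p)"
    unfolding Rn_def u_def by (simp add: algebra_simps)
  then have "\<bar>Rn n k \<omega> - Rn n p \<omega>\<bar> \<le> \<bar>row_sum n k \<omega> - row_sum n p \<omega>\<bar> * u k + \<bar>row_sum n p \<omega>\<bar> * \<bar>u k - u p\<bar>"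
    using \<open>0 \<le> u k\<close> abs_triangle_ineq[of "(row_sum n k \<omega> - row_sum n p \<omega>) * u k" "row_sum n p \<omega> * (u k - u p)"]
    by (simp add: abs_mult)
  ultimately show ?thesis using 1 by linarith
qed

lemma chebyshev_level:
  assumes "0 < (\<eta>::real)"
  obtains K where "0 < K" "6 / K\<^sup>2 \<le> \<eta>"
proof
  show "0 < sqrt (6 / \<eta>)" "6 / (sqrt (6 / \<eta>))\<^sup>2 \<le> \<eta>" using assms by auto
qed

text \<open>[0,1] is cut into m intervals, each matching a block of at most 4n/m indices on which
  \<open>block_4\<close> bounds the oscillation of the row sums. A time within 1/m of a node shares
  one of the intervals with it, and both are compared with the first index of that block.\<close>

lemma Yproc_modulus:
  assumes eps: "0 < \<epsilon>" and eta: "0 < \<eta>"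
  shows "\<exists>m0. \<forall>m\<ge>m0. \<forall>\<^sub>F n in sequentially.
       holds_up_to M \<eta> (\<lambda>\<omega>. \<forall>i\<le>m. \<forall>t\<in>{0..1}.
          \<bar>real m * t - real i\<bar> < 1 \<longrightarrow> \<bar>Yproc X n \<omega> t - Yproc X n \<omega> (real i / real m)\<bar> \<le> \<epsilon>)"
proof -
  obtain K where K: "0 < K" "6 / K\<^sup>2 \<le> \<eta> / 8" using chebyshev_level[of "\<eta> / 8"] eta by auto
  \<comment> \<open>Budget for a comparison with the start of a block: 2 x = \<epsilon> / 8 from the
    row sums, \<epsilon> / 16 from the change of normalization and twice \<epsilon> / 32 from
    self-normalization, in all \<epsilon> / 4.\<close>
  define x where "x = \<epsilon> / 16"
  have x: "0 < x" using eps by (simp add: x_def)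
  \<comment> \<open>In this order the summands secure m > 0, the variance condition of
    \<open>block_4\<close>, a total probability 96 / (m x^4) of at most \<eta> / 4, and a small
    change of normalization within a block.\<close>
  obtain m0 :: nat where m0: "1 + 8 / x\<^sup>2 + 384 / (\<eta> * x ^ 4) + 128 * K / \<epsilon> < real m0"
    using reals_Archimedean2 by blast
  show ?thesis
  proof (intro exI allI impI)
    fix m assume "m0 \<le> m"
    then have m: "1 + 8 / x\<^sup>2 + 384 / (\<eta> * x ^ 4) + 128 * K / \<epsilon> < real m" using m0 by linarith
    have nn: "0 \<le> 8 / x\<^sup>2" "0 \<le> 384 / (\<eta> * x ^ 4)" "0 \<le> 128 * K / \<epsilon>"
      using x eta eps K by auto
    have mpos: "0 < real m" "0 < m" using m nn by linarith+
    have "8 / x\<^sup>2 \<le> real m" using m nn by linarith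
    then have m1: "4 / real m / x\<^sup>2 \<le> 1/2" using x mpos by (simp add: field_simps)
    have "384 / (\<eta> * x ^ 4) \<le> real m" using m nn by linarith
    then have m2: "96 / real m / x ^ 4 \<le> \<eta> / 4" using x mpos eta by (simp add: field_simps)
    have "128 * K / \<epsilon> \<le> real m" using m nn by linarith
    then have m3: "2 * K * (4 / real m) \<le> \<epsilon> / 16" using mpos eps by (simp add: field_simps)
    have close: "\<forall>\<^sub>F n in sequentially. holds_up_to M (2 * (\<eta> / 8))
     (\<lambda>\<omega>. \<forall>l\<in>{n..3*n}. \<bar>Y_self X l \<omega> - Rn n l \<omega>\<bar> \<le> \<epsilon> / 32 \<and> \<bar>row_sum n l \<omega>\<bar> \<le> 2 * K)"
      using eps eta K by (intro Y_self_close) auto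
    have "(\<lambda>n. 8 * rho n / x ^ 4) \<longlonglongrightarrow> 8 * 0 / x ^ 4" using x by (intro tendsto_intros rho0) auto
    then have "\<forall>\<^sub>F n in sequentially. 8 * rho n / x ^ 4 < \<eta> / 4"
      using eta by (intro order_tendstoD) auto
    \<comment> \<open>n >= 10 is for \<open>idx_less_3n\<close>; n >= 2 m absorbs the rounding in
      the block length, 3 n / m + 2 <= 4 n / m.\<close>
    from array close eventually_ge_at_top[of "10 + 2 * m"] this
    show "\<forall>\<^sub>F n in sequentially.
       holds_up_to M \<eta> (\<lambda>\<omega>. \<forall>i\<le>m. \<forall>t\<in>{0..1}.
          \<bar>real m * t - real i\<bar> < 1 \<longrightarrow> \<bar>Yproc X n \<omega> t - Yproc X n \<omega> (real i / real m)\<bar> \<le> \<epsilon>)"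
    proof eventually_elim
      case (elim n)
      then have row: "row_array M (xi n) n (rho n) (C n)" and n: "10 \<le> n" "2 * m \<le> n" by auto
      interpret row_array M "xi n" n "rho n" "C n" by (rule row)
      define p where "p i = idx n (real i / real m)" for i
      \<comment> \<open>One index past the right end, since the interpolation there also uses the
        next node.\<close>
      define q where "q i = Suc (idx n (real (Suc i) / real m))" for i
      have grid: "real i / real m \<in> {0..1}" if "i \<le> m" for i
        using that mpos by (auto simp: divide_le_eq_1)
      have pq: "n \<le> p i" "p i \<le> q i" "q i \<le> 3 * n" "real (q i - p i) / real n \<le> 4 / real m" if i: "i < m" for i
      proof -
        have le: "real i / real m \<le> real (Suc i) / real m" by (simp add: divide_right_mono)
        show "n \<le> p i" unfolding p_def by (rule idx_ge)
        have mono: "p i \<le> idx n (real (Suc i) / real m)" unfolding p_def by (rule idx_mono[OF le])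
        then show "p i \<le> q i" unfolding q_def by simp
        show "q i \<le> 3 * n" using idx_less_3n[OF n(1) grid[of "Suc i"]] i unfolding q_def by simp
        have "real (idx n (real (Suc i) / real m) - p i) \<le> 3 * real n * (real (Suc i) / real m - real i / real m) + 1"
          unfolding p_def using i by (intro idx_diff_le n grid le) auto
        also have "real (Suc i) / real m - real i / real m = 1 / real m" by (simp add: diff_divide_distrib[symmetric])
        finally have "real (q i - p i) \<le> 3 * real n / real m + 2" using mono unfolding q_def by simp
        also have "\<dots> \<le> 4 * real n / real m" using n(2) mpos by (simp add: field_simps)
        finally show "real (q i - p i) / real n \<le> 4 / real m" using n mpos by (simp add: field_simps)
      qed
      have osc: "holds_up_to M ((96 / real m / x ^ 4 + 8 * rho n / x ^ 4) / real m)
        (\<lambda>\<omega>. \<forall>k\<in>{p i..q i}. \<bar>T k \<omega> - T (p i) \<omega>\<bar> \<le> 2 * x)" if "i < m" for i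
      proof -
        have "holds_up_to M (2 * (3 * (4 / real m)\<^sup>2 + rho n * (4 / real m)) / x ^ 4)
            (\<lambda>\<omega>. \<forall>k\<in>{p i..q i}. \<bar>T k \<omega> - T (p i) \<omega>\<bar> \<le> 2 * x)"
          using pq[OF that] x m1 by (intro block_4) auto
        also have "2 * (3 * (4 / real m)\<^sup>2 + rho n * (4 / real m)) / x ^ 4 = (96 / real m / x ^ 4 + 8 * rho n / x ^ 4) / real m"
          using mpos x by (simp add: field_simps power2_eq_square)
        finally show ?thesis .
      qed
      from holds_up_to_conj[OF elim(2) holds_up_to_all[of m, OF osc]] show ?case
      proof (rule holds_up_to_mono; (intro allI ballI impI)?)
        show "2 * (\<eta> / 8) + real m * ((96 / real m / x ^ 4 + 8 * rho n / x ^ 4) / real m) \<le> \<eta>"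
          using m2 elim(4) eta mpos by simp
        fix \<omega> i and t :: real
        assume \<omega>: "(\<forall>l\<in>{n..3 * n}. \<bar>Y_self X l \<omega> - Rn n l \<omega>\<bar> \<le> \<epsilon> / 32 \<and> \<bar>T l \<omega>\<bar> \<le> 2 * K) \<and>
            (\<forall>i<m. \<forall>k\<in>{p i..q i}. \<bar>T k \<omega> - T (p i) \<omega>\<bar> \<le> 2 * x)"
          and i: "i \<le> m" and t: "t \<in> {0..1}" and it: "\<bar>real m * t - real i\<bar> < 1"
        have Yk: "\<bar>Y_self X k \<omega> - Y_self X (p j) \<omega>\<bar> \<le> \<epsilon> / 4" if j: "j < m" and k: "k \<in> {p j..q j}" for j k
        proof -
          have kk: "k \<in> {n..3*n}" "p j \<in> {n..3*n}" using pq[OF j] k by auto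
          have "\<bar>Rn n k \<omega> - Rn n (p j) \<omega>\<bar> \<le> \<bar>T k \<omega> - T (p j) \<omega>\<bar> + 2 * K * (real (k - p j) / real n)"
            using kk k n \<omega> by (intro Rn_diff_le) auto
          also have "\<bar>T k \<omega> - T (p j) \<omega>\<bar> \<le> 2 * x" using \<omega> j k by blast
          also have "2 * K * (real (k - p j) / real n) \<le> 2 * K * (4 / real m)"
          proof (rule mult_left_mono)
            have "real (k - p j) / real n \<le> real (q j - p j) / real n"
              using k by (intro divide_right_mono) auto
            then show "real (k - p j) / real n \<le> 4 / real m" using pq(4)[OF j] by linarith
          qed (use K in simp)
          finally have "\<bar>Rn n k \<omega> - Rn n (p j) \<omega>\<bar> \<le> 2 * x + \<epsilon> / 16" using m3 by linarith
          moreover have "\<bar>Y_self X k \<omega> - Rn n k \<omega>\<bar> \<le> \<epsilon> / 32" "\<bar>Y_self X (p j) \<omega> - Rn n (p j) \<omega>\<bar> \<le> \<epsilon> / 32"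
            using kk \<omega> by auto
          ultimately show ?thesis unfolding x_def by linarith
        qed
        have Yt: "\<bar>Yproc X n \<omega> s - Y_self X (p j) \<omega>\<bar> \<le> \<epsilon> / 4"
          if j: "j < m" and s: "real j / real m \<le> s" "s \<le> real (Suc j) / real m" for j s
        proof (rule Yproc_close)
          show "0 \<le> s" using s(1) by (smt (verit) divide_nonneg_nonneg of_nat_0_le_iff)
          have "p j \<le> idx n s" "Suc (idx n s) \<le> q j"
            unfolding p_def q_def using s by (auto intro!: idx_mono)
          then show "\<bar>Y_self X (idx n s) \<omega> - Y_self X (p j) \<omega>\<bar> \<le> \<epsilon> / 4"
            "\<bar>Y_self X (Suc (idx n s)) \<omega> - Y_self X (p j) \<omega>\<bar> \<le> \<epsilon> / 4"
            by (intro Yk[OF j]; simp)+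
        qed
        consider "t = real i / real m" | "i < m" "real i / real m \<le> t" | j where "i = Suc j" "t \<le> real i / real m"
          using i t mpos by (cases "i = m"; cases i; force simp: not_less)
        then show "\<bar>Yproc X n \<omega> t - Yproc X n \<omega> (real i / real m)\<bar> \<le> \<epsilon>"
        proof cases
          case 1
          then show ?thesis using eps by simp
        next
          case 2
          have "t \<le> real (Suc i) / real m" using it mpos by (simp add: field_simps abs_less_iff)
          then have "\<bar>Yproc X n \<omega> t - Y_self X (p i) \<omega>\<bar> \<le> \<epsilon> / 4" by (rule Yt[OF 2])
          moreover have "\<bar>Yproc X n \<omega> (real i / real m) - Y_self X (p i) \<omega>\<bar> \<le> \<epsilon> / 4"
            by (rule Yt[OF 2(1) order.refl]) (simp add: divide_right_mono)
          ultimately show ?thesis using eps by linarith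
        next
          case 3
          have j: "j < m" using 3 i by simp
          have "real j / real m \<le> t" using it mpos 3 by (simp add: field_simps abs_less_iff)
          then have "\<bar>Yproc X n \<omega> t - Y_self X (p j) \<omega>\<bar> \<le> \<epsilon> / 4"
            by (rule Yt[OF j]) (use 3 in simp)
          moreover have "\<bar>Yproc X n \<omega> (real i / real m) - Y_self X (p j) \<omega>\<bar> \<le> \<epsilon> / 4"
            by (rule Yt[OF j]) (use 3 in \<open>simp_all add: divide_right_mono\<close>)
          ultimately show ?thesis using eps by linarith
        qed
      qed
    qed
  qed
qed

text \<open>At a single time only the step from l to l + 1 matters. Its variance is 1/n, so second
  moments suffice.\<close>

lemma Yproc_close_R:
  assumes t: "t \<in> {0..1}" and delta: "0 < \<delta>"
  shows "\<forall>\<^sub>F n in sequentially. holds_up_to M \<delta> (\<lambda>\<omega>. \<bar>Yproc X n \<omega> t - Rn n (idx n t) \<omega>\<bar> \<le> \<delta>)"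
proof -
  obtain K where K: "0 < K" "6 / K\<^sup>2 \<le> \<delta> / 4" using chebyshev_level[of "\<delta> / 4"] delta by auto
  define x where "x = \<delta> / 8"
  have x: "0 < x" using delta by (simp add: x_def)
  have close: "\<forall>\<^sub>F n in sequentially. holds_up_to M (2 * (\<delta> / 4))
     (\<lambda>\<omega>. \<forall>l\<in>{n..3*n}. \<bar>Y_self X l \<omega> - Rn n l \<omega>\<bar> \<le> \<delta> / 4 \<and> \<bar>row_sum n l \<omega>\<bar> \<le> 2 * K)"
    using delta K by (intro Y_self_close) auto
  have "(\<lambda>n. 2 * (1 / real n) / x\<^sup>2) \<longlonglongrightarrow> 2 * 0 / x\<^sup>2"
    using x by (intro tendsto_intros lim_1_over_n) simp
  then have ev1: "\<forall>\<^sub>F n in sequentially. 2 * (1 / real n) / x\<^sup>2 < \<delta> / 2"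
    by (rule order_tendstoD(2)) (use delta in simp)
  have "(\<lambda>n. 2 * K * (1 / real n)) \<longlonglongrightarrow> 2 * K * 0"
    by (intro tendsto_intros lim_1_over_n)
  then have ev2: "\<forall>\<^sub>F n in sequentially. 2 * K * (1 / real n) < \<delta> / 4"
    by (rule order_tendstoD(2)) (use delta in simp)
  from array close eventually_ge_at_top[of 10] ev1 ev2 show ?thesis
  proof eventually_elim
    case (elim n)
    then have row: "row_array M (xi n) n (rho n) (C n)" and n: "10 \<le> n" by auto
    interpret row_array M "xi n" n "rho n" "C n" by (rule row)
    define l where "l = idx n t"
    have l: "n \<le> l" "Suc l \<le> 3 * n" unfolding l_def using idx_ge idx_less_3n[OF n t] by auto
    have "holds_up_to M (2 * (\<delta> / 4) + 2 * (1 / real n) / x\<^sup>2) (\<lambda>\<omega>.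
       (\<forall>l\<in>{n..3*n}. \<bar>Y_self X l \<omega> - Rn n l \<omega>\<bar> \<le> \<delta> / 4 \<and> \<bar>T l \<omega>\<bar> \<le> 2 * K) \<and>
       (\<forall>k\<in>{l..Suc l}. \<bar>T k \<omega> - T l \<omega>\<bar> \<le> 2 * x))"
      using x elim(2) by (intro holds_up_to_conj block_2) auto
    then show ?case
      unfolding l_def[symmetric]
    proof (rule holds_up_to_mono)
      show "2 * (\<delta> / 4) + 2 * (1 / real n) / x\<^sup>2 \<le> \<delta>" using elim(4) by linarith
      fix \<omega> assume \<omega>: "(\<forall>l\<in>{n..3*n}. \<bar>Y_self X l \<omega> - Rn n l \<omega>\<bar> \<le> \<delta> / 4 \<and> \<bar>T l \<omega>\<bar> \<le> 2 * K) \<and>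
       (\<forall>k\<in>{l..Suc l}. \<bar>T k \<omega> - T l \<omega>\<bar> \<le> 2 * x)"
      show "\<bar>Yproc X n \<omega> t - Rn n l \<omega>\<bar> \<le> \<delta>"
      proof (rule Yproc_close)
      show "0 \<le> t" using t by simp
      have Yl: "\<bar>Y_self X l \<omega> - Rn n l \<omega>\<bar> \<le> \<delta> / 4" "\<bar>Y_self X (Suc l) \<omega> - Rn n (Suc l) \<omega>\<bar> \<le> \<delta> / 4"
        using l \<omega> by auto
      then show "\<bar>Y_self X (idx n t) \<omega> - Rn n l \<omega>\<bar> \<le> \<delta>" using delta unfolding l_def by linarith
      have "\<bar>Rn n (Suc l) \<omega> - Rn n l \<omega>\<bar> \<le> \<bar>T (Suc l) \<omega> - T l \<omega>\<bar> + 2 * K * (real (Suc l - l) / real n)"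
        using l n \<omega> by (intro Rn_diff_le) auto
      moreover have "\<bar>T (Suc l) \<omega> - T l \<omega>\<bar> \<le> 2 * x" using \<omega> by simp
      moreover have "2 * K * (real (Suc l - l) / real n) < \<delta> / 4" using elim by simp
      ultimately show "\<bar>Y_self X (Suc (idx n t)) \<omega> - Rn n l \<omega>\<bar> \<le> \<delta>"
        using Yl(2) delta unfolding x_def l_def[symmetric] by linarith
      qed
    qed
  qed
qed

text \<open>As \<open>idx n t\<close> / n tends to exp t, the normalized Brownian covariance in
  \<open>expectation_cos_fdd\<close> tends to the expression in \<open>min_exp_correlation\<close>,
  and the error there vanishes with \<open>rho n\<close> and 1/n.\<close>

lemma fdd_R:
  fixes ts :: "nat \<Rightarrow> real"
  assumes ts: "\<And>i. i < k \<Longrightarrow> ts i \<in> {0..1}"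
  shows "(\<lambda>n. expectation (\<lambda>\<omega>. cos (a + (\<Sum>i<k. c i * Rn n (idx n (ts i)) \<omega>)))) \<longlonglongrightarrow>
     cos a * exp (- (\<Sum>i<k. \<Sum>j<k. c i * c j * exp (- \<bar>ts i - ts j\<bar> / 2)) / 2)"
proof -
  define r where "r n i = real (idx n (ts i)) / real n" for n i
  define v where "v n = (\<Sum>i<k. \<Sum>j<k. c i * c j *
         (real (min (idx n (ts i)) (idx n (ts j))) / real n / (sqrt (r n i) * sqrt (r n j))))" for n
  have r: "(\<lambda>n. r n i) \<longlonglongrightarrow> exp (ts i)" if "i < k" for i
    unfolding r_def using ts[OF that] by (intro idx_tendsto) auto
  have v: "v \<longlonglongrightarrow> (\<Sum>i<k. \<Sum>j<k. c i * c j * exp (- \<bar>ts i - ts j\<bar> / 2))"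
    unfolding v_def[abs_def]
  proof (intro tendsto_sum tendsto_mult tendsto_const)
    fix i j assume ij: "i \<in> {..<k}" "j \<in> {..<k}"
    have "(\<lambda>n. min (r n i) (r n j) / (sqrt (r n i) * sqrt (r n j))) \<longlonglongrightarrow>
       min (exp (ts i)) (exp (ts j)) / (sqrt (exp (ts i)) * sqrt (exp (ts j)))"
      using ij by (intro tendsto_divide tendsto_min tendsto_mult tendsto_real_sqrt r) auto
    moreover have "real (min (idx n (ts i)) (idx n (ts j))) / real n = min (r n i) (r n j)" for n
      unfolding r_def by (cases "n = 0") (auto simp: min_def divide_le_cancel)
    ultimately show "(\<lambda>n. real (min (idx n (ts i)) (idx n (ts j))) / real n / (sqrt (r n i) * sqrt (r n j)))
       \<longlonglongrightarrow> exp (- \<bar>ts i - ts j\<bar> / 2)" by (simp add: min_exp_correlation)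
  qed
  have "(\<lambda>n. expectation (\<lambda>\<omega>. cos (a + (\<Sum>i<k. c i * Rn n (idx n (ts i)) \<omega>))) - cos a * exp (- v n / 2)) \<longlonglongrightarrow> 0"
  proof (rule Lim_null_comparison)
    have "(\<lambda>n. (\<Sum>i<k. \<bar>c i\<bar>) ^ 4 * (rho n + 1 / real n)) \<longlonglongrightarrow> (\<Sum>i<k. \<bar>c i\<bar>) ^ 4 * (0 + 0)"
      by (intro tendsto_intros rho0 lim_1_over_n)
    then show "(\<lambda>n. (\<Sum>i<k. \<bar>c i\<bar>) ^ 4 * (rho n + 1 / real n)) \<longlonglongrightarrow> 0" by simp
    show "\<forall>\<^sub>F n in sequentially. norm (expectation (\<lambda>\<omega>. cos (a + (\<Sum>i<k. c i * Rn n (idx n (ts i)) \<omega>))) - cos a * exp (- v n / 2))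
       \<le> (\<Sum>i<k. \<bar>c i\<bar>) ^ 4 * (rho n + 1 / real n)"
      using array eventually_ge_at_top[of 10]
    proof eventually_elim
      case (elim n)
      then interpret row_array M "xi n" n "rho n" "C n" by blast
      have "n \<le> idx n (ts i)" "idx n (ts i) \<le> 3 * n" if "i < k" for i
        using idx_ge idx_less_3n[OF elim(2) ts[OF that]] by auto
      from expectation_cos_fdd[of k "\<lambda>i. idx n (ts i)" a c, OF this]
      show ?case unfolding Rn_def v_def r_def real_norm_def by blast
    qed
  qed
  moreover have "(\<lambda>n. cos a * exp (- v n / 2)) \<longlonglongrightarrow>
      cos a * exp (- (\<Sum>i<k. \<Sum>j<k. c i * c j * exp (- \<bar>ts i - ts j\<bar> / 2)) / 2)"
    by (intro tendsto_intros v) auto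
  ultimately show ?thesis by (rule Lim_transform[rotated])
qed

lemma fdd_Yproc:
  fixes ts :: "nat \<Rightarrow> real"
  assumes ts: "\<And>i. i < k \<Longrightarrow> ts i \<in> {0..1}"
  shows "(\<lambda>n. expectation (\<lambda>\<omega>. cos (a + (\<Sum>i<k. c i * Yproc X n \<omega> (ts i))))) \<longlonglongrightarrow>
     cos a * exp (- (\<Sum>i<k. \<Sum>j<k. c i * c j * exp (- \<bar>ts i - ts j\<bar> / 2)) / 2)"
proof (rule Lim_transform[OF fdd_R[OF ts]])
  define s where "s = (\<Sum>i<k. \<bar>c i\<bar>)"
  have s: "0 \<le> s" unfolding s_def by (intro sum_nonneg) auto
  show "(\<lambda>n. expectation (\<lambda>\<omega>. cos (a + (\<Sum>i<k. c i * Yproc X n \<omega> (ts i)))) -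
      expectation (\<lambda>\<omega>. cos (a + (\<Sum>i<k. c i * Rn n (idx n (ts i)) \<omega>)))) \<longlonglongrightarrow> 0"
  proof (rule tendstoI)
    fix e :: real assume e: "0 < e"
    \<comment> \<open>Since the cosine is 1-Lipschitz, the integrands differ by at most s \<delta>
      off an exceptional set and by at most 2 on it; that set has probability at most k
      \<delta>.\<close>
    define \<delta> where "\<delta> = e / (2 * (s + 2 * real k + 1))"
    have sk: "0 < s + 2 * real k + 1" using s by linarith
    have delta: "0 < \<delta>" using e s unfolding \<delta>_def by (intro divide_pos_pos) auto
    have "\<forall>\<^sub>F n in sequentially. \<forall>i\<in>{..<k}. holds_up_to M \<delta> (\<lambda>\<omega>. \<bar>Yproc X n \<omega> (ts i) - Rn n (idx n (ts i)) \<omega>\<bar> \<le> \<delta>)"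
    proof (rule eventually_ball_finite)
      show "\<forall>i\<in>{..<k}. \<forall>\<^sub>F n in sequentially. holds_up_to M \<delta> (\<lambda>\<omega>. \<bar>Yproc X n \<omega> (ts i) - Rn n (idx n (ts i)) \<omega>\<bar> \<le> \<delta>)"
        by (intro ballI Yproc_close_R ts delta) simp
    qed simp
    with array show "\<forall>\<^sub>F n in sequentially. dist (expectation (\<lambda>\<omega>. cos (a + (\<Sum>i<k. c i * Yproc X n \<omega> (ts i)))) -
      expectation (\<lambda>\<omega>. cos (a + (\<Sum>i<k. c i * Rn n (idx n (ts i)) \<omega>)))) 0 < e"
    proof eventually_elim
      case (elim n)
      then interpret row_array M "xi n" n "rho n" "C n" by blast
      have "holds_up_to M (real k * \<delta>) (\<lambda>\<omega>. \<forall>i<k. \<bar>Yproc X n \<omega> (ts i) - Rn n (idx n (ts i)) \<omega>\<bar> \<le> \<delta>)"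
        using elim(2) by (intro holds_up_to_all) auto
      then obtain A where [measurable]: "A \<in> sets M" and PA: "measure M A \<le> real k * \<delta>"
        and A: "\<And>i \<omega>. i < k \<Longrightarrow> \<omega> \<in> space M - A \<Longrightarrow> \<bar>Yproc X n \<omega> (ts i) - Rn n (idx n (ts i)) \<omega>\<bar> \<le> \<delta>"
        unfolding holds_up_to_def by blast
      have [measurable]: "(\<lambda>\<omega>. Yproc X n \<omega> t) \<in> borel_measurable M" for t
        by (rule Yproc_measurable[OF mX])
      have [measurable]: "Rn n l \<in> borel_measurable M" for l
        unfolding Rn_def[abs_def] by measurable
      let ?f = "\<lambda>\<omega>. cos (a + (\<Sum>i<k. c i * Yproc X n \<omega> (ts i)))"
      let ?g = "\<lambda>\<omega>. cos (a + (\<Sum>i<k. c i * Rn n (idx n (ts i)) \<omega>))"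
      have i: "integrable M ?f" "integrable M ?g"
        by (rule integrable_const_bound[where B=1]; simp)+
      have d: "\<bar>?f \<omega> - ?g \<omega>\<bar> \<le> s * \<delta> + 2 * indicator A \<omega>" if \<omega>: "\<omega> \<in> space M" for \<omega>
      proof (cases "\<omega> \<in> A")
        case True
        have "\<bar>?f \<omega> - ?g \<omega>\<bar> \<le> \<bar>?f \<omega>\<bar> + \<bar>?g \<omega>\<bar>" by (rule abs_triangle_ineq4)
        also have "\<dots> \<le> 1 + 1" by (intro add_mono abs_cos_le_one)
        also have "\<dots> \<le> s * \<delta> + 2 * indicator A \<omega>" using True s delta by simp
        finally show ?thesis .
      next
        case False
        have "\<bar>?f \<omega> - ?g \<omega>\<bar> \<le> \<bar>\<Sum>i<k. c i * (Yproc X n \<omega> (ts i) - Rn n (idx n (ts i)) \<omega>)\<bar>"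
          by (rule order.trans[OF abs_cos_diff_le]) (simp add: right_diff_distrib sum_subtractf)
        also have "\<dots> \<le> (\<Sum>i<k. \<bar>c i\<bar> * \<delta>)"
        proof (intro order.trans[OF sum_abs] sum_mono)
          fix i assume "i \<in> {..<k}"
          then show "\<bar>c i * (Yproc X n \<omega> (ts i) - Rn n (idx n (ts i)) \<omega>)\<bar> \<le> \<bar>c i\<bar> * \<delta>"
            using A[of i \<omega>] False \<omega> by (auto simp: abs_mult intro!: mult_left_mono)
        qed
        also have "\<dots> = s * \<delta>" unfolding s_def by (simp add: sum_distrib_right)
        finally show ?thesis using False by simp
      qed
      have "\<bar>expectation ?f - expectation ?g\<bar> = \<bar>expectation (\<lambda>\<omega>. ?f \<omega> - ?g \<omega>)\<bar>" using i by simp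
      also have "\<dots> \<le> expectation (\<lambda>\<omega>. s * \<delta> + 2 * indicator A \<omega>)"
        using d i by (intro order.trans[OF integral_abs_bound] integral_mono) (auto simp: less_top[symmetric])
      also have "\<dots> = s * \<delta> + 2 * measure M A" by (simp add: prob_space less_top[symmetric])
      also have "\<dots> \<le> (s + 2 * real k + 1) * \<delta>" using PA delta by (simp add: algebra_simps)
      also have "\<dots> = e / 2" using sk unfolding \<delta>_def by (simp add: divide_simps)
      finally show ?case using e by (simp add: dist_real_def)
    qed
  qed
qed

end

theorem theorem2p1:
  fixes M :: "'a measure" and X :: "nat \<Rightarrow> 'a \<Rightarrow> real"
    and Q :: "'b measure" and Z :: "real \<Rightarrow> 'b \<Rightarrow> real"
  assumes "prob_space M"
    and "\<And>i. i \<ge> 1 \<Longrightarrow> X i \<in> borel_measurable M"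
    and "prob_space.indep_vars M (\<lambda>_. borel) X {1..}"
    and "\<And>i. i \<ge> 1 \<Longrightarrow> distr M borel (X i) = distr M borel (X 1)"
    and "distr M borel (\<lambda>\<omega>. - X 1 \<omega>) = distr M borel (X 1)"
    and "measure M {\<omega>\<in>space M. X 1 \<omega> = 0} = 0"
    and "in_DA_normal M X"
    and "stationary_OU Q Z"
  shows "weak_conv_C01 M (\<lambda>n \<omega>. Yproc X n \<omega>) Q (\<lambda>\<omega> t. Z t \<omega>)"
proof -
  obtain xi :: "nat \<Rightarrow> nat \<Rightarrow> 'a \<Rightarrow> real" and b rho C :: "nat \<Rightarrow> real" where rho: "rho \<longlonglongrightarrow> 0"
    and array: "\<forall>\<^sub>F n in sequentially. row_array M (xi n) n (rho n) (C n) \<and> b n > 0 \<and>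
      holds_up_to M (3 * rho n) (\<lambda>\<omega>. \<forall>j\<in>{1..3*n}. X j \<omega> = b n * xi n j \<omega>)"
    by (rule array_reduction[OF assms(1-5,7)])
  show ?thesis
  proof (rule weak_conv_C01_criterion)
    show "prob_space M" by (rule assms(1))
    show "prob_space Q" using assms(8) unfolding stationary_OU_def by blast
    show "(\<lambda>t. Z t \<omega>) \<in> C01" if "\<omega> \<in> space Q" for \<omega>
      using assms(8) that unfolding stationary_OU_def C01_def by auto
    show "Z t \<in> borel_measurable Q" if "t \<in> {0..1}" for t
      using assms(8) that unfolding stationary_OU_def by auto
    show "Yproc X n \<omega> \<in> C01" for n \<omega> by (rule Yproc_C01)
    show "(\<lambda>\<omega>. Yproc X n \<omega> t) \<in> borel_measurable M" for n t by (rule Yproc_measurable[OF assms(2)])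
    show "(\<lambda>n. \<integral>\<omega>. cos (a + (\<Sum>i<k. c i * Yproc X n \<omega> (ts i))) \<partial>M) \<longlonglongrightarrow>
       (\<integral>\<omega>. cos (a + (\<Sum>i<k. c i * Z (ts i) \<omega>)) \<partial>Q)" if "\<And>i::nat. i < k \<Longrightarrow> ts i \<in> {0..1}" for k ts c a
    proof (subst stationary_OU_cos[OF assms(8)])
      show "(\<lambda>n. \<integral>\<omega>. cos (a + (\<Sum>i<k. c i * Yproc X n \<omega> (ts i))) \<partial>M) \<longlonglongrightarrow>
         cos a * exp (- (\<Sum>i<k. \<Sum>j<k. c i * c j * exp (- \<bar>ts i - ts j\<bar> / 2)) / 2)"
        by (rule fdd_Yproc[OF assms(1,2) rho array that])
    qed (rule that)
    show "\<exists>m0. \<forall>m\<ge>m0. \<forall>\<^sub>F n in sequentially.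
       holds_up_to M \<eta> (\<lambda>\<omega>. \<forall>i\<le>m. \<forall>t\<in>{0..1}.
          \<bar>real m * t - real i\<bar> < 1 \<longrightarrow> \<bar>Yproc X n \<omega> t - Yproc X n \<omega> (real i / real m)\<bar> \<le> \<epsilon>)"
      if "\<epsilon> > 0" "\<eta> > 0" for \<epsilon> \<eta>
      by (rule Yproc_modulus[OF assms(1,2) rho array that])
  qed
qed

end
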